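(* Let $q\in\mathbb{N}$, let $\mathcal{H}$ be a complex Hilbert space, let $(g_j)_{j=-\infty}^\infty$ be a stationary sequence in $\mathcal{H}^q$ with covariance sequence $(C_j)_{j=-\infty}^\infty$, and let $n\in\mathbb{N}$. Suppose that $(g_j)_{j=-\infty}^\infty$ is autoregressive of order $n$. Then $\Lambda_n$ (built from $(C_j)_{j=0}^n$ as described in the context) is holomorphic at each point $u\in\mathbb{T}$, and the non-stochastic spectral measure $\mu$ of $(g_j)_{j=-\infty}^\infty$ admits, for all Borel subsets $B$ of $\mathbb{T}$, the representation $$\mu(B)=\frac1{2\pi}\int_B\operatorname{Re}\Lambda_n(\zeta)\,\lambda(d\zeta)+\sum_{v\in\mathcal{N}_n}X_{n,v}\,\delta_v(B).$$
   Context: $\mathbb{T}$ is the unit circle; $\operatorname{Re}A=\frac12(A+A^* )$; $A^\dagger$ is the Moore–Penrose inverse; $A^\sharp$ the classical adjugate; $\lambda$ the linear Lebesgue (arc length, total mass $2\pi$) measure on the Borel sets of $\mathbb{T}$; $\delta_v$ the Dirac measure at $v$. Empty sums are zero matrices. **Stationary sequences.** For $g=(g^{(1)},\dots,g^{(q)})^{T}$ and $h=(h^{(1)},\dots,h^{(q)})^{T}$ in $\mathcal{H}^q$ the Gramian is $(g,h):=[\langle g^{(j)},h^{(k)}\rangle]_{j,k=1}^q$. A sequence $(g_m)_{m=-\infty}^\infty$ in $\mathcal{H}^q$ is stationary if $(g_m,g_n)=(g_{m-n},g_0)$ for all $m,n\in\mathbb{Z}$; its covariance sequence is $C_m:=(g_m,g_0)$.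 All block Toeplitz matrices $[C_{j-k}]_{j,k=0}^m$ are then non-negative Hermitian, and by Herglotz' theorem there is a unique non-negative Hermitian $q\times q$ measure $\mu$ on $\mathbb{T}$ (countably additive map from the Borel sets of $\mathbb{T}$ into the non-negative Hermitian $q\times q$ matrices) with $\int_{\mathbb{T}}\zeta^{-j}\mu(d\zeta)=C_j$ for all $j\in\mathbb{Z}$; $\mu$ is the non-stochastic spectral measure of the sequence. **Autoregressive.** The matrix linear subspace generated by a family in $\mathcal{H}^q$ is the set of all finite sums $\sum A_jg_j$ with $A_j\in\mathbb{C}^{q\times q}$ and $g_j$ in the family ($\mathcal{H}^q$ is viewed as a Hilbert space with inner product given by the trace of the Gramian). For $n\in\mathbb{N}$ let $\hat g_n$ be the orthogonal projection of $g_0$ onto the matrix linear subspace generated by $g_{-1},\dots,g_{-n}$, and $\hat g$ the orthogonal projection of $g_0$ onto the closed matrix linear subspace generated by $(g_{-j})_{j=1}^\infty$. The stationary sequence is autoregressive if $\hat g_n=\hat g$ for some $n\in\mathbb{N}$; if $\hat g\ne0$, the smallest such $n$ is its order; if $\hat g=0$, it is autoregressive of order $0$. **The objects in the formula.** Let $T_m:=[C_{j-k}]_{j,k=0}^m$, $Y_n$ the block column with blocks $C_1,\dots,C_n$ (top to bottom), $\Gamma_0:=\operatorname{Re}C_0$ $(=C_0)$, $\Gamma_j:=2C_j$ for $j\ge1$, $S_m:=[\Gamma_{j-k}]_{j,k=0}^m$ with $\Gamma_l:=0$ for $l<0$ (lower triangular block Toeplitz), $e_m(z):=[z^0I_q,z^1I_q,\dots,z^mI_q]$,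 and $$a_n(z):=\Gamma_0+z\,e_{n-1}(z)S_{n-1}^*T_{n-1}^\dagger Y_n,\qquad b_n(z):=I_q-z\,e_{n-1}(z)T_{n-1}^\dagger Y_n .$$ ($\det b_n$ does not vanish identically since $b_n(0)=I_q$.) Let $\mathcal{N}_n:=\{v\in\mathbb{T}:\det b_n(v)=0\}$, a finite set; for $v\in\mathcal{N}_n$ let $m_v$ be the multiplicity of $v$ as a zero of $\det b_n$ and $$X_{n,v}:=\frac{-m_v}{2v(\det b_n)^{(m_v)}(v)}\,(a_nb_n^\sharp)^{(m_v-1)}(v).$$ Let $\Delta_n(z):=\sum_{v\in\mathcal{N}_n}\frac{v+z}{v-z}X_{n,v}$ for $z\in\mathbb{C}\setminus\mathcal{N}_n$ and $\Lambda_n:=a_nb_n^{-1}-\Delta_n$, a rational matrix function (removable singularities removed). *)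

theory Defs
  imports "HOL-Complex_Analysis.Complex_Analysis"
begin

section \<open>Complex Hilbert spaces\<close>

text \<open>The inner product is linear in the first argument, so that the Gramian satisfies
  \<open>(A g, h) = A (g, h)\<close>. Completeness is part of \<open>banach\<close>; \<open>scaleC 1 x = x\<close> and positive
  definiteness follow from the axioms on \<open>scaleR\<close> and \<open>norm\<close>.\<close>

class complex_hilbert = banach +
  fixes scaleC :: "complex \<Rightarrow> 'a \<Rightarrow> 'a" (infixr "*\<^sub>C" 75)
    and cinner :: "'a \<Rightarrow> 'a \<Rightarrow> complex"
  assumes scaleC_add_right: "c *\<^sub>C (x + y) = c *\<^sub>C x + c *\<^sub>C y"
    and scaleC_add_left: "(c + d) *\<^sub>C x = c *\<^sub>C x + d *\<^sub>C x"
    and scaleC_scaleC: "c *\<^sub>C (d *\<^sub>C x) = (c * d) *\<^sub>C x"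
    and scaleR_scaleC: "r *\<^sub>R x = complex_of_real r *\<^sub>C x"
    and cinner_commute: "cinner x y = cnj (cinner y x)"
    and cinner_add_left: "cinner (x + y) z = cinner x z + cinner y z"
    and cinner_scaleC_left: "cinner (c *\<^sub>C x) y = c * cinner x y"
    and cinner_self: "cinner x x = complex_of_real ((norm x)\<^sup>2)"

instantiation complex :: complex_hilbert
begin

definition scaleC_complex :: "complex \<Rightarrow> complex \<Rightarrow> complex"
  where "scaleC_complex c x = c * x"

definition cinner_complex :: "complex \<Rightarrow> complex \<Rightarrow> complex"
  where "cinner_complex x y = x * cnj y"

instance
  by standard
    (auto simp: scaleC_complex_def cinner_complex_def algebra_simps scaleR_conv_of_real
      complex_norm_square[symmetric])

end


section \<open>Complex matrices\<close>

definition mscale :: "complex \<Rightarrow> complex^'n^'m \<Rightarrow> complex^'n^'m"  (infixr "*\<^sub>m" 75)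
  where "c *\<^sub>m A = (\<chi> i j. c * A $ i $ j)"

definition ctranspose :: "complex^'n^'m \<Rightarrow> complex^'m^'n"
  where "ctranspose A = (\<chi> i j. cnj (A $ j $ i))"

definition mRe :: "complex^'n^'n \<Rightarrow> complex^'n^'n"
  where "mRe A = (1 / 2) *\<^sub>m (A + ctranspose A)"

definition nonneg_hermitian :: "complex^'n^'n \<Rightarrow> bool"
  where "nonneg_hermitian A \<longleftrightarrow> ctranspose A = A \<and>
    (\<forall>u. 0 \<le> Re (\<Sum>i\<in>UNIV. \<Sum>j\<in>UNIV. cnj (u $ i) * A $ i $ j * u $ j))"

text \<open>The classical adjugate. Its \<open>(i, j)\<close> entry is the cofactor of \<open>A\<close> at \<open>(j, i)\<close>, the
  signed minor obtained by deleting row \<open>j\<close> and column \<open>i\<close>. As the index type carries no order,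
  the signed minor is written as the determinant of \<open>A\<close> with that row and column replaced
  by unit vectors.\<close>

definition adjugate :: "complex^'n^'n \<Rightarrow> complex^'n^'n"
  where "adjugate A = (\<chi> i j. det (\<chi> k l.
    if k = j \<and> l = i then 1 else if k = j \<or> l = i then 0 else A $ k $ l))"


section \<open>Block matrices\<close>

text \<open>The number of blocks varies, so a block matrix with \<open>N \<times> N\<close> blocks is a function of two
  block indices in \<open>{..<N}\<close>, and a block row or block column is a function of one such index.\<close>

type_synonym 'q blockmat = "nat \<Rightarrow> nat \<Rightarrow> complex^'q^'q"
type_synonym 'q blockvec = "nat \<Rightarrow> complex^'q^'q"

definition block_mult :: "nat \<Rightarrow> ('q::finite) blockmat \<Rightarrow> 'q blockmat \<Rightarrow> 'q blockmat"
  where "block_mult N A B = (\<lambda>j k. \<Sum>l<N. A j l ** B l k)"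

definition block_mult_col :: "nat \<Rightarrow> ('q::finite) blockmat \<Rightarrow> 'q blockvec \<Rightarrow> 'q blockvec"
  where "block_mult_col N A Y = (\<lambda>j. \<Sum>l<N. A j l ** Y l)"

definition block_row_col :: "nat \<Rightarrow> ('q::finite) blockvec \<Rightarrow> 'q blockvec \<Rightarrow> complex^'q^'q"
  where "block_row_col N X Y = (\<Sum>l<N. X l ** Y l)"

definition block_adjoint :: "('q::finite) blockmat \<Rightarrow> 'q blockmat"
  where "block_adjoint A = (\<lambda>j k. ctranspose (A k j))"

definition block_eq :: "nat \<Rightarrow> ('q::finite) blockmat \<Rightarrow> 'q blockmat \<Rightarrow> bool"
  where "block_eq N A B \<longleftrightarrow> (\<forall>j<N. \<forall>k<N. A j k = B j k)"

text \<open>The Moore--Penrose inverse, given by the four Penrose equations. Entries outside the block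
  index range are set to zero, which makes the function representing it unique.\<close>

definition block_pinv :: "nat \<Rightarrow> ('q::finite) blockmat \<Rightarrow> 'q blockmat"
  where "block_pinv N A = (THE X.
    block_eq N (block_mult N (block_mult N A X) A) A \<and>
    block_eq N (block_mult N (block_mult N X A) X) X \<and>
    block_eq N (block_adjoint (block_mult N A X)) (block_mult N A X) \<and>
    block_eq N (block_adjoint (block_mult N X A)) (block_mult N X A) \<and>
    (\<forall>j k. \<not> (j < N \<and> k < N) \<longrightarrow> X j k = 0))"


section \<open>Stationary and autoregressive sequences\<close>

definition gramian :: "('h::complex_hilbert)^'q \<Rightarrow> 'h^'q \<Rightarrow> complex^'q^'q"
  where "gramian g h = (\<chi> j k. cinner (g $ j) (h $ k))"

definition stationary :: "(int \<Rightarrow> ('h::complex_hilbert)^'q) \<Rightarrow> bool"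
  where "stationary g \<longleftrightarrow> (\<forall>m n. gramian (g m) (g n) = gramian (g (m - n)) (g 0))"

definition covariance :: "(int \<Rightarrow> ('h::complex_hilbert)^'q) \<Rightarrow> int \<Rightarrow> complex^'q^'q"
  where "covariance g m = gramian (g m) (g 0)"

definition mat_act :: "complex^'q^'q \<Rightarrow> ('h::complex_hilbert)^'q \<Rightarrow> 'h^'q"
  where "mat_act A h = (\<chi> j. \<Sum>k\<in>UNIV. (A $ j $ k) *\<^sub>C (h $ k))"

definition matrix_span :: "(('h::complex_hilbert)^('q::finite)) set \<Rightarrow> ('h^'q) set"
  where "matrix_span G = {\<Sum>x\<in>F. mat_act (A x) x | F A. finite F \<and> F \<subseteq> G}"

text \<open>Orthogonality refers to the inner product \<open>trace (gramian x y)\<close>; the library norm on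
  \<open>'h^'q\<close> is the norm of this inner product.\<close>

definition orth_proj :: "(('h::complex_hilbert)^'q) set \<Rightarrow> 'h^'q \<Rightarrow> 'h^'q"
  where "orth_proj S x = (THE p. p \<in> S \<and> (\<forall>y\<in>S. trace (gramian (x - p) y) = 0))"

definition predictor :: "(int \<Rightarrow> ('h::complex_hilbert)^'q) \<Rightarrow> nat \<Rightarrow> 'h^'q"
  where "predictor g n = orth_proj (matrix_span {g (- int j) | j. 1 \<le> j \<and> j \<le> n}) (g 0)"

definition full_predictor :: "(int \<Rightarrow> ('h::complex_hilbert)^'q) \<Rightarrow> 'h^'q"
  where "full_predictor g = orth_proj (closure (matrix_span {g (- int j) | j. 1 \<le> j})) (g 0)"

definition autoregressive :: "(int \<Rightarrow> ('h::complex_hilbert)^'q) \<Rightarrow> bool"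
  where "autoregressive g \<longleftrightarrow> stationary g \<and> (\<exists>n\<ge>1. predictor g n = full_predictor g)"

definition ar_order :: "(int \<Rightarrow> ('h::complex_hilbert)^'q) \<Rightarrow> nat"
  where "ar_order g = (if full_predictor g = 0 then 0
    else (LEAST n. 1 \<le> n \<and> predictor g n = full_predictor g))"


section \<open>Non-negative Hermitian measures on the unit circle\<close>

text \<open>Only the \<open>\<sigma>\<close>-algebra of \<open>circle_borel\<close>, the Borel subsets of the circle, matters.\<close>

definition circle_borel :: "complex measure"
  where "circle_borel = restrict_space borel (sphere 0 1)"

definition arc_length :: "complex measure"
  where "arc_length = distr (restrict_space lborel {0..<2 * pi}) circle_borel cis"

definition nonneg_hermitian_measure :: "(complex set \<Rightarrow> complex^'q^'q) \<Rightarrow> bool"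
  where "nonneg_hermitian_measure \<mu> \<longleftrightarrow>
    (\<forall>B\<in>sets circle_borel. nonneg_hermitian (\<mu> B)) \<and>
    (\<forall>A :: nat \<Rightarrow> complex set. range A \<subseteq> sets circle_borel \<longrightarrow> disjoint_family A \<longrightarrow>
      (\<lambda>i. \<mu> (A i)) sums \<mu> (\<Union>i. A i))"

text \<open>Integration against a complex measure \<open>\<nu>\<close>: split
  \<open>\<nu> = \<nu>\<^sub>0 + \<i> \<nu>\<^sub>1 - \<nu>\<^sub>2 - \<i> \<nu>\<^sub>3\<close>
  into finite positive measures (as by Jordan decomposition of real and imaginary part) and
  integrate termwise. The value does not depend on the splitting.\<close>

definition has_cmeasure_integral ::
    "(complex set \<Rightarrow> complex) \<Rightarrow> (complex \<Rightarrow> complex) \<Rightarrow> complex \<Rightarrow> bool"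
  where "has_cmeasure_integral \<nu> f I \<longleftrightarrow> (\<exists>M :: nat \<Rightarrow> complex measure.
    (\<forall>l<4. finite_measure (M l) \<and> sets (M l) = sets circle_borel \<and> integrable (M l) f) \<and>
    (\<forall>B\<in>sets circle_borel. \<nu> B = (\<Sum>l<4. \<i> ^ l * complex_of_real (measure (M l) B))) \<and>
    I = (\<Sum>l<4. \<i> ^ l * integral\<^sup>L (M l) f))"

definition spectral_measure ::
    "(int \<Rightarrow> ('h::complex_hilbert)^'q) \<Rightarrow> (complex set \<Rightarrow> complex^'q^'q) \<Rightarrow> bool"
  where "spectral_measure g \<mu> \<longleftrightarrow> nonneg_hermitian_measure \<mu> \<and>
    (\<forall>j a b. has_cmeasure_integral (\<lambda>B. \<mu> B $ a $ b) (\<lambda>\<zeta>. \<zeta> powi (- j))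
      (covariance g j $ a $ b))"


section \<open>The matrix functions in the representation formula\<close>

text \<open>Throughout, \<open>C\<close> is the covariance sequence. Block Toeplitz matrices are given as functions
  on all block indices; \<open>T\<^sub>m\<close> and \<open>S\<^sub>m\<close> are their restrictions to \<open>m + 1\<close> blocks, so the
  subscript \<open>n - 1\<close> corresponds to the size argument \<open>n\<close> of the block operations.\<close>

definition Tmat :: "(int \<Rightarrow> complex^'q^'q) \<Rightarrow> 'q blockmat"
  where "Tmat C = (\<lambda>j k. C (int j - int k))"

definition Ycol :: "(int \<Rightarrow> complex^'q^'q) \<Rightarrow> 'q blockvec"
  where "Ycol C = (\<lambda>j. C (int j + 1))"

definition Gam :: "(int \<Rightarrow> complex^'q^'q) \<Rightarrow> int \<Rightarrow> complex^'q^'q"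
  where "Gam C l = (if l < 0 then 0 else if l = 0 then mRe (C 0) else 2 *\<^sub>m C l)"

definition Smat :: "(int \<Rightarrow> complex^'q^'q) \<Rightarrow> 'q blockmat"
  where "Smat C = (\<lambda>j k. Gam C (int j - int k))"

definition erow :: "complex \<Rightarrow> ('q::finite) blockvec"
  where "erow z = (\<lambda>k. z ^ k *\<^sub>m mat 1)"

definition afun :: "(int \<Rightarrow> complex^'q^'q) \<Rightarrow> nat \<Rightarrow> complex \<Rightarrow> complex^'q^'q"
  where "afun C n z = Gam C 0 + z *\<^sub>m block_row_col n (erow z)
    (block_mult_col n (block_adjoint (Smat C))
      (block_mult_col n (block_pinv n (Tmat C)) (Ycol C)))"

definition bfun :: "(int \<Rightarrow> complex^'q^'q) \<Rightarrow> nat \<Rightarrow> complex \<Rightarrow> complex^'q^'q"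
  where "bfun C n z = mat 1 - z *\<^sub>m block_row_col n (erow z)
    (block_mult_col n (block_pinv n (Tmat C)) (Ycol C))"

definition Nset :: "(int \<Rightarrow> complex^'q^'q) \<Rightarrow> nat \<Rightarrow> complex set"
  where "Nset C n = {v \<in> sphere 0 1. det (bfun C n v) = 0}"

definition zmult :: "(int \<Rightarrow> complex^'q^'q) \<Rightarrow> nat \<Rightarrow> complex \<Rightarrow> nat"
  where "zmult C n v = nat (zorder (\<lambda>z. det (bfun C n z)) v)"

definition Xres :: "(int \<Rightarrow> complex^'q^'q) \<Rightarrow> nat \<Rightarrow> complex \<Rightarrow> complex^'q^'q"
  where "Xres C n v =
    (- of_nat (zmult C n v) / (2 * v * (deriv ^^ zmult C n v) (\<lambda>z. det (bfun C n z)) v)) *\<^sub>m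
    (\<chi> i j. (deriv ^^ (zmult C n v - 1)) (\<lambda>z. (afun C n z ** adjugate (bfun C n z)) $ i $ j) v)"

definition Delta :: "(int \<Rightarrow> complex^'q^'q) \<Rightarrow> nat \<Rightarrow> complex \<Rightarrow> complex^'q^'q"
  where "Delta C n z = (\<Sum>v\<in>Nset C n. ((v + z) / (v - z)) *\<^sub>m Xres C n v)"

text \<open>Removable singularities are removed entrywise. The values of the expression below at the
  finitely many zeros of \<open>det (bfun C n)\<close> are arbitrary, but \<open>remove_sings\<close> ignores them.\<close>

definition Lambda :: "(int \<Rightarrow> complex^'q^'q) \<Rightarrow> nat \<Rightarrow> complex \<Rightarrow> complex^'q^'q"
  where "Lambda C n z = (\<chi> i j.
    remove_sings (\<lambda>w. (afun C n w ** matrix_inv (bfun C n w) - Delta C n w) $ i $ j) z)"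

end

theory Submission
  imports Defs
begin

text \<open>Autoregressivity means \<open>C\<^sub>k = \<Sum>\<^sub>j A\<^sub>j C\<^sub>k\<^sub>-\<^sub>j\<close> for all \<open>k \<ge> 1\<close>. The columns
  \<open>D = T\<^sup>\<dagger> Y\<close> solve the reversed system \<open>C\<^sub>k = \<Sum>\<^sub>l C\<^sub>k\<^sub>-\<^sub>l D\<^sub>l\<close> for \<open>k \<le> n\<close>, and the two
  recursions together give it for all \<open>k\<close>. Hence \<open>F = \<Sum>\<^sub>k \<Gamma>\<^sub>k z\<^sup>k\<close>, which is the Herglotz
  transform of \<open>\<mu>\<close>, satisfies \<open>F b\<^sub>n = a\<^sub>n\<close> in the disc. Since \<open>(v - z) F(z)\<close> tends radially
  to \<open>2 v \<mu>({v})\<close> at \<open>v \<in> \<T>\<close>, the rational function \<open>F\<close> has at most simple poles on \<open>\<T>\<close>, and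
  \<open>X\<^sub>v = \<mu>({v})\<close>. So \<open>\<Lambda> = F - \<Delta>\<close> is holomorphic on the closed disc, and by Cauchy's theorem
  the density \<open>Re \<Lambda> / 2\<pi>\<close> has the Fourier coefficients of \<open>\<mu>\<close> with its atoms at the zeros
  of \<open>det b\<^sub>n\<close> removed. By Stone--Weierstrass, Fourier coefficients determine a measure.\<close>

text \<open>Two obstacles shape the argument. \<open>T\<close> may be singular, so \<open>D\<close>
  is only one of possibly many solutions of its Toeplitz system, and it is not visibly related to
  the prediction coefficients \<open>A\<close>, which act from the other side. But the system is a
  Gram system, hence consistent, so the first Penrose equation alone shows that \<open>D\<close>
  solves it. The entries of \<mu> are complex measures, known only through splittings into positive
  ones; one splitting per entry is fixed, and the Herglotz transform is studied for positive
  measures and then combined linearly. The factor 2 in \<open>Gam\<close> comes from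
  \<open>(1 + w) / (1 - w) = 1 + 2 w + 2 w^2 + ...\<close>, and \<open>a_n\<close> is what is left
  of \<open>F b_n\<close> once the recursion has cancelled all coefficients beyond degree
  \<open>n\<close>. Zeros of \<open>det b_n\<close> inside the disc are harmless, since
  \<open>F\<close> is a convergent power series there. On the circle the order of a pole is unknown
  beforehand; a single radial sequence suffices to bound it, because numerator and denominator are
  entire.\<close>

no_notation fps_nth (infixl "$" 75)

section \<open>Linear equations and Moore--Penrose inverses\<close>

text \<open>Induction on the columns. A new column either depends on the old ones, and then every
  functional killing these kills it too, or some functional separates it from them. Consistency of
  singular systems is always derived from the second alternative, by showing that an annihilating
  functional also kills the right-hand side.\<close>

lemma fredholm_alternative:
  fixes M :: "'k \<Rightarrow> 'i \<Rightarrow> 'f::field"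
  assumes "finite I" "finite K"
  shows "(\<exists>c. \<forall>k\<in>K. (\<Sum>i\<in>I. M k i * c i) = y k) \<or>
     (\<exists>w. (\<forall>i\<in>I. (\<Sum>k\<in>K. w k * M k i) = 0) \<and> (\<Sum>k\<in>K. w k * y k) \<noteq> 0)"
  using assms(1)
proof (induction I arbitrary: y rule: finite_induct)
  case empty
  show ?case
  proof (cases "\<forall>k\<in>K. y k = 0")
    case True
    then show ?thesis by simp
  next
    case False
    then obtain k0 where k0: "k0 \<in> K" "y k0 \<noteq> 0" by blast
    have "(\<Sum>k\<in>K. (if k = k0 then 1 else 0) * y k) = (\<Sum>k\<in>K. if k = k0 then y k else 0)"
      by (intro sum.cong) auto
    with k0 have "(\<Sum>k\<in>K. (if k = k0 then 1 else 0) * y k) \<noteq> 0"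
      using assms(2) by simp
    then show ?thesis by auto
  qed
next
  case (insert m I)
  have solvable: "\<exists>c. \<forall>k\<in>K. (\<Sum>i\<in>insert m I. M k i * c i) = y k"
    if "\<forall>k\<in>K. (\<Sum>i\<in>I. M k i * c i) = y k - t * M k m" for c t
  proof (intro exI ballI)
    fix k assume "k \<in> K"
    have "(\<Sum>i\<in>I. M k i * (c(m := t)) i) = (\<Sum>i\<in>I. M k i * c i)"
      using insert.hyps by (intro sum.cong) auto
    with that \<open>k \<in> K\<close> insert.hyps
    show "(\<Sum>i\<in>insert m I. M k i * (c(m := t)) i) = y k" by simp
  qed
  consider (dep) c where "\<forall>k\<in>K. (\<Sum>i\<in>I. M k i * c i) = M k m"
    | (indep) w where "\<forall>i\<in>I. (\<Sum>k\<in>K. w k * M k i) = 0" "(\<Sum>k\<in>K. w k * M k m) \<noteq> 0"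
    using insert.IH[of "\<lambda>k. M k m"] by blast
  then show ?case
  proof cases
    case dep
    have "(\<Sum>k\<in>K. w k * M k m) = 0" if "\<forall>i\<in>I. (\<Sum>k\<in>K. w k * M k i) = 0" for w
    proof -
      have "(\<Sum>k\<in>K. w k * M k m) = (\<Sum>k\<in>K. \<Sum>i\<in>I. c i * (w k * M k i))"
        using dep by (intro sum.cong refl) (simp add: sum_distrib_left algebra_simps flip: dep)
      also have "\<dots> = (\<Sum>i\<in>I. c i * (\<Sum>k\<in>K. w k * M k i))"
        by (subst sum.swap) (simp add: sum_distrib_left)
      also have "\<dots> = 0" using that by simp
      finally show ?thesis .
    qed
    then show ?thesis using insert.IH[of y] solvable[of _ 0] by auto
  next
    case indep
    \<comment> \<open>Applying \<open>w\<close> to the enlarged system leaves only column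
      \<open>m\<close>, so this is the only possible coefficient of that column.\<close>
    define t where "t = (\<Sum>k\<in>K. w k * y k) / (\<Sum>k\<in>K. w k * M k m)"
    consider (solv) c where "\<forall>k\<in>K. (\<Sum>i\<in>I. M k i * c i) = y k - t * M k m"
      | (unsolv) u where "\<forall>i\<in>I. (\<Sum>k\<in>K. u k * M k i) = 0"
          "(\<Sum>k\<in>K. u k * (y k - t * M k m)) \<noteq> 0"
      using insert.IH[of "\<lambda>k. y k - t * M k m"] by blast
    then show ?thesis
    proof cases
      case solv
      then show ?thesis using solvable by blast
    next
      case unsolv
      \<comment> \<open>Subtracting \<open>s * w\<close> makes the functional vanish on column
        \<open>m\<close> as well; its value at \<open>y\<close> is then that of \<open>u\<close> at
        \<open>y - t * M m\<close>, hence nonzero.\<close>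
      define s where "s = (\<Sum>k\<in>K. u k * M k m) / (\<Sum>k\<in>K. w k * M k m)"
      have lin: "(\<Sum>k\<in>K. (u k - s * w k) * z k) =
          (\<Sum>k\<in>K. u k * z k) - s * (\<Sum>k\<in>K. w k * z k)" for z
        by (simp add: sum_subtractf sum_distrib_left algebra_simps)
      have "(\<Sum>k\<in>K. u k * (y k - t * M k m)) =
          (\<Sum>k\<in>K. u k * y k) - t * (\<Sum>k\<in>K. u k * M k m)"
        by (simp add: sum_subtractf sum_distrib_left algebra_simps)
      also have "\<dots> = (\<Sum>k\<in>K. (u k - s * w k) * y k)"
        unfolding lin by (simp add: s_def t_def)
      finally have "(\<Sum>k\<in>K. (u k - s * w k) * y k) \<noteq> 0"
        using unsolv by simp
      moreover have "\<forall>i\<in>insert m I. (\<Sum>k\<in>K. (u k - s * w k) * M k i) = 0"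
        unfolding lin using unsolv indep by (auto simp: s_def)
      ultimately show ?thesis
        by (intro disjI2 exI[of _ "\<lambda>k. u k - s * w k"]) blast
    qed
  qed
qed

text \<open>If \<open>w\<close> annihilates the columns of \<open>t^2\<close> and
  \<open>v = w t\<close>, then \<open>v t = 0\<close> and \<open>|v|^2 = v t w^* = 0\<close>; so
  \<open>w\<close> annihilates the columns of \<open>t\<close> too. The solutions supply the
  \<open>Z\<close> of \<open>penrose_self_adjoint\<close>.\<close>

lemma hermitian_square_solvable:
  fixes t :: "'i \<Rightarrow> 'i \<Rightarrow> complex"
  assumes "finite I" and herm: "\<And>p r. t p r = cnj (t r p)" and "r \<in> I"
  shows "\<exists>z. \<forall>p\<in>I. (\<Sum>s\<in>I. (\<Sum>u\<in>I. t p u * t u s) * z s) = t p r"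
proof (rule ccontr)
  assume "\<not> ?thesis"
  then obtain w where w: "\<And>s. s \<in> I \<Longrightarrow> (\<Sum>p\<in>I. w p * (\<Sum>u\<in>I. t p u * t u s)) = 0"
    and nz: "(\<Sum>p\<in>I. w p * t p r) \<noteq> 0"
    using fredholm_alternative[OF assms(1) assms(1), of "\<lambda>p s. \<Sum>u\<in>I. t p u * t u s" "\<lambda>p. t p r"]
    by blast
  define v where "v u = (\<Sum>p\<in>I. w p * t p u)" for u
  have 0: "(\<Sum>u\<in>I. v u * t u s) = 0" if "s \<in> I" for s
  proof -
    have "(\<Sum>u\<in>I. v u * t u s) = (\<Sum>p\<in>I. w p * (\<Sum>u\<in>I. t p u * t u s))"
      unfolding v_def sum_distrib_left sum_distrib_right
      by (subst sum.swap) (simp add: mult.assoc)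
    then show ?thesis using w that by simp
  qed
  have "(\<Sum>u\<in>I. v u * cnj (v u)) = (\<Sum>u\<in>I. \<Sum>s\<in>I. cnj (w s) * (v u * t u s))"
    unfolding v_def[of "_"] cnj_sum sum_distrib_left
    by (intro sum.cong refl) (subst (2) herm, simp add: v_def algebra_simps)
  also have "\<dots> = (\<Sum>s\<in>I. cnj (w s) * (\<Sum>u\<in>I. v u * t u s))"
    by (subst sum.swap) (simp add: sum_distrib_left)
  also have "\<dots> = 0" using 0 by simp
  finally have "complex_of_real (\<Sum>u\<in>I. (cmod (v u))\<^sup>2) = 0"
    by (simp only: of_real_sum complex_norm_square)
  then have "\<And>u. u \<in> I \<Longrightarrow> v u = 0"
    using assms(1) by (simp only: of_real_eq_0_iff) (simp add: sum_nonneg_eq_0_iff)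
  with nz assms(3) show False by (simp add: v_def)
qed

text \<open>\<open>A X\<close> and \<open>A Y\<close> are self-adjoint and each absorbs the other,
  which forces them to be equal; likewise \<open>X A = Y A\<close>, and then
  \<open>X = X A X = Y A Y = Y\<close>. The abstract product with an involution is later
  instantiated with \<open>block_mult N\<close> and \<open>block_adjoint\<close>.\<close>

lemma penrose_unique:
  fixes m :: "'a \<Rightarrow> 'a \<Rightarrow> 'a" (infixl "\<cdot>" 70)
  assumes assoc: "\<And>x y z. (x \<cdot> y) \<cdot> z = x \<cdot> (y \<cdot> z)"
    and anti: "\<And>x y. adj (x \<cdot> y) = adj y \<cdot> adj x"
    and X: "A \<cdot> X \<cdot> A = A" "X \<cdot> A \<cdot> X = X" "adj (A \<cdot> X) = A \<cdot> X" "adj (X \<cdot> A) = X \<cdot> A"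
    and Y: "A \<cdot> Y \<cdot> A = A" "Y \<cdot> A \<cdot> Y = Y" "adj (A \<cdot> Y) = A \<cdot> Y" "adj (Y \<cdot> A) = Y \<cdot> A"
  shows "X = Y"
proof -
  have "A \<cdot> X = adj (A \<cdot> Y \<cdot> A \<cdot> X)" using X Y by simp
  also have "\<dots> = adj (A \<cdot> X) \<cdot> adj (A \<cdot> Y)" by (simp add: anti assoc)
  also have "\<dots> = A \<cdot> X \<cdot> A \<cdot> Y" by (simp only: X(3) Y(3) assoc)
  finally have AX: "A \<cdot> X = A \<cdot> Y" using X by simp
  have "X \<cdot> A = adj (X \<cdot> (A \<cdot> Y \<cdot> A))" using X Y by simp
  also have "\<dots> = adj (Y \<cdot> A) \<cdot> adj (X \<cdot> A)" by (simp add: anti assoc)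
  also have "\<dots> = Y \<cdot> (A \<cdot> X \<cdot> A)" by (simp only: X(4) Y(4) assoc)
  finally have XA: "X \<cdot> A = Y \<cdot> A" using X by simp
  have "X = X \<cdot> (A \<cdot> X)" using X by (simp add: assoc)
  also have "\<dots> = Y \<cdot> A \<cdot> Y" unfolding AX by (simp add: XA flip: assoc)
  finally show ?thesis using Y by simp
qed

text \<open>If \<open>A\<close> is self-adjoint and \<open>A\<^sup>2 Z = A\<close>, then \<open>E = A Z\<close> is the orthogonal projector
  onto the range of \<open>A\<close>.\<close>

lemma penrose_self_adjoint:
  fixes m :: "'a \<Rightarrow> 'a \<Rightarrow> 'a" (infixl "\<cdot>" 70)
  assumes assoc: "\<And>x y z. (x \<cdot> y) \<cdot> z = x \<cdot> (y \<cdot> z)"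
    and anti: "\<And>x y. adj (x \<cdot> y) = adj y \<cdot> adj x"
    and inv: "\<And>x. adj (adj x) = x"
    and A: "adj A = A" "A \<cdot> (A \<cdot> Z) = A"
  defines "X \<equiv> A \<cdot> Z \<cdot> Z \<cdot> (A \<cdot> Z)"
  shows "A \<cdot> X \<cdot> A = A" "X \<cdot> A \<cdot> X = X" "adj (A \<cdot> X) = A \<cdot> X" "adj (X \<cdot> A) = X \<cdot> A"
proof -
  define E where "E = A \<cdot> Z"
  have AE: "A \<cdot> E = A" using A by (simp add: E_def)
  have adjE: "adj E = adj Z \<cdot> A" by (simp add: E_def anti A)
  have EA': "adj E \<cdot> A = A" using arg_cong[OF AE, of adj] by (simp add: anti A)
  have "adj E \<cdot> E = E" using EA' by (simp add: E_def flip: assoc)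
  then have herm: "adj E = E" by (metis anti inv)
  have EE: "E \<cdot> E = E" using \<open>adj E \<cdot> E = E\<close> herm by simp
  have EA: "E \<cdot> A = A" using EA' herm by simp
  have ZA: "adj Z \<cdot> A = E" using adjE herm by simp
  have X: "X = E \<cdot> (Z \<cdot> E)" by (simp add: X_def E_def assoc)
  have "A \<cdot> X = (A \<cdot> E) \<cdot> Z \<cdot> E" by (simp add: X assoc)
  then have AX: "A \<cdot> X = E" using AE EE by (simp add: E_def)
  have "X \<cdot> A = E \<cdot> Z \<cdot> (E \<cdot> A)" by (simp add: X assoc)
  also have "\<dots> = adj Z \<cdot> (A \<cdot> Z) \<cdot> A" using EA by (simp add: assoc flip: ZA)
  also have "\<dots> = adj Z \<cdot> (E \<cdot> A)" by (simp add: E_def assoc)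
  finally have XA: "X \<cdot> A = E" using EA ZA by simp
  show "A \<cdot> X \<cdot> A = A" "X \<cdot> A \<cdot> X = X" "adj (A \<cdot> X) = A \<cdot> X" "adj (X \<cdot> A) = X \<cdot> A"
    using AX XA EA herm EE by (simp_all add: X flip: assoc)
qed

section \<open>The Moore-Penrose inverse of a self-adjoint block matrix\<close>

lemma ctranspose_nth: "ctranspose A $ i $ j = cnj (A $ j $ i)"
  by (simp add: ctranspose_def)

lemma ctranspose_ctranspose: "ctranspose (ctranspose A) = A"
  by (simp add: ctranspose_def vec_eq_iff)

lemma ctranspose_sum: "ctranspose (\<Sum>x\<in>F. f x) = (\<Sum>x\<in>F. ctranspose (f x))"
  by (simp add: ctranspose_def vec_eq_iff sum_component)

lemma ctranspose_0: "ctranspose 0 = 0"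
  by (simp add: ctranspose_def vec_eq_iff)

lemma ctranspose_mult: "ctranspose (A ** B) = ctranspose B ** ctranspose A"
  by (simp add: ctranspose_def matrix_matrix_mult_def vec_eq_iff mult.commute)

lemma sum_matrix_mult_right: "(\<Sum>x\<in>F. f x) ** B = (\<Sum>x\<in>F. f x ** (B::complex^'n^'m))"
  by (simp add: matrix_matrix_mult_def vec_eq_iff sum_component sum_distrib_right)
    (intro allI sum.swap)

lemma sum_matrix_mult_left: "B ** (\<Sum>x\<in>F. f x) = (\<Sum>x\<in>F. (B::complex^'n^'m) ** f x)"
  by (simp add: matrix_matrix_mult_def vec_eq_iff sum_component sum_distrib_left)
    (intro allI sum.swap)

lemma block_mult_assoc:
  "block_mult N (block_mult N A B) C = block_mult N A (block_mult N B C)"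
proof (intro ext)
  fix j k
  have "block_mult N (block_mult N A B) C j k = (\<Sum>l<N. \<Sum>i<N. A j i ** (B i l ** C l k))"
    by (simp add: block_mult_def sum_matrix_mult_right matrix_mul_assoc)
  also have "\<dots> = block_mult N A (block_mult N B C) j k"
    by (subst sum.swap) (simp add: block_mult_def sum_matrix_mult_left)
  finally show "block_mult N (block_mult N A B) C j k = block_mult N A (block_mult N B C) j k" .
qed

lemma block_mult_col_assoc:
  "block_mult_col N (block_mult N A B) Y = block_mult_col N A (block_mult_col N B Y)"
proof (intro ext)
  fix j
  have "block_mult_col N (block_mult N A B) Y j = (\<Sum>l<N. \<Sum>i<N. A j i ** (B i l ** Y l))"
    by (simp add: block_mult_def block_mult_col_def sum_matrix_mult_right matrix_mul_assoc)
  also have "\<dots> = block_mult_col N A (block_mult_col N B Y) j"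
    by (subst sum.swap) (simp add: block_mult_col_def sum_matrix_mult_left)
  finally show "block_mult_col N (block_mult N A B) Y j = block_mult_col N A (block_mult_col N B Y) j" .
qed

lemma block_adjoint_mult:
  "block_adjoint (block_mult N A B) = block_mult N (block_adjoint B) (block_adjoint A)"
  by (simp add: block_adjoint_def block_mult_def ctranspose_sum ctranspose_mult)

lemma block_adjoint_adjoint: "block_adjoint (block_adjoint A) = A"
  by (simp add: block_adjoint_def ctranspose_ctranspose)

text \<open>A block matrix is a function on all indices, of which only those below \<open>N\<close>
  matter. Truncation turns \<open>block_eq\<close> into true equality, as the abstract Penrose
  lemmas require.\<close>

definition block_trunc :: "nat \<Rightarrow> ('q::finite) blockmat \<Rightarrow> 'q blockmat"
  where "block_trunc N A = (\<lambda>j k. if j < N \<and> k < N then A j k else 0)"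

lemma block_eq_iff_trunc: "block_eq N A B \<longleftrightarrow> block_trunc N A = block_trunc N B"
  by (auto simp: block_eq_def block_trunc_def fun_eq_iff)

lemma block_trunc_mult:
  "block_trunc N (block_mult N A B) = block_mult N (block_trunc N A) (block_trunc N B)"
  by (auto simp: block_trunc_def block_mult_def fun_eq_iff)

lemma block_trunc_adjoint: "block_trunc N (block_adjoint A) = block_adjoint (block_trunc N A)"
  by (auto simp: block_trunc_def block_adjoint_def fun_eq_iff ctranspose_0)

lemma block_trunc_fixed: "block_trunc N X = X \<longleftrightarrow> (\<forall>j k. \<not> (j < N \<and> k < N) \<longrightarrow> X j k = 0)"
  by (auto simp: block_trunc_def fun_eq_iff)

lemma block_trunc_trunc: "block_trunc N (block_trunc N X) = block_trunc N X"
  by (auto simp: block_trunc_def fun_eq_iff)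

text \<open>The \<open>THE\<close> in \<open>block_pinv\<close> denotes: existence comes from
  solving \<open>A^2 Z = A\<close> for the scalar entries, indexed by pairs of a block index and an
  entry index, and uniqueness from \<open>penrose_unique\<close>. The first Penrose equation is the
  one that later proves \<open>T T^+ Y = Y\<close>.\<close>

lemma block_pinv_self_adjoint:
  fixes A :: "('q::finite) blockmat"
  assumes herm: "block_adjoint A = A"
  shows "block_eq N (block_mult N (block_mult N A (block_pinv N A)) A) A"
proof -
  define B where "B = block_trunc N A"
  let ?m = "block_mult N" and ?adj = "block_adjoint"
  define P where "P X \<longleftrightarrow> ?m (?m B X) B = B \<and> ?m (?m X B) X = X \<and>
    ?adj (?m B X) = ?m B X \<and> ?adj (?m X B) = ?m X B" for X
  have pinv: "block_pinv N A = (THE X. P X \<and> block_trunc N X = X)"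
    unfolding block_pinv_def block_eq_iff_trunc block_trunc_mult block_trunc_adjoint
      block_trunc_fixed[symmetric] P_def B_def
    by (intro arg_cong[where f=The] ext) (auto simp: block_trunc_mult)
  have hermB: "?adj B = B" by (metis B_def block_trunc_adjoint herm)
  define t where "t = (\<lambda>(j, a) (k, b). A j k $ a $ b)"
  let ?I = "{..<N} \<times> (UNIV :: 'q set)"
  have t_pair: "t (j, a) (k, b) = A j k $ a $ b" for j a k b by (simp add: t_def)
  have fin: "finite ?I" by simp
  have herm_t: "t p r = cnj (t r p)" for p r
  proof -
    obtain j a k b where p: "p = (j, a)" and r: "r = (k, b)" by (metis surj_pair)
    have "A j k $ a $ b = block_adjoint A j k $ a $ b" using herm by simp
    then show ?thesis by (simp add: t_def p r block_adjoint_def ctranspose_nth)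
  qed
  have "\<forall>r\<in>?I. \<exists>z. \<forall>p\<in>?I. (\<Sum>s\<in>?I. (\<Sum>u\<in>?I. t p u * t u s) * z s) = t p r"
  proof
    fix r assume "r \<in> ?I"
    then show "\<exists>z. \<forall>p\<in>?I. (\<Sum>s\<in>?I. (\<Sum>u\<in>?I. t p u * t u s) * z s) = t p r"
      by (rule hermitian_square_solvable[where t = t, OF fin herm_t])
  qed
  from bchoice[OF this] obtain z where
    z: "\<And>p r. p \<in> ?I \<Longrightarrow> r \<in> ?I \<Longrightarrow> (\<Sum>s\<in>?I. (\<Sum>u\<in>?I. t p u * t u s) * z r s) = t p r"
    by blast
  \<comment> \<open>Column \<open>(l, c)\<close> of \<open>Z\<close> is the solution belonging to
    column \<open>(l, c)\<close> of \<open>A\<close>.\<close>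
  define Z :: "'q blockmat" where "Z = block_trunc N (\<lambda>k l. \<chi> b c. z (l, c) (k, b))"
  have "?m (?m A A) Z j l $ a $ c = A j l $ a $ c" if "j < N" "l < N" for j l a c
    using z[of "(j, a)" "(l, c)"] that
    by (simp add: t_pair sum.cartesian_product' block_mult_def matrix_matrix_mult_def sum_component
      Z_def block_trunc_def)
  then have "block_eq N (?m (?m A A) Z) A" by (simp add: block_eq_def vec_eq_iff)
  then have BZ: "?m B (?m B Z) = B"
    by (simp add: block_eq_iff_trunc block_trunc_mult B_def Z_def block_trunc_trunc block_mult_assoc)
  define X where "X = ?m (?m (?m B Z) Z) (?m B Z)"
  have "P X"
    unfolding P_def X_def
    using penrose_self_adjoint[of ?m ?adj B Z, OF block_mult_assoc block_adjoint_mult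
        block_adjoint_adjoint hermB BZ] by blast
  moreover have "block_trunc N X = X"
    by (simp add: X_def block_trunc_mult B_def Z_def block_trunc_trunc)
  moreover have "Y = X" if "P Y" for Y
    by (rule penrose_unique[where m = ?m and adj = ?adj and A = B,
        OF block_mult_assoc block_adjoint_mult])
      (insert that[unfolded P_def] \<open>P X\<close>[unfolded P_def], (elim conjE, assumption)+)
  ultimately have "\<exists>!X. P X \<and> block_trunc N X = X" by blast
  from theI'[OF this] have "P (block_pinv N A) \<and> block_trunc N (block_pinv N A) = block_pinv N A"
    unfolding pinv[symmetric] .
  then have "block_mult N (block_mult N B (block_pinv N A)) B = B"
    and "block_trunc N (block_pinv N A) = block_pinv N A"
    unfolding P_def by blast+
  then show ?thesis
    by (simp add: block_eq_iff_trunc block_trunc_mult B_def block_trunc_trunc)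
qed

section \<open>Complex Hilbert spaces and prediction\<close>

lemma cinner_add_right: "cinner x (y + z) = cinner x y + cinner x (z::'a::complex_hilbert)"
  by (metis cinner_add_left cinner_commute complex_cnj_add)

lemma cinner_scaleC_right: "cinner x (c *\<^sub>C y) = cnj c * cinner x (y::'a::complex_hilbert)"
  by (metis cinner_commute cinner_scaleC_left complex_cnj_mult)

lemma cinner_zero_left [simp]: "cinner 0 (y::'a::complex_hilbert) = 0"
  using cinner_add_left[of 0 0 y] by simp

lemma cinner_zero_right [simp]: "cinner (y::'a::complex_hilbert) 0 = 0"
  using cinner_add_right[of y 0 0] by simp

lemma cinner_diff_left: "cinner (x - y) z = cinner x z - cinner y (z::'a::complex_hilbert)"
  using cinner_add_left[of "x - y" y z] by simp

lemma cinner_diff_right: "cinner z (x - y) = cinner z x - cinner z (y::'a::complex_hilbert)"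
  using cinner_add_right[of z "x - y" y] by simp

lemma cinner_sum_left: "cinner (\<Sum>i\<in>F. f i) z = (\<Sum>i\<in>F. cinner (f i) (z::'a::complex_hilbert))"
  by (induction F rule: infinite_finite_induct) (auto simp: cinner_add_left)

lemma cinner_sum_right: "cinner z (\<Sum>i\<in>F. f i) = (\<Sum>i\<in>F. cinner z (f i :: 'a::complex_hilbert))"
  by (induction F rule: infinite_finite_induct) (auto simp: cinner_add_right)

lemma cinner_eq_zero_iff: "cinner x x = 0 \<longleftrightarrow> x = (0::'a::complex_hilbert)"
  by (simp add: cinner_self)

lemma norm_square_cinner: "(norm (x::'a::complex_hilbert))\<^sup>2 = Re (cinner x x)"
  by (simp add: cinner_self)

lemma scaleC_zero_right: "c *\<^sub>C (0::'a::complex_hilbert) = 0"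
  using scaleC_add_right[of c 0 "0::'a"] by simp

lemma scaleC_zero_left: "0 *\<^sub>C (x::'a::complex_hilbert) = 0"
  using scaleC_add_left[of 0 0 x] by simp

lemma scaleC_sum_right: "c *\<^sub>C (\<Sum>i\<in>I. f i) = (\<Sum>i\<in>I. c *\<^sub>C (f i :: 'a::complex_hilbert))"
  by (induction I rule: infinite_finite_induct) (auto simp: scaleC_zero_right scaleC_add_right)

lemma parallelogram:
  "(norm (x + y))\<^sup>2 + (norm (x - y))\<^sup>2 = 2 * (norm x)\<^sup>2 + 2 * (norm (y::'a::complex_hilbert))\<^sup>2"
  by (simp add: norm_square_cinner cinner_add_left cinner_add_right cinner_diff_left cinner_diff_right)

text \<open>A minimizing sequence for the distance is Cauchy by the parallelogram law, and
  minimality of its limit forces orthogonality. It yields the projection onto the closed span of the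
  whole past, for which no finite Gram system is available.\<close>

lemma hilbert_projection:
  fixes S :: "'a::complex_hilbert set"
  assumes "closed S" "0 \<in> S" and add: "\<And>x y. x \<in> S \<Longrightarrow> y \<in> S \<Longrightarrow> x + y \<in> S"
    and scale: "\<And>c x. x \<in> S \<Longrightarrow> c *\<^sub>C x \<in> S"
  shows "\<exists>p\<in>S. \<forall>y\<in>S. cinner (x - p) y = 0"
proof -
  define d where "d = (INF y\<in>S. (norm (x - y))\<^sup>2)"
  have bdd: "bdd_below ((\<lambda>y. (norm (x - y))\<^sup>2) ` S)"
    by (rule bdd_belowI[of _ 0]) auto
  have d_le: "d \<le> (norm (x - y))\<^sup>2" if "y \<in> S" for y
    unfolding d_def using bdd that by (rule cINF_lower)
  have "\<exists>y\<in>S. (norm (x - y))\<^sup>2 < d + 1 / Suc k" for k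
    using cInf_lessD[of "(\<lambda>y. (norm (x - y))\<^sup>2) ` S" "d + 1 / Suc k"] \<open>0 \<in> S\<close>
    unfolding d_def by auto
  then obtain s where sS: "\<And>k. s k \<in> S" and s: "\<And>k. (norm (x - s k))\<^sup>2 < d + 1 / Suc k"
    by metis
  have half: "(1/2) *\<^sub>R (a + b) \<in> S" if "a \<in> S" "b \<in> S" for a b
    using that by (simp add: scaleR_scaleC add scale)
  \<comment> \<open>The midpoint of \<open>s k\<close> and \<open>s l\<close> lies in
    \<open>S\<close>, so its squared distance from \<open>x\<close> is at least
    \<open>d\<close>.\<close>
  have close: "(norm (s k - s l))\<^sup>2 \<le> 2 / Suc k + 2 / Suc l" for k l
  proof -
    have "x - s k + (x - s l) = 2 *\<^sub>R (x - (1/2) *\<^sub>R (s k + s l))"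
      by (simp add: scaleR_2 algebra_simps flip: scaleR_left.add)
    then have "(norm (x - s k + (x - s l)))\<^sup>2 = 4 * (norm (x - (1/2) *\<^sub>R (s k + s l)))\<^sup>2"
      by (simp add: power_mult_distrib)
    moreover have "d \<le> (norm (x - (1/2) *\<^sub>R (s k + s l)))\<^sup>2"
      using half sS d_le by blast
    moreover have "norm (x - s k - (x - s l)) = norm (s k - s l)"
      by (simp add: norm_minus_commute)
    ultimately show ?thesis
      using parallelogram[of "x - s k" "x - s l"] s[of k] s[of l] by simp
  qed
  have "Cauchy s"
  proof (rule metric_CauchyI)
    fix e :: real assume "0 < e"
    \<comment> \<open>Beyond \<open>M\<close> the bound of \<open>close\<close> is at most
      \<open>4 / Suc M\<close>, which is to be below \<open>e^2\<close>.\<close>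
    then obtain M :: nat where "4 / e\<^sup>2 < M" using reals_Archimedean2 by blast
    then have M: "4 < e\<^sup>2 * M" using \<open>0 < e\<close> by (simp add: divide_less_eq mult.commute)
    have "dist (s k) (s l) < e" if "k \<ge> M" "l \<ge> M" for k l
    proof -
      have "2 / Suc k \<le> 2 / Suc M" "2 / Suc l \<le> 2 / Suc M"
        using that by (auto intro!: divide_left_mono)
      then have "(norm (s k - s l))\<^sup>2 \<le> 4 / Suc M" using close[of k l] by simp
      also have "\<dots> < e\<^sup>2"
      proof -
        have "e\<^sup>2 * real M \<le> e\<^sup>2 * Suc M" by (intro mult_left_mono) auto
        with M have "4 < e\<^sup>2 * Suc M" by linarith
        then show ?thesis by (simp add: divide_less_eq del: of_nat_Suc)
      qed
      finally show ?thesis using \<open>0 < e\<close> by (simp add: dist_norm power_less_imp_less_base)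
    qed
    then show "\<exists>M. \<forall>k\<ge>M. \<forall>l\<ge>M. dist (s k) (s l) < e" by blast
  qed
  then obtain p where p: "s \<longlonglongrightarrow> p" using Cauchy_convergent convergent_def by blast
  have "p \<in> S" using assms(1) sS p by (rule closed_sequentially)
  have "(\<lambda>k. (norm (x - s k))\<^sup>2) \<longlonglongrightarrow> (norm (x - p))\<^sup>2"
    by (intro tendsto_intros p)
  moreover have "(\<lambda>k. d + 1 / Suc k) \<longlonglongrightarrow> d + 0"
    by (intro tendsto_intros LIMSEQ_Suc[OF lim_1_over_n])
  ultimately have min: "(norm (x - p))\<^sup>2 \<le> d"
    using s by (auto intro: LIMSEQ_le less_imp_le)
  have "cinner (x - p) y = 0" if "y \<in> S" for y
  proof (cases "y = 0")
    case False
    \<comment> \<open>The coefficient of the projection of \<open>x - p\<close> onto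
      \<open>y\<close>: moving \<open>p\<close> by \<open>c *\<^sub>C y\<close> lowers the squared
      distance by \<open>|cinner (x - p) y|^2 / (norm y)^2\<close>, which minimality forbids unless
      this is zero.\<close>
    define c where "c = cinner (x - p) y / cinner y y"
    have yy: "cinner y y \<noteq> 0" using False by (simp add: cinner_eq_zero_iff)
    have "cinner (x - p - c *\<^sub>C y) (x - p - c *\<^sub>C y) =
        cinner (x - p) (x - p) - cinner (x - p) y * cnj (cinner (x - p) y) / cinner y y"
      using yy cinner_commute[of y "x - p"]
      by (simp add: cinner_diff_left[of _ "c *\<^sub>C y"] cinner_diff_right[of _ _ "c *\<^sub>C y"]
          cinner_scaleC_left cinner_scaleC_right) (simp add: c_def field_simps cinner_self)
    also have "\<dots> = of_real ((norm (x - p))\<^sup>2 - (cmod (cinner (x - p) y))\<^sup>2 / (norm y)\<^sup>2)"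
      by (simp only: cinner_self of_real_diff of_real_divide complex_norm_square)
    finally have "(norm (x - p - c *\<^sub>C y))\<^sup>2 =
        (norm (x - p))\<^sup>2 - (cmod (cinner (x - p) y))\<^sup>2 / (norm y)\<^sup>2"
      unfolding cinner_self of_real_eq_iff .
    moreover have "d \<le> (norm (x - (p + c *\<^sub>C y)))\<^sup>2"
      using d_le add scale that \<open>p \<in> S\<close> by blast
    ultimately have "(cmod (cinner (x - p) y))\<^sup>2 / (norm y)\<^sup>2 \<le> 0"
      using min by (simp add: diff_diff_eq)
    then show ?thesis using False by (simp add: divide_le_0_iff)
  qed simp
  then show ?thesis using \<open>p \<in> S\<close> by blast
qed

text \<open>A Gram matrix may be singular, but normal equations are always consistent: if
  \<open>w\<close> annihilates the Gram columns, then \<open>v = \<Sum> w k x k\<close> is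
  orthogonal to every \<open>x i\<close>, hence to itself, so \<open>v = 0\<close> and
  \<open>w\<close> annihilates the right-hand side.\<close>

lemma gram_solvable:
  fixes x :: "'i \<Rightarrow> 'a::complex_hilbert"
  assumes "finite I"
  shows "\<exists>c. \<forall>k\<in>I. (\<Sum>i\<in>I. cinner (x k) (x i) * c i) = cinner (x k) y"
proof (rule ccontr)
  assume "\<not> ?thesis"
  then obtain w where w: "\<forall>i\<in>I. (\<Sum>k\<in>I. w k * cinner (x k) (x i)) = 0"
    and nz: "(\<Sum>k\<in>I. w k * cinner (x k) y) \<noteq> 0"
    using fredholm_alternative[OF assms assms, of "\<lambda>k i. cinner (x k) (x i)" "\<lambda>k. cinner (x k) y"]
    by blast
  define v where "v = (\<Sum>k\<in>I. w k *\<^sub>C x k)"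
  have v: "cinner v z = (\<Sum>k\<in>I. w k * cinner (x k) z)" for z
    by (simp add: v_def cinner_sum_left cinner_scaleC_left)
  have "cinner v v = (\<Sum>i\<in>I. cnj (w i) * cinner v (x i))"
    by (subst (2) v_def) (simp add: cinner_sum_right cinner_scaleC_right)
  also have "\<dots> = 0" using w by (simp add: v)
  finally have "v = 0" by (simp add: cinner_eq_zero_iff)
  then show False using nz v[of y] by simp
qed

section \<open>The Hilbert space of vectors and matrix linear subspaces\<close>

instantiation vec :: (complex_hilbert, finite) complex_hilbert
begin

definition scaleC_vec :: "complex \<Rightarrow> 'a ^ 'b \<Rightarrow> 'a ^ 'b"
  where "scaleC_vec c x = (\<chi> i. c *\<^sub>C (x $ i))"

definition cinner_vec :: "'a ^ 'b \<Rightarrow> 'a ^ 'b \<Rightarrow> complex"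
  where "cinner_vec x y = (\<Sum>i\<in>UNIV. cinner (x $ i) (y $ i))"

instance
proof
  fix x y :: "'a ^ 'b"
  show "cinner x y = cnj (cinner y x)"
    unfolding cinner_vec_def cnj_sum by (intro sum.cong refl cinner_commute)
  show "cinner x x = complex_of_real ((norm x)\<^sup>2)"
    by (simp add: cinner_vec_def cinner_self norm_vec_def L2_set_def sum_nonneg)
qed (auto simp: cinner_vec_def scaleC_vec_def vec_eq_iff scaleC_add_right scaleC_add_left
    scaleC_scaleC scaleR_scaleC cinner_add_left cinner_scaleC_left sum.distrib sum_distrib_left)

end

lemma trace_gramian: "trace (gramian x y) = cinner x (y :: ('h::complex_hilbert)^'q::finite)"
  by (simp add: trace_def gramian_def cinner_vec_def)

lemma mat_act_nth: "mat_act A x $ j = (\<Sum>k\<in>UNIV. (A $ j $ k) *\<^sub>C (x $ k))"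
  by (simp add: mat_act_def)

lemma matrix_span_eq:
  "(p \<in> matrix_span G) \<longleftrightarrow> (\<exists>F A. p = (\<Sum>x\<in>F. mat_act (A x) x) \<and> finite F \<and> F \<subseteq> G)"
  by (auto simp: matrix_span_def)

lemma mat_act_0: "mat_act 0 x = 0"
  by (simp add: mat_act_def scaleC_zero_left vec_eq_iff)

lemma mat_act_add: "mat_act (A + B) x = mat_act A x + mat_act B x"
  by (simp add: mat_act_def vec_eq_iff scaleC_add_left sum.distrib)

lemma matrix_span_add:
  assumes "p \<in> matrix_span G" "r \<in> matrix_span G"
  shows "p + r \<in> matrix_span G"
proof -
  obtain F A F' A' where p: "p = (\<Sum>x\<in>F. mat_act (A x) x)" "finite F" "F \<subseteq> G"
    and r: "r = (\<Sum>x\<in>F'. mat_act (A' x) x)" "finite F'" "F' \<subseteq> G"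
    using assms unfolding matrix_span_eq by blast
  \<comment> \<open>The two families may share generators, so coefficients are added on the
    union.\<close>
  define B where "B x = (if x \<in> F then A x else 0) + (if x \<in> F' then A' x else 0)" for x
  have "p = (\<Sum>x\<in>F \<union> F'. mat_act (if x \<in> F then A x else 0) x)"
    unfolding p(1) using p r by (intro sum.mono_neutral_cong_left) (auto simp: mat_act_0)
  moreover have "r = (\<Sum>x\<in>F \<union> F'. mat_act (if x \<in> F' then A' x else 0) x)"
    unfolding r(1) using p r by (intro sum.mono_neutral_cong_left) (auto simp: mat_act_0)
  ultimately have "p + r = (\<Sum>x\<in>F \<union> F'. mat_act (B x) x)"
    by (simp add: B_def mat_act_add sum.distrib)
  then show ?thesis unfolding matrix_span_eq using p r by blast
qed

lemma mat_act_in_matrix_span: "x \<in> G \<Longrightarrow> mat_act A x \<in> matrix_span G"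
  unfolding matrix_span_eq by (intro exI[of _ "{x}"] exI[of _ "\<lambda>_. A"]) auto

lemma zero_in_matrix_span: "0 \<in> matrix_span G"
  unfolding matrix_span_eq by (intro exI[of _ "{}"]) auto

lemma matrix_span_scale:
  assumes "p \<in> matrix_span G"
  shows "c *\<^sub>C p \<in> matrix_span G"
proof -
  obtain F A where p: "p = (\<Sum>x\<in>F. mat_act (A x) x)" "finite F" "F \<subseteq> G"
    using assms unfolding matrix_span_eq by blast
  have act: "c *\<^sub>C mat_act B x = mat_act (c *\<^sub>m B) x" for B x
    by (simp add: vec_eq_iff scaleC_vec_def mat_act_def mscale_def scaleC_sum_right scaleC_scaleC)
  have "c *\<^sub>C p = (\<Sum>x\<in>F. c *\<^sub>C mat_act (A x) x)"
    unfolding p(1) by (rule scaleC_sum_right)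
  then show ?thesis
    unfolding matrix_span_eq using p
    by (intro exI[of _ F] exI[of _ "\<lambda>x. c *\<^sub>m A x"]) (simp add: act)
qed

lemma matrix_span_sum:
  "(\<And>i. i \<in> I \<Longrightarrow> f i \<in> matrix_span G) \<Longrightarrow> (\<Sum>i\<in>I. f i) \<in> matrix_span G"
  by (induction I rule: infinite_finite_induct) (auto simp: zero_in_matrix_span matrix_span_add)

text \<open>Two candidates for the projection differ by an element of \<open>S\<close> that is
  orthogonal to itself. So the \<open>THE\<close> can be evaluated as soon as one candidate is
  exhibited.\<close>

lemma orth_proj_eqI:
  fixes S :: "(('h::complex_hilbert)^('q::finite)) set"
  assumes "p \<in> S" "\<And>y. y \<in> S \<Longrightarrow> cinner (x - p) y = 0"
    and add: "\<And>x y. x \<in> S \<Longrightarrow> y \<in> S \<Longrightarrow> x + y \<in> S"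
    and scale: "\<And>c x. x \<in> S \<Longrightarrow> c *\<^sub>C x \<in> S"
  shows "orth_proj S x = p"
  unfolding orth_proj_def trace_gramian
proof (rule the_equality)
  show "p \<in> S \<and> (\<forall>y\<in>S. cinner (x - p) y = 0)" using assms by blast
next
  fix r assume r: "r \<in> S \<and> (\<forall>y\<in>S. cinner (x - r) y = 0)"
  have "(- 1) *\<^sub>C p = - p" using scaleR_scaleC[of "- 1" p] by simp
  then have "r - p \<in> S" using add scale[of p "- 1"] r assms(1) by fastforce
  then have "cinner (x - p) (r - p) - cinner (x - r) (r - p) = 0"
    using r assms(2) by simp
  then have "cinner (x - p - (x - r)) (r - p) = 0"
    unfolding cinner_diff_left[of "x - p"] .
  then show "r = p" by (simp add: cinner_eq_zero_iff)
qed

lemma norm_scaleC: "norm (c *\<^sub>C x) = cmod c * norm (x::'a::complex_hilbert)"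
proof -
  have "cinner (c *\<^sub>C x) (c *\<^sub>C x) = of_real ((cmod c * norm x)\<^sup>2)"
    by (simp add: cinner_scaleC_left cinner_scaleC_right cinner_self[of x] power_mult_distrib
        mult.commute[of "cnj c" c] flip: complex_norm_square mult.assoc)
  then have "(norm (c *\<^sub>C x))\<^sup>2 = (cmod c * norm x)\<^sup>2"
    unfolding cinner_self of_real_eq_iff .
  then show ?thesis by (simp add: power2_eq_iff_nonneg)
qed

lemma tendsto_scaleC:
  assumes "(f \<longlongrightarrow> x) F"
  shows "((\<lambda>k. c *\<^sub>C f k) \<longlongrightarrow> c *\<^sub>C (x::'a::complex_hilbert)) F"
proof -
  have "bounded_linear (\<lambda>x::'a. c *\<^sub>C x)"
    by (rule bounded_linear_intro[of _ "cmod c"])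
      (auto simp: scaleC_add_right norm_scaleC scaleR_scaleC scaleC_scaleC mult.commute)
  then show ?thesis using assms by (rule bounded_linear.tendsto)
qed

lemma closure_add:
  fixes S :: "'a::real_normed_vector set"
  assumes "\<And>x y. x \<in> S \<Longrightarrow> y \<in> S \<Longrightarrow> x + y \<in> S" "x \<in> closure S" "y \<in> closure S"
  shows "x + y \<in> closure S"
proof -
  obtain a b where "\<And>k. a k \<in> S" "a \<longlonglongrightarrow> x" "\<And>k. b k \<in> S" "b \<longlonglongrightarrow> y"
    using assms(2,3) unfolding closure_sequential by blast
  then show ?thesis
    unfolding closure_sequential using assms(1)
    by (intro exI[of _ "\<lambda>k. a k + b k"]) (simp add: tendsto_add)
qed

lemma closure_scaleC:
  fixes S :: "'a::complex_hilbert set"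
  assumes "\<And>x. x \<in> S \<Longrightarrow> c *\<^sub>C x \<in> S" "x \<in> closure S"
  shows "c *\<^sub>C x \<in> closure S"
proof -
  obtain a where "\<And>k. a k \<in> S" "a \<longlonglongrightarrow> x"
    using assms(2) unfolding closure_sequential by blast
  then show ?thesis
    unfolding closure_sequential using assms(1)
    by (intro exI[of _ "\<lambda>k. c *\<^sub>C a k"]) (simp add: tendsto_scaleC)
qed

lemma cinner_mat_act:
  "cinner z (mat_act B x) = (\<Sum>a\<in>UNIV. \<Sum>b\<in>UNIV. cnj (B $ a $ b) * cinner (z $ a) (x $ b))"
  by (simp add: cinner_vec_def mat_act_def cinner_sum_right cinner_scaleC_right)

text \<open>Taking matrix units for \<open>B\<close> isolates single entries of the Gramian. Thus
  orthogonality for the trace inner product to all \<open>mat_act B x\<close> yields matrix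
  equations instead of scalar ones.\<close>

lemma gramian_eq_0_iff:
  fixes z x :: "('h::complex_hilbert)^('q::finite)"
  shows "gramian z x = 0 \<longleftrightarrow> (\<forall>B. cinner z (mat_act B x) = 0)"
proof
  assume "gramian z x = 0"
  then have "cinner (z $ a) (x $ b) = 0" for a b
    by (simp add: gramian_def vec_eq_iff)
  then show "\<forall>B. cinner z (mat_act B x) = 0" by (simp add: cinner_mat_act)
next
  assume *: "\<forall>B. cinner z (mat_act B x) = 0"
  have "cinner (z $ a) (x $ b) = 0" for a b
  proof -
    define B :: "complex^'q^'q" where "B = (\<chi> i j. if i = a \<and> j = b then 1 else 0)"
    have "cinner z (mat_act B x) =
        (\<Sum>i\<in>UNIV. \<Sum>j\<in>UNIV. if j = b then if i = a then cinner (z $ i) (x $ j) else 0 else 0)"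
      unfolding cinner_mat_act by (intro sum.cong refl) (simp add: B_def)
    then show ?thesis using * by simp
  qed
  then show "gramian z x = 0" by (simp add: gramian_def vec_eq_iff)
qed

lemma gramian_mat_act: "gramian (mat_act A x) y = A ** gramian x y"
  by (simp add: vec_eq_iff gramian_def mat_act_def matrix_matrix_mult_def cinner_sum_left
      cinner_scaleC_left)

lemma gramian_diff: "gramian (x - y) z = gramian x z - gramian y z"
  by (simp add: vec_eq_iff gramian_def cinner_diff_left)

lemma gramian_sum: "gramian (\<Sum>i\<in>I. f i) z = (\<Sum>i\<in>I. gramian (f i) z)"
  by (simp add: vec_eq_iff gramian_def sum_component cinner_sum_left)

lemma gramian_adjoint: "ctranspose (gramian x y) = gramian y x"
  by (simp add: vec_eq_iff gramian_def ctranspose_def flip: cinner_commute)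

lemma gramian_stationary: "stationary g \<Longrightarrow> gramian (g m) (g k) = covariance g (m - k)"
  by (simp add: stationary_def covariance_def)

lemma covariance_minus: "stationary g \<Longrightarrow> covariance g (- m) = ctranspose (covariance g m)"
  using gramian_stationary[of g 0 m] by (simp add: gramian_adjoint covariance_def)

text \<open>The \<open>THE\<close> in \<open>orth_proj\<close> is meaningful for both predictors, so that equality of the two
  extends the normal equations from the last \<open>n\<close> values to the whole past.\<close>

lemma autoregressive_recursion:
  fixes g :: "int \<Rightarrow> ('h::complex_hilbert)^('q::finite)"
  assumes stat: "stationary g" and eq: "predictor g n = full_predictor g"
  shows "\<exists>A. \<forall>k\<ge>1. covariance g k = (\<Sum>j=1..n. A j ** covariance g (k - int j))"
proof -
  let ?I = "{1..n} \<times> (UNIV :: 'q set)"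
  define x where "x = (\<lambda>(j, b). g (- int j) $ b)"
  have "\<exists>c. \<forall>k\<in>?I. (\<Sum>i\<in>?I. cinner (x k) (x i) * c i) = cinner (x k) (g 0 $ a)" for a
    by (rule gram_solvable) simp
  then obtain c where
    c: "\<And>a k. k \<in> ?I \<Longrightarrow> (\<Sum>i\<in>?I. cinner (x k) (x i) * c a i) = cinner (x k) (g 0 $ a)"
    by metis
  \<comment> \<open>Conjugates appear because \<open>cinner\<close> is conjugate-linear in its
    second argument, the one in which the Gram system combines the vectors.\<close>
  define A :: "nat \<Rightarrow> complex^'q^'q" where "A j = (\<chi> a b. cnj (c a (j, b)))" for j
  define p where "p = (\<Sum>j=1..n. mat_act (A j) (g (- int j)))"
  have p_nth: "p $ a = (\<Sum>i\<in>?I. cnj (c a i) *\<^sub>C x i)" for a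
    by (simp add: p_def A_def sum_component mat_act_nth x_def sum.cartesian_product')
  have "cinner (p $ a) (x k) = cinner (g 0 $ a) (x k)" if "k \<in> ?I" for a k
  proof -
    have "cinner (p $ a) (x k) = cnj (\<Sum>i\<in>?I. cinner (x k) (x i) * c a i)"
      unfolding p_nth cinner_sum_left cnj_sum
      by (intro sum.cong refl) (simp add: cinner_scaleC_left mult.commute flip: cinner_commute)
    then show ?thesis using c[OF that, of a] cinner_commute by metis
  qed
  then have "cinner (p $ a) (g (- int k) $ b) = cinner (g 0 $ a) (g (- int k) $ b)"
    if "1 \<le> k" "k \<le> n" for k a b
    using that unfolding x_def by fastforce
  then have gram0: "gramian (g 0 - p) (g (- int k)) = 0" if "1 \<le> k" "k \<le> n" for k
    using that by (simp add: vec_eq_iff gramian_def cinner_diff_left)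
  have pred: "predictor g n = p"
    unfolding predictor_def
  proof (rule orth_proj_eqI)
    show "p \<in> matrix_span {g (- int j) |j. 1 \<le> j \<and> j \<le> n}"
      unfolding p_def by (intro matrix_span_sum mat_act_in_matrix_span) auto
    fix y assume "y \<in> matrix_span {g (- int j) |j. 1 \<le> j \<and> j \<le> n}"
    then obtain F B where y: "y = (\<Sum>x\<in>F. mat_act (B x) x)"
        and F: "F \<subseteq> {g (- int j) |j. 1 \<le> j \<and> j \<le> n}"
      unfolding matrix_span_eq by auto
    show "cinner (g 0 - p) y = 0"
      unfolding y cinner_sum_right
    proof (intro sum.neutral ballI)
      fix x assume "x \<in> F"
      then show "cinner (g 0 - p) (mat_act (B x) x) = 0"
        using F gram0 gramian_eq_0_iff by blast
    qed
  qed (auto intro: matrix_span_add matrix_span_scale)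
  let ?S = "closure (matrix_span {g (- int j) |j. 1 \<le> j})"
  have "0 \<in> ?S" using closure_subset zero_in_matrix_span by blast
  moreover have S_add: "\<And>x y. x \<in> ?S \<Longrightarrow> y \<in> ?S \<Longrightarrow> x + y \<in> ?S"
    by (rule closure_add) (auto intro: matrix_span_add)
  moreover have S_scale: "\<And>c x. x \<in> ?S \<Longrightarrow> c *\<^sub>C x \<in> ?S"
    by (rule closure_scaleC) (auto intro: matrix_span_scale)
  ultimately obtain r where "r \<in> ?S" and r: "\<And>y. y \<in> ?S \<Longrightarrow> cinner (g 0 - r) y = 0"
    using hilbert_projection[of ?S "g 0"] by auto
  then have "full_predictor g = r"
    unfolding full_predictor_def using S_add S_scale by (intro orth_proj_eqI)
  \<comment> \<open>The residual of the finite past is now that of the whole past, hence orthogonal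
    to \<open>g (- k)\<close> for every \<open>k \<ge> 1\<close>.\<close>
  then have "p = r" using eq pred by simp
  show ?thesis
  proof (intro exI allI impI)
    fix k :: int assume "1 \<le> k"
    have "mat_act B (g (- k)) \<in> ?S" for B
    proof -
      have "g (- k) \<in> {g (- int j) |j. 1 \<le> j}"
        using \<open>1 \<le> k\<close> by (intro CollectI exI[of _ "nat k"]) simp
      from subsetD[OF closure_subset mat_act_in_matrix_span[OF this]] show ?thesis .
    qed
    then have "gramian (g 0 - p) (g (- k)) = 0"
      using r \<open>p = r\<close> gramian_eq_0_iff by blast
    then have "gramian (g 0) (g (- k)) = (\<Sum>j=1..n. A j ** gramian (g (- int j)) (g (- k)))"
      by (simp add: gramian_diff p_def gramian_sum gramian_mat_act)
    then show "covariance g k = (\<Sum>j=1..n. A j ** covariance g (k - int j))"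
      by (simp add: gramian_stationary[OF stat])
  qed
qed

text \<open>The blocks \<open>D l\<close> of \<open>T^+ Y\<close>. Their adjoints are coefficients
  of the best approximation of \<open>g (- 1)\<close> by \<open>g 0, ..., g (n - 1)\<close>, that
  is, of backward prediction; this is why they multiply covariances from the right.\<close>

definition backward_coeff :: "(int \<Rightarrow> complex^'q^'q) \<Rightarrow> nat \<Rightarrow> ('q::finite) blockvec"
  where "backward_coeff C n = block_mult_col n (block_pinv n (Tmat C)) (Ycol C)"

text \<open>Some \<open>D\<close> with \<open>T D = Y\<close> exists because this is a Gram system.
  Then \<open>T T^+ Y = T T^+ T D = T D = Y\<close>, so the pseudo-inverse gives a genuine solution
  even if \<open>T\<close> is singular.\<close>

lemma backward_recursion_initial:
  fixes g :: "int \<Rightarrow> ('h::complex_hilbert)^('q::finite)"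
  assumes stat: "stationary g" and "k < n"
  shows "covariance g (int k + 1) =
    (\<Sum>l<n. covariance g (int k - int l) ** backward_coeff (covariance g) n l)"
proof -
  define C where "C = covariance g"
  define x where "x = (\<lambda>(j, b). g (int j) $ b)"
  let ?I = "{..<n} \<times> (UNIV :: 'q set)"
  \<comment> \<open>The target is \<open>g (- 1)\<close> because its Gramian with \<open>g j\<close>
    is \<open>C (j + 1)\<close>, which is block \<open>j\<close> of \<open>Ycol C\<close>.\<close>
  have "\<exists>c. \<forall>k\<in>?I. (\<Sum>i\<in>?I. cinner (x k) (x i) * c i) = cinner (x k) (g (- 1) $ a)" for a
    by (rule gram_solvable) simp
  then obtain c where
    c: "\<And>a k. k \<in> ?I \<Longrightarrow> (\<Sum>i\<in>?I. cinner (x k) (x i) * c a i) = cinner (x k) (g (- 1) $ a)"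
    by metis
  define D :: "'q blockvec" where "D l = (\<chi> b a. c a (l, b))" for l
  have entry: "cinner (g (int j) $ a) (g m $ b) = C (int j - m) $ a $ b" for j m a b
    using gramian_stationary[OF stat, of "int j" m] by (simp add: C_def gramian_def vec_eq_iff)
  have D: "block_mult_col n (Tmat C) D j = Ycol C j" if "j < n" for j
  proof -
    have "block_mult_col n (Tmat C) D j $ a $ b = Ycol C j $ a $ b" for a b
      using c[of "(j, a)" b] that
      by (simp add: x_def entry block_mult_col_def Tmat_def Ycol_def D_def matrix_matrix_mult_def
          sum_component sum.cartesian_product')
    then show ?thesis by (simp add: vec_eq_iff)
  qed
  have herm: "block_adjoint (Tmat C) = Tmat C"
    using covariance_minus[OF stat] unfolding block_adjoint_def Tmat_def C_def
    by (metis minus_diff_eq)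
  let ?T = "Tmat C" and ?P = "block_pinv n (Tmat C)"
  have "block_mult_col n ?T (backward_coeff C n) k =
      block_mult_col n ?T (block_mult_col n ?P (block_mult_col n ?T D)) k"
    by (simp add: backward_coeff_def block_mult_col_def[of n ?P] D)
  also have "\<dots> = block_mult_col n (block_mult n (block_mult n ?T ?P) ?T) D k"
    by (simp add: block_mult_col_assoc)
  also have "\<dots> = block_mult_col n ?T D k"
    using block_pinv_self_adjoint[OF herm, of n] \<open>k < n\<close> unfolding block_eq_def
    by (simp add: block_mult_col_def)
  finally show ?thesis using D[OF \<open>k < n\<close>]
    by (simp add: block_mult_col_def Tmat_def Ycol_def C_def algebra_simps)
qed

text \<open>The forward recursion carries the backward one from \<open>k < n\<close> to all \<open>k\<close>.\<close>

lemma backward_recursion: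
  fixes g :: "int \<Rightarrow> ('h::complex_hilbert)^('q::finite)"
  assumes stat: "stationary g" and eq: "predictor g n = full_predictor g"
  shows "covariance g (int k + 1) =
    (\<Sum>l<n. covariance g (int k - int l) ** backward_coeff (covariance g) n l)"
proof (induction k rule: less_induct)
  case (less k)
  define C where "C = covariance g"
  define D where "D = backward_coeff C n"
  note IH = less.IH[folded C_def, folded D_def]
  obtain A where A: "\<And>k. k \<ge> 1 \<Longrightarrow> C k = (\<Sum>j=1..n. A j ** C (k - int j))"
    using autoregressive_recursion[OF stat eq] unfolding C_def by blast
  show ?case
  proof (cases "k < n")
    case True
    then show ?thesis by (rule backward_recursion_initial[OF stat])
  next
    case False
    \<comment> \<open>The forward recursion at \<open>k + 1\<close>. Since
      \<open>1 \<le> j \<le> n \<le> k\<close>, each \<open>k - j\<close> is a natural number below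
      \<open>k\<close>, and the induction hypothesis applies to it.\<close>
    have "C (int k + 1) = (\<Sum>j=1..n. A j ** C (int (k - j) + 1))"
      using False by (subst A) (auto intro!: sum.cong simp: of_nat_diff algebra_simps)
    also have "\<dots> = (\<Sum>j=1..n. A j ** (\<Sum>l<n. C (int (k - j) - int l) ** D l))"
      using False by (intro sum.cong refl) (subst IH; simp)
    also have "\<dots> = (\<Sum>j=1..n. \<Sum>l<n. A j ** C (int k - int l - int j) ** D l)"
      using False by (intro sum.cong refl)
        (auto simp: sum_matrix_mult_left matrix_mul_assoc of_nat_diff algebra_simps intro!: sum.cong)
    \<comment> \<open>From \<open>l < n \<le> k\<close> follows \<open>k - l \<ge> 1\<close>, so
      after the exchange of sums the forward recursion collapses the inner one.\<close>
    also have "\<dots> = (\<Sum>l<n. C (int k - int l) ** D l)"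
      using False by (subst sum.swap) (auto intro!: sum.cong simp: sum_matrix_mult_right A)
    finally show ?thesis by (simp add: C_def D_def)
  qed
qed

section \<open>Measures on the unit circle\<close>

lemma space_circle_borel [simp]: "space circle_borel = sphere 0 1"
  by (simp add: circle_borel_def space_restrict_space)

lemma borel_measurable_circle:
  "continuous_on (sphere 0 1) f \<Longrightarrow> f \<in> borel_measurable circle_borel"
  unfolding circle_borel_def by (rule borel_measurable_continuous_on_restrict)

lemma continuous_on_circle_powi: "continuous_on (sphere 0 1) (\<lambda>z::complex. z powi k)"
  by (intro continuous_intros) auto

lemma simple_integral_expand:
  fixes s :: "'a \<Rightarrow> complex"
  assumes "finite_measure M" "simple_function M s"
  shows "integral\<^sup>L M s = (\<Sum>y\<in>s ` space M. y * measure M (s -` {y} \<inter> space M))"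
proof -
  interpret finite_measure M by fact
  have fin: "finite (s ` space M)" and [measurable]: "\<And>y. s -` {y} \<inter> space M \<in> sets M"
    using assms(2) by (auto simp: simple_function_def intro: simple_functionD)
  have "integral\<^sup>L M s =
      (\<integral>x. (\<Sum>y\<in>s ` space M. y * complex_of_real (indicator (s -` {y} \<inter> space M) x)) \<partial>M)"
  proof (intro Bochner_Integration.integral_cong refl)
    fix x assume x: "x \<in> space M"
    have "(\<Sum>y\<in>s ` space M. y * complex_of_real (indicator (s -` {y} \<inter> space M) x)) =
        (\<Sum>y\<in>s ` space M. if y = s x then y else 0)"
      using x by (intro sum.cong) (auto simp: indicator_def)
    then show "s x = (\<Sum>y\<in>s ` space M. y * complex_of_real (indicator (s -` {y} \<inter> space M) x))"
      using x fin by simp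
  qed
  also have "\<dots> = (\<Sum>y\<in>s ` space M. y * (\<integral>x. complex_of_real (indicator (s -` {y} \<inter> space M) x) \<partial>M))"
    by (subst Bochner_Integration.integral_sum)
      (auto intro!: integrable_of_real integrable_real_indicator simp: less_top[symmetric])
  also have "\<dots> = (\<Sum>y\<in>s ` space M. y * measure M (s -` {y} \<inter> space M))"
    by (intro sum.cong refl) simp
  finally show ?thesis .
qed

text \<open>Equality on sets passes to simple functions by linearity and to bounded measurable
  functions by dominated convergence. This makes an integral against a complex measure independent
  of the chosen splitting.\<close>

lemma measure_combination_integral_eq:
  fixes f :: "'a \<Rightarrow> complex" and M :: "'i \<Rightarrow> 'a measure" and M' :: "'j \<Rightarrow> 'a measure"
  assumes M: "\<And>i. i \<in> I \<Longrightarrow> finite_measure (M i) \<and> sets (M i) = sets N"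
    and M': "\<And>j. j \<in> J \<Longrightarrow> finite_measure (M' j) \<and> sets (M' j) = sets N"
    and eq: "\<And>B. B \<in> sets N \<Longrightarrow>
      (\<Sum>i\<in>I. c i * complex_of_real (measure (M i) B)) = (\<Sum>j\<in>J. c' j * complex_of_real (measure (M' j) B))"
    and f: "f \<in> borel_measurable N" and bound: "\<And>x. x \<in> space N \<Longrightarrow> cmod (f x) \<le> K"
  shows "(\<Sum>i\<in>I. c i * integral\<^sup>L (M i) f) = (\<Sum>j\<in>J. c' j * integral\<^sup>L (M' j) f)"
proof -
  obtain s where s: "\<And>k. simple_function N (s k)" "\<And>x. x \<in> space N \<Longrightarrow> (\<lambda>k. s k x) \<longlonglongrightarrow> f x"
      "\<And>k x. x \<in> space N \<Longrightarrow> dist (s k x) 0 \<le> 2 * dist (f x) 0"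
    using borel_measurable_implies_sequence_metric[OF f, of 0] by blast
  have lim: "(\<lambda>k. integral\<^sup>L L (s k)) \<longlonglongrightarrow> integral\<^sup>L L f"
    and val: "integral\<^sup>L L (s k) = (\<Sum>y\<in>s k ` space N. y * measure L (s k -` {y} \<inter> space N))"
    if L: "finite_measure L \<and> sets L = sets N" for L :: "'a measure" and k
  proof -
    interpret finite_measure L using L by blast
    have sp: "space L = space N" using L sets_eq_imp_space_eq by blast
    have [measurable_cong]: "sets L = sets N" using L by blast
    have simple: "simple_function L (s k)" for k
      using s(1)[of k] L sp by (simp add: simple_function_def)
    show "(\<lambda>k. integral\<^sup>L L (s k)) \<longlonglongrightarrow> integral\<^sup>L L f"
    proof (rule integral_dominated_convergence[where w = "\<lambda>_. 2 * K"])
      show "f \<in> borel_measurable L" using f by measurable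
      show "s k \<in> borel_measurable L" for k using simple by (rule borel_measurable_simple_function)
      show "AE x in L. norm (s k x) \<le> 2 * K" for k
        using s(3)[of _ k] bound sp by (intro AE_I2) (fastforce simp: dist_norm)
    qed (use s(2) sp in auto)
    show "integral\<^sup>L L (s k) = (\<Sum>y\<in>s k ` space N. y * measure L (s k -` {y} \<inter> space N))"
      using simple_integral_expand[OF _ simple, of k] L sp by simp
  qed
  have meas: "s k -` {y} \<inter> space N \<in> sets N" for k y
    using s(1) by (rule simple_functionD)
  have "(\<Sum>i\<in>I. c i * integral\<^sup>L (M i) (s k)) = (\<Sum>j\<in>J. c' j * integral\<^sup>L (M' j) (s k))" for k
  proof -
    have "(\<Sum>i\<in>I. c i * integral\<^sup>L (M i) (s k)) =
        (\<Sum>y\<in>s k ` space N. y * (\<Sum>i\<in>I. c i * measure (M i) (s k -` {y} \<inter> space N)))"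
      by (simp add: val M sum_distrib_left, subst sum.swap) (simp add: algebra_simps)
    also have "\<dots> = (\<Sum>y\<in>s k ` space N. y * (\<Sum>j\<in>J. c' j * measure (M' j) (s k -` {y} \<inter> space N)))"
      by (intro sum.cong refl arg_cong2[where f="(*)"] eq meas)
    also have "\<dots> = (\<Sum>j\<in>J. c' j * integral\<^sup>L (M' j) (s k))"
      by (simp add: val M' sum_distrib_left, subst sum.swap) (simp add: algebra_simps)
    finally show ?thesis .
  qed
  moreover have "(\<lambda>k. \<Sum>i\<in>I. c i * integral\<^sup>L (M i) (s k)) \<longlonglongrightarrow> (\<Sum>i\<in>I. c i * integral\<^sup>L (M i) f)"
    by (intro tendsto_intros lim M)
  moreover have "(\<lambda>k. \<Sum>j\<in>J. c' j * integral\<^sup>L (M' j) (s k)) \<longlonglongrightarrow> (\<Sum>j\<in>J. c' j * integral\<^sup>L (M' j) f)"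
    by (intro tendsto_intros lim M')
  ultimately show ?thesis using LIMSEQ_unique by simp
qed

section \<open>Trigonometric polynomials and uniqueness of Fourier coefficients\<close>

text \<open>Only the values on the unit circle are prescribed, so that polynomials in
  \<open>Re z\<close> and \<open>Im z\<close> qualify through
  \<open>cnj z = z powi (- 1)\<close>.\<close>

inductive trig_poly :: "(complex \<Rightarrow> complex) \<Rightarrow> bool"
  where
    monom: "(\<And>z. cmod z = 1 \<Longrightarrow> f z = c * z powi k) \<Longrightarrow> trig_poly f"
  | add: "trig_poly g \<Longrightarrow> trig_poly h \<Longrightarrow> (\<And>z. cmod z = 1 \<Longrightarrow> f z = g z + h z) \<Longrightarrow> trig_poly f"

lemma trig_poly_mult:
  assumes "trig_poly f" "trig_poly g"
  shows "trig_poly (\<lambda>z. f z * g z)"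
  using assms
proof (induction f rule: trig_poly.induct)
  case f: (monom f c k)
  from f(2) show ?case
  proof (induction g rule: trig_poly.induct)
    case (monom g d l)
    have "f z * g z = (c * d) * z powi (k + l)" if "cmod z = 1" for z
      using that by (subst power_int_add) (auto simp: f(1) monom(1))
    then show ?case by (rule trig_poly.monom)
  next
    case (add g h f')
    then show ?case by (auto intro!: trig_poly.add[OF add.IH] simp: distrib_left)
  qed
next
  case (add g' h f')
  then show ?case
    by (auto intro!: trig_poly.add[OF add.IH(1)[OF add.prems] add.IH(2)[OF add.prems]] simp: distrib_right)
qed

lemma trig_poly_real_polynomial:
  assumes "real_polynomial_function (p :: complex \<Rightarrow> real)"
  shows "trig_poly (\<lambda>z. complex_of_real (p z))"
  using assms
proof (induction p rule: real_polynomial_function.induct)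
  case (linear f)
  interpret bounded_linear f by fact
  \<comment> \<open>From \<open>f z = Re z * f 1 + Im z * f \<i>\<close> with
    \<open>Re z = (z + 1/z) / 2\<close> and \<open>Im z = (z - 1/z) / (2 \<i>)\<close> on the
    circle.\<close>
  have "complex_of_real (f z) = ((f 1 - \<i> * f \<i>) / 2) * z powi 1 + ((f 1 + \<i> * f \<i>) / 2) * z powi (- 1)"
    if "cmod z = 1" for z
  proof -
    have "f z = f (Re z *\<^sub>R 1 + Im z *\<^sub>R \<i>)"
      by (intro arg_cong[where f=f]) (simp add: complex_eq_iff)
    also have "\<dots> = Re z * f 1 + Im z * f \<i>" by (simp only: add scaleR) simp
    finally have "f z = Re z * f 1 + Im z * f \<i>" .
    moreover have "z powi (- 1) = cnj z"
    proof -
      have "z * cnj z = 1" using that complex_norm_square[of z] by simp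
      then show ?thesis using inverse_unique[of z "cnj z"] by (simp add: power_int_minus)
    qed
    moreover have "complex_of_real (Re z * f 1 + Im z * f \<i>) =
        ((f 1 - \<i> * f \<i>) / 2) * z + ((f 1 + \<i> * f \<i>) / 2) * cnj z"
      by (simp add: complex_eq_iff diff_divide_distrib add_divide_distrib algebra_simps)
    ultimately show ?thesis by (simp only: power_int_1_right)
  qed
  then show ?case
    by (rule trig_poly.add[OF trig_poly.monom[OF refl] trig_poly.monom[OF refl]])
next
  case (const c)
  then show ?case by (intro trig_poly.monom[of _ "complex_of_real c" 0]) simp
next
  case (add f g)
  then show ?case by (auto intro: trig_poly.add[OF add.IH])
next
  case (mult f g)
  then show ?case using trig_poly_mult by fastforce
qed

lemma integrable_bounded_mult:
  fixes f h :: "'a \<Rightarrow> complex"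
  assumes "integrable M h" "f \<in> borel_measurable M" "\<And>x. x \<in> space M \<Longrightarrow> cmod (f x) \<le> K"
  shows "integrable M (\<lambda>x. f x * h x)"
proof (rule Bochner_Integration.integrable_bound)
  show "integrable M (\<lambda>x. K * cmod (h x))" using assms(1) by simp
  show "AE x in M. norm (f x * h x) \<le> norm (K * cmod (h x))"
    using assms(3) by (intro AE_I2) (auto simp: norm_mult abs_mult intro!: mult_right_mono
        intro: order_trans[OF _ abs_ge_self])
qed (use assms in measurable)

text \<open>A complex measure on the circle with vanishing Fourier coefficients is zero. It is
  represented as a finite sum of densities \<open>h i\<close> against different measures
  \<open>M i\<close>, which allows the parts of \<mu> and a density against arc length to be
  compared without building a signed measure. Vanishing passes to continuous functions by uniform
  approximation, to closed sets by dominated convergence and to Borel sets by a Dynkin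
  argument.\<close>

lemma trig_moments_unique:
  fixes h :: "'i \<Rightarrow> complex \<Rightarrow> complex" and M :: "'i \<Rightarrow> complex measure"
  assumes "finite I" and setsM: "\<And>i. i \<in> I \<Longrightarrow> sets (M i) = sets circle_borel"
    and int: "\<And>i. i \<in> I \<Longrightarrow> integrable (M i) (h i)"
    and moments: "\<And>k. (\<Sum>i\<in>I. \<integral>z. z powi k * h i z \<partial>M i) = 0"
    and "B \<in> sets circle_borel"
  shows "(\<Sum>i\<in>I. \<integral>z. indicator B z *\<^sub>R h i z \<partial>M i) = 0"
proof -
  have spM: "space (M i) = sphere 0 1" if "i \<in> I" for i
    using sets_eq_imp_space_eq[OF setsM[OF that]] by simp
  have cont_int: "integrable (M i) (\<lambda>z. f z * h i z)"
    if "i \<in> I" and f: "continuous_on (sphere 0 1) f" for i f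
  proof -
    have "bounded (f ` sphere 0 1)"
      using f compact_continuous_image compact_imp_bounded compact_sphere by blast
    then obtain K where K: "\<And>z. z \<in> sphere 0 1 \<Longrightarrow> cmod (f z) \<le> K"
      unfolding bounded_iff by blast
    have "f \<in> borel_measurable (M i)"
      using borel_measurable_circle[OF f] measurable_cong_sets[OF setsM[OF \<open>i \<in> I\<close>] refl] by blast
    then show ?thesis using integrable_bounded_mult[OF int] K spM \<open>i \<in> I\<close> by auto
  qed
  have trig: "(\<forall>i\<in>I. integrable (M i) (\<lambda>z. f z * h i z)) \<and> (\<Sum>i\<in>I. \<integral>z. f z * h i z \<partial>M i) = 0"
    if "trig_poly f" for f
    using that
  proof (induction f rule: trig_poly.induct)
    case (monom f c k)
    have *: "integrable (M i) (\<lambda>z. c * (z powi k * h i z))" if "i \<in> I" for i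
      using cont_int[OF that continuous_on_circle_powi] by simp
    have eq: "f z * h i z = c * (z powi k * h i z)" if "i \<in> I" "z \<in> space (M i)" for i z
      using that monom spM by simp
    have "(\<Sum>i\<in>I. \<integral>z. f z * h i z \<partial>M i) = (\<Sum>i\<in>I. \<integral>z. c * (z powi k * h i z) \<partial>M i)"
      by (intro sum.cong Bochner_Integration.integral_cong refl eq)
    also have "\<dots> = c * (\<Sum>i\<in>I. \<integral>z. z powi k * h i z \<partial>M i)"
      by (simp add: sum_distrib_left)
    finally have "(\<Sum>i\<in>I. \<integral>z. f z * h i z \<partial>M i) = 0" using moments by simp
    moreover have "integrable (M i) (\<lambda>z. f z * h i z)" if "i \<in> I" for i
      by (subst Bochner_Integration.integrable_cong[OF refl, OF eq[OF that]], assumption)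
        (rule *[OF that])
    ultimately show ?case by blast
  next
    case (add g k f)
    have eq: "f z * h i z = g z * h i z + k z * h i z" if "i \<in> I" "z \<in> space (M i)" for i z
      using that add spM by (simp add: distrib_right)
    have "(\<Sum>i\<in>I. \<integral>z. f z * h i z \<partial>M i) = (\<Sum>i\<in>I. \<integral>z. g z * h i z + k z * h i z \<partial>M i)"
      by (intro sum.cong Bochner_Integration.integral_cong refl eq)
    also have "\<dots> = (\<Sum>i\<in>I. (\<integral>z. g z * h i z \<partial>M i) + (\<integral>z. k z * h i z \<partial>M i))"
      using add by (intro sum.cong Bochner_Integration.integral_add) auto
    also have "\<dots> = 0" using add by (simp add: sum.distrib)
    finally have "(\<Sum>i\<in>I. \<integral>z. f z * h i z \<partial>M i) = 0" .
    moreover have "integrable (M i) (\<lambda>z. f z * h i z)" if "i \<in> I" for i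
      by (subst Bochner_Integration.integrable_cong[OF refl, OF eq[OF that]], assumption)
        (intro Bochner_Integration.integrable_add; use add.IH that in auto)
    ultimately show ?case by blast
  qed
  define K where "K = (\<Sum>i\<in>I. \<integral>z. cmod (h i z) \<partial>M i)"
  have cont: "(\<Sum>i\<in>I. \<integral>z. complex_of_real (f z) * h i z \<partial>M i) = 0"
    if f: "continuous_on (sphere 0 1) f" for f :: "complex \<Rightarrow> real"
  proof -
    let ?L = "\<lambda>f. \<Sum>i\<in>I. \<integral>z. complex_of_real (f z) * h i z \<partial>M i"
    \<comment> \<open>The functional vanishes at the polynomial \<open>p\<close>, so its value at
      \<open>f\<close> is its value at \<open>f - p\<close>, and \<open>K\<close> is the total mass
      of the densities.\<close>
    have le: "cmod (?L f) \<le> e * K" if "0 < e" for e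
    proof -
      obtain p where p: "real_polynomial_function p" "\<And>z. z \<in> sphere 0 1 \<Longrightarrow> \<bar>f z - p z\<bar> < e"
        using Stone_Weierstrass_real_polynomial_function[OF compact_sphere f \<open>0 < e\<close>] by blast
      note tp = trig[OF trig_poly_real_polynomial[OF p(1)]]
      have f': "continuous_on (sphere 0 1) (\<lambda>z. complex_of_real (f z))"
        by (intro continuous_intros f)
      have "?L f = (\<Sum>i\<in>I. (\<integral>z. complex_of_real (f z) * h i z \<partial>M i) - (\<integral>z. complex_of_real (p z) * h i z \<partial>M i))"
        using tp by (simp add: sum_subtractf)
      also have "\<dots> = (\<Sum>i\<in>I. \<integral>z. complex_of_real (f z) * h i z - complex_of_real (p z) * h i z \<partial>M i)"
        using tp cont_int[OF _ f'] by (intro sum.cong Bochner_Integration.integral_diff[symmetric]) auto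
      also have "cmod \<dots> \<le> (\<Sum>i\<in>I. cmod (\<integral>z. complex_of_real (f z) * h i z - complex_of_real (p z) * h i z \<partial>M i))"
        by (rule norm_sum)
      also have "\<dots> \<le> (\<Sum>i\<in>I. \<integral>z. e * cmod (h i z) \<partial>M i)"
      proof (intro sum_mono order_trans[OF integral_norm_bound])
        fix i assume i: "i \<in> I"
        show "(\<integral>z. cmod (complex_of_real (f z) * h i z - complex_of_real (p z) * h i z) \<partial>M i) \<le> (\<integral>z. e * cmod (h i z) \<partial>M i)"
        proof (rule integral_mono)
          show "integrable (M i) (\<lambda>z. cmod (complex_of_real (f z) * h i z - complex_of_real (p z) * h i z))"
            using tp cont_int[OF i f'] i by (intro integrable_norm Bochner_Integration.integrable_diff) auto
          fix z assume "z \<in> space (M i)"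
          then have "\<bar>f z - p z\<bar> \<le> e" using p(2)[of z] spM[OF i] by auto
          then have "cmod (complex_of_real (f z - p z)) * cmod (h i z) \<le> e * cmod (h i z)"
            unfolding norm_of_real by (rule mult_right_mono) simp
          then show "cmod (complex_of_real (f z) * h i z - complex_of_real (p z) * h i z) \<le> e * cmod (h i z)"
            by (simp flip: left_diff_distrib norm_mult)
        qed (use int[OF i] in simp)
      qed
      also have "\<dots> = e * K" by (simp add: K_def sum_distrib_left)
      finally show ?thesis .
    qed
    have "K \<ge> 0" unfolding K_def by (intro sum_nonneg) simp
    have "cmod (?L f) \<le> e" if "0 < e" for e
    proof -
      \<comment> \<open>Dividing by \<open>K + 1\<close> rather than \<open>K\<close> covers
        \<open>K = 0\<close>.\<close>
      have "cmod (?L f) \<le> e / (K + 1) * K" using that \<open>K \<ge> 0\<close> by (intro le) simp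
      also have "\<dots> \<le> e" using that \<open>K \<ge> 0\<close> by (simp add: field_simps)
      finally show ?thesis .
    qed
    then have "cmod (?L f) \<le> 0" using field_le_epsilon[of "cmod (?L f)" 0] by simp
    then show ?thesis by simp
  qed
  have meas_ind: "A \<inter> sphere 0 1 \<in> sets (M i)" if "i \<in> I" "A \<in> sets borel" for i A
    unfolding setsM[OF that(1)] circle_borel_def sets_restrict_space using that(2) by auto
  \<comment> \<open>Extended to Borel sets of the plane, where the closed sets are an
    intersection-stable generator.\<close>
  define L where "L A = (\<Sum>i\<in>I. LINT z:(A \<inter> sphere 0 1)|M i. h i z)" for A
  have set_int: "set_integrable (M i) (A \<inter> sphere 0 1) (h i)" if "i \<in> I" "A \<in> sets borel" for i A
    unfolding set_integrable_def using that by (intro integrable_mult_indicator meas_ind int)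
  have L_Un: "L (A \<union> A') = L A + L A'" if "A \<inter> A' = {}" "A \<in> sets borel" "A' \<in> sets borel" for A A'
    unfolding L_def Int_Un_distrib2 sum.distrib[symmetric]
    using that by (intro sum.cong set_integral_Un set_int) auto
  have closed: "L A = 0" if "closed A" for A
  \<comment> \<open>The empty set is treated apart because \<open>infdist z {} = 0\<close>: the
    functions below would then be constantly 1.\<close>
  proof (cases "A = {}")
    case False
    \<comment> \<open>Continuous functions that equal 1 on \<open>A\<close>, vanish at distance at
      least \<open>1 / k\<close> from it, and decrease to its indicator.\<close>
    define f where "f k z = max 0 (1 - real k * infdist z A)" for k and z :: complex
    have A: "A \<in> sets borel" using that by simp
    have "(\<lambda>k. \<integral>z. complex_of_real (f k z) * h i z \<partial>M i) \<longlonglongrightarrow>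
        (\<integral>z. indicator (A \<inter> sphere 0 1) z *\<^sub>R h i z \<partial>M i)" if i: "i \<in> I" for i
    proof (rule integral_dominated_convergence[where w = "\<lambda>z. cmod (h i z)"])
      show "(\<lambda>z. indicat_real (A \<inter> sphere 0 1) z *\<^sub>R h i z) \<in> borel_measurable (M i)"
        using set_int[OF i A] unfolding set_integrable_def by simp
      show "(\<lambda>z. complex_of_real (f k z) * h i z) \<in> borel_measurable (M i)" for k
        unfolding f_def
        by (intro borel_measurable_integrable cont_int i continuous_intros)
      show "integrable (M i) (\<lambda>z. cmod (h i z))" using int i by simp
      show "AE z in M i. cmod (complex_of_real (f k z) * h i z) \<le> cmod (h i z)" for k
      proof (intro AE_I2)
        fix z
        have "\<bar>f k z\<bar> \<le> 1" by (simp add: f_def infdist_nonneg)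
        then show "cmod (complex_of_real (f k z) * h i z) \<le> cmod (h i z)"
          by (simp add: norm_mult mult_left_le_one_le)
      qed
      show "AE z in M i. (\<lambda>k. complex_of_real (f k z) * h i z) \<longlonglongrightarrow> indicat_real (A \<inter> sphere 0 1) z *\<^sub>R h i z"
      proof (intro AE_I2)
        fix z assume "z \<in> space (M i)"
        then have z: "z \<in> sphere 0 1" using spM i by blast
        have "(\<lambda>k. f k z) \<longlonglongrightarrow> indicator (A \<inter> sphere 0 1) z"
        proof (cases "z \<in> A")
          case True
          then show ?thesis using z by (simp add: f_def)
        next
          case F: False
          then have pos: "0 < infdist z A"
            using \<open>closed A\<close> \<open>A \<noteq> {}\<close> infdist_nonneg[of z A] in_closed_iff_infdist_zero[of A z] by fastforce
          obtain k0 :: nat where "1 / infdist z A < k0" using reals_Archimedean2 by blast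
          then have "f k z = 0" if "k \<ge> k0" for k
          proof -
            have "1 < real k0 * infdist z A"
              using pos \<open>1 / infdist z A < k0\<close> by (simp add: divide_less_eq)
            also have "\<dots> \<le> real k * infdist z A" using that pos by (intro mult_right_mono) auto
            finally show ?thesis by (simp add: f_def)
          qed
          then have "eventually (\<lambda>k. f k z = 0) sequentially"
            unfolding eventually_sequentially by blast
          then show ?thesis using F by (simp add: tendsto_eventually)
        qed
        then show "(\<lambda>k. complex_of_real (f k z) * h i z) \<longlonglongrightarrow> indicat_real (A \<inter> sphere 0 1) z *\<^sub>R h i z"
          unfolding scaleR_conv_of_real by (intro tendsto_intros)
      qed
    qed
    then have "(\<lambda>k. \<Sum>i\<in>I. \<integral>z. complex_of_real (f k z) * h i z \<partial>M i) \<longlonglongrightarrow> L A"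
      unfolding L_def set_lebesgue_integral_def by (intro tendsto_sum)
    moreover have "(\<Sum>i\<in>I. \<integral>z. complex_of_real (f k z) * h i z \<partial>M i) = 0" for k
      unfolding f_def by (intro cont continuous_intros)
    ultimately have "(\<lambda>k. 0) \<longlonglongrightarrow> L A" by simp
    then show ?thesis by (simp add: LIMSEQ_const_iff)
  qed (simp add: L_def set_lebesgue_integral_def)
  have borel: "L A = 0" if "A \<in> sets borel" for A
  proof -
    have "Int_stable (Collect closed :: complex set set)"
      by (auto simp: Int_stable_def)
    moreover have "Collect closed \<subseteq> Pow (UNIV :: complex set)" by simp
    moreover have "A \<in> sigma_sets UNIV (Collect closed)"
      using that unfolding borel_eq_closed by simp
    ultimately show ?thesis
    proof (induction A rule: sigma_sets_induct_disjoint)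
      case (compl A)
      from compl(1) have A: "A \<in> sets borel" unfolding borel_eq_closed by simp
      have "L (A \<union> (UNIV - A)) = L A + L (UNIV - A)"
        using A by (intro L_Un) auto
      then show ?case using closed[of UNIV] compl by (simp add: Un_Diff_cancel)
    next
      case (union A)
      from union(2) have A: "A k \<in> sets borel" for k unfolding borel_eq_closed by auto
      define U where "U m = (\<Union>k<m. A k)" for m
      have U: "U m \<in> sets borel" for m
        unfolding U_def by (rule sets.finite_UN) (use A in simp_all)
      have LU: "L (U m) = 0" for m
      proof (induction m)
        case (Suc m)
        have disj: "U m \<inter> A m = {}"
        proof -
          have "A k \<inter> A m = {}" if "k < m" for k
            using union(1) that by (simp add: disjoint_family_on_def)
          then show ?thesis by (auto simp: U_def)
        qed
        have "U (Suc m) = U m \<union> A m" by (simp add: U_def lessThan_Suc Un_commute)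
        then show ?case using L_Un[OF disj U A] Suc union(3)[of m] by simp
      qed (simp add: U_def L_def set_lebesgue_integral_def)
      have UU: "(\<Union>m. U m \<inter> sphere 0 1) = (\<Union>k. A k) \<inter> sphere 0 1"
        unfolding U_def by blast
      have "(\<lambda>m. L (U m)) \<longlonglongrightarrow> L (\<Union>k. A k)"
        unfolding L_def UU[symmetric]
      proof (intro tendsto_sum set_integral_cont_up)
        fix i assume i: "i \<in> I"
        show "incseq (\<lambda>m. U m \<inter> sphere 0 1)" unfolding U_def incseq_def by force
        show "set_integrable (M i) (\<Union>m. U m \<inter> sphere 0 1) (h i)"
          unfolding UU using A i by (intro set_int) auto
      qed (use meas_ind U in auto)
      then show ?case by (simp add: LU LIMSEQ_const_iff)
    next
      case (basic A)
      then show ?case by (intro closed) simp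
    next
      case empty
      show ?case by (rule closed) simp
    qed
  qed
  obtain A where A: "A \<in> sets borel" "B = sphere 0 1 \<inter> A"
    using assms(5) unfolding circle_borel_def sets_restrict_space by auto
  then have "L A = (\<Sum>i\<in>I. \<integral>z. indicator B z *\<^sub>R h i z \<partial>M i)"
    by (simp add: L_def set_lebesgue_integral_def Int_commute)
  then show ?thesis using borel[OF A(1)] by simp
qed

section \<open>Complex analysis on the unit disc\<close>

text \<open>A permutation contributes to either determinant only if it sends \<open>r\<close> to
  \<open>k\<close>, and then row \<open>r\<close> is used nowhere else. So replacing the column
  alone gives the same determinant; this is the form that occurs in Cramer's rule.\<close>

lemma adjugate_nth:
  fixes A :: "complex^'n^'n"
  shows "adjugate A $ k $ r = det (\<chi> i j. if j = k then (if i = r then 1 else 0) else A $ i $ j)"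
proof -
  let ?X = "(\<chi> i j. if i = r \<and> j = k then 1 else if i = r \<or> j = k then 0 else A $ i $ j) :: complex^'n^'n"
  let ?Y = "(\<chi> i j. if j = k then (if i = r then 1 else 0) else A $ i $ j) :: complex^'n^'n"
  have "(\<Prod>i\<in>UNIV. ?X $ i $ p i) = (\<Prod>i\<in>UNIV. ?Y $ i $ p i)" if p: "p permutes (UNIV :: 'n set)" for p
  proof (cases "p r = k")
    case True
    have "p i = k \<longleftrightarrow> i = r" for i
      using True permutes_inj[OF p] by (metis injD)
    then show ?thesis by (intro prod.cong refl) auto
  next
    case False
    obtain i where i: "p i = k" using permutes_surj[OF p] by (metis surjD)
    then have "?X $ i $ p i = 0" "?Y $ i $ p i = 0" using False by auto
    then have "(\<Prod>i\<in>UNIV. ?X $ i $ p i) = 0" "(\<Prod>i\<in>UNIV. ?Y $ i $ p i) = 0"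
      by (meson finite UNIV_I prod_zero)+
    then show ?thesis by (rule trans[OF _ sym])
  qed
  then have "det ?X = det ?Y" unfolding det_def by (intro sum.cong refl) simp
  then show ?thesis by (simp add: adjugate_def)
qed

lemma adjugate_eq_right_inverse:
  fixes A B :: "complex^'n^'n"
  assumes "A ** B = mat 1"
  shows "adjugate A = det A *\<^sub>m B"
proof -
  have "adjugate A $ k $ r = det A * B $ k $ r" for k r
  proof -
    have *: "(A *v column r B) $ i = (if i = r then 1 else 0)" for i
      using arg_cong[OF assms, of "\<lambda>M. M $ i $ r"]
      by (simp add: matrix_vector_mult_def matrix_matrix_mult_def column_def mat_def)
    have "adjugate A $ k $ r = column r B $ k * det A"
      using cramer_lemma[of k A "column r B"] unfolding * adjugate_nth .
    then show ?thesis by (simp add: column_def)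
  qed
  then show ?thesis by (simp add: vec_eq_iff mscale_def)
qed

lemma matrix_inv_inverse:
  fixes A :: "complex^'n^'n"
  assumes "det A \<noteq> 0"
  shows "A ** matrix_inv A = mat 1" "matrix_inv A ** A = mat 1"
proof -
  have "\<exists>B. A ** B = mat 1 \<and> B ** A = mat 1"
    using assms invertible_det_nz[of A] by (simp add: invertible_def)
  then have "A ** matrix_inv A = mat 1 \<and> matrix_inv A ** A = mat 1"
    unfolding matrix_inv_def by (rule someI_ex)
  then show "A ** matrix_inv A = mat 1" "matrix_inv A ** A = mat 1" by auto
qed

lemma matrix_mult_mscale_right: "A ** (c *\<^sub>m B) = c *\<^sub>m (A ** (B::complex^'n^'m))"
  by (simp add: vec_eq_iff mscale_def matrix_matrix_mult_def sum_distrib_left mult.left_commute)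

lemma matrix_mult_mscale_left: "(c *\<^sub>m A) ** B = c *\<^sub>m (A ** (B::complex^'n^'m))"
  by (simp add: vec_eq_iff mscale_def matrix_matrix_mult_def sum_distrib_left mult.assoc)

lemma mult_matrix_inv_nth:
  fixes A B :: "complex^'n^'n"
  assumes "det B \<noteq> 0"
  shows "(A ** matrix_inv B) $ i $ j = (A ** adjugate B) $ i $ j / det B"
proof -
  have "A ** adjugate B = det B *\<^sub>m (A ** matrix_inv B)"
    using adjugate_eq_right_inverse[OF matrix_inv_inverse(1)[OF assms]]
    by (simp add: matrix_mult_mscale_right)
  then show ?thesis using assms by (simp add: mscale_def)
qed

section \<open>Arc length and Cauchy's theorem\<close>

lemma finite_measure_arc_length: "finite_measure arc_length"
  and cis_measurable: "cis \<in> restrict_space lborel {0..<2 * pi} \<rightarrow>\<^sub>M circle_borel"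
proof -
  show *: "cis \<in> restrict_space lborel {0..<2 * pi} \<rightarrow>\<^sub>M circle_borel"
    unfolding circle_borel_def
  proof (rule measurable_restrict_space2)
    have "cis \<in> borel_measurable borel"
      by (intro borel_measurable_continuous_onI continuous_intros)
    then show "cis \<in> borel_measurable (restrict_space lborel {0..<2 * pi})"
      by (intro measurable_restrict_space1) simp
  qed simp
  have "finite_measure (restrict_space lborel {0..<2 * pi})"
    by (rule finite_measureI) (simp add: space_restrict_space emeasure_restrict_space)
  then show "finite_measure arc_length"
    unfolding arc_length_def using * by (rule finite_measure.finite_measure_distr)
qed

lemma sets_arc_length: "sets arc_length = sets circle_borel"
  by (simp add: arc_length_def)

lemma integrable_continuous_circle:
  fixes f :: "complex \<Rightarrow> 'b::euclidean_space"
  assumes "finite_measure M" "sets M = sets circle_borel" "continuous_on (sphere 0 1) f"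
  shows "integrable M f"
proof -
  interpret finite_measure M by fact
  have "bounded (f ` sphere 0 1)"
    using assms(3) compact_continuous_image compact_imp_bounded compact_sphere by blast
  then obtain K where K: "\<And>z. z \<in> sphere 0 1 \<Longrightarrow> norm (f z) \<le> K"
    unfolding bounded_iff by blast
  have "space M = sphere 0 1" using sets_eq_imp_space_eq[OF assms(2)] by simp
  moreover have "f \<in> borel_measurable M"
    using borel_measurable_circle[OF assms(3)] measurable_cong_sets[OF assms(2) refl] by blast
  ultimately show ?thesis using K by (intro integrable_const_bound[of _ K]) auto
qed

lemma arc_length_has_integral:
  fixes f :: "complex \<Rightarrow> complex"
  assumes "continuous_on (sphere 0 1) f"
  shows "((\<lambda>t. f (cis t)) has_integral (\<integral>z. f z \<partial>arc_length)) {0..2 * pi}"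
proof -
  let ?g = "\<lambda>t. f (cis t)"
  have cont: "continuous_on {0..2 * pi} ?g"
    by (rule continuous_on_compose2[OF assms]) (auto intro: continuous_intros)
  then have "set_integrable lborel {0..2 * pi} ?g" by (rule borel_integrable_atLeastAtMost')
  then have int: "set_integrable lborel {0..<2 * pi} ?g"
    by (rule set_integrable_subset) auto
  have "(\<integral>z. f z \<partial>arc_length) = (\<integral>t. ?g t \<partial>restrict_space lborel {0..<2 * pi})"
    unfolding arc_length_def
    using cis_measurable borel_measurable_circle[OF assms] by (rule integral_distr)
  also have "\<dots> = (LINT t:{0..<2 * pi}|lborel. ?g t)"
    by (simp add: integral_restrict_space set_lebesgue_integral_def)
  also have "\<dots> = integral {0..<2 * pi} ?g" by (rule set_borel_integral_eq_integral(2)[OF int])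
  also have "\<dots> = integral {0..2 * pi} ?g"
  proof (rule integral_subset_negligible)
    have "{0..2 * pi} - {0..<2 * pi} = {2 * pi}" by auto
    then show "negligible ({0..2 * pi} - {0..<2 * pi})" by simp
  qed auto
  finally show ?thesis
    using integrable_integral[OF integrable_continuous_interval[OF cont]] by simp
qed

text \<open>On the unit circle \<open>dz / z = \<i> dt\<close>.\<close>

lemma contour_integral_circle_arc_length:
  fixes f :: "complex \<Rightarrow> complex"
  assumes f: "continuous_on (sphere 0 1) f"
    and int: "((\<lambda>z. f z / z) has_contour_integral I) (circlepath 0 1)"
  shows "(\<integral>z. f z \<partial>arc_length) = I / \<i>"
proof -
  have "((\<lambda>t. f (0 + 1 * cis t) / (0 + 1 * cis t) * 1 * \<i> * cis t) has_integral I) {0..2 * pi}"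
    using int unfolding circlepath_def
    by (subst (asm) has_contour_integral_part_circlepath_iff) simp_all
  then have "((\<lambda>t. \<i> * f (cis t)) has_integral I) {0..2 * pi}" by (simp add: mult.commute)
  moreover have "((\<lambda>t. \<i> * f (cis t)) has_integral \<i> * (\<integral>z. f z \<partial>arc_length)) {0..2 * pi}"
    by (intro has_integral_mult_right arc_length_has_integral f)
  ultimately have "\<i> * (\<integral>z. f z \<partial>arc_length) = I" by (rule has_integral_unique[symmetric])
  then show ?thesis by auto
qed

lemma power_series_coeff:
  fixes f :: "complex \<Rightarrow> complex" and c :: "nat \<Rightarrow> complex"
  assumes sums: "\<And>z. cmod z < 1 \<Longrightarrow> (\<lambda>k. c k * z ^ k) sums f z"
  shows "c k = (deriv ^^ k) f 0 / fact k"
proof -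
  have "f has_fps_expansion Abs_fps c"
    unfolding has_fps_expansion_def
  proof
    have "fps_conv_radius (Abs_fps c) \<ge> norm (1/2 :: complex)"
      unfolding fps_conv_radius_def using sums[of "1/2"]
      by (intro conv_radius_geI) (simp add: sums_iff)
    moreover have "0 < ereal (norm (1/2 :: complex))" by simp
    ultimately show "0 < fps_conv_radius (Abs_fps c)" by (rule less_le_trans[rotated])
    have "eval_fps (Abs_fps c) z = f z" if "z \<in> ball 0 1" for z
      using sums[of z] that by (simp add: eval_fps_def sums_iff)
    then show "eventually (\<lambda>z. eval_fps (Abs_fps c) z = f z) (nhds 0)"
      by (intro eventually_nhds_in_open[THEN eventually_mono, of "ball 0 1"]) auto
  qed
  from fps_nth_fps_expansion[OF this, of k] show ?thesis by simp
qed

text \<open>Continuity up to the boundary allows Cauchy's theorem on the circle itself. Negative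
  powers give Cauchy's formula for derivatives at 0, hence Taylor coefficients; positive powers
  leave an integrand that is holomorphic inside.\<close>

lemma circle_fourier_coeff:
  fixes f :: "complex \<Rightarrow> complex" and c :: "nat \<Rightarrow> complex"
  assumes cont: "continuous_on (cball 0 1) f"
    and sums: "\<And>z. cmod z < 1 \<Longrightarrow> (\<lambda>k. c k * z ^ k) sums f z"
  shows "(\<integral>z. z powi (- int k) * f z \<partial>arc_length) = 2 * pi * c k"
    and "k > 0 \<Longrightarrow> (\<integral>z. z powi (int k) * f z \<partial>arc_length) = 0"
proof -
  have holo: "f holomorphic_on ball 0 1"
    using sums by (intro power_series_holomorphic[of 0 1 c]) simp
  have conts: "continuous_on (sphere 0 1) f"
    by (rule continuous_on_subset[OF cont]) (simp add: sphere_cball)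
  have c: "continuous_on (sphere 0 1) (\<lambda>z. z powi m * f z)" for m
    by (intro continuous_on_mult continuous_on_circle_powi conts)
  have coeff: "(2 * pi * \<i>) / fact k * (deriv ^^ k) f 0 = (2 * pi * \<i>) * c k"
    using power_series_coeff[OF sums, of k] by simp
  have integrand: "(\<lambda>u. f u / (u - 0) ^ Suc k) = (\<lambda>u. (u powi (- int k) * f u) / u)"
    by (simp add: fun_eq_iff power_int_minus divide_inverse)
  have "((\<lambda>u. f u / (u - 0) ^ Suc k) has_contour_integral
      (2 * pi * \<i>) / fact k * (deriv ^^ k) f 0) (circlepath 0 1)"
    by (rule Cauchy_has_contour_integral_higher_derivative_circlepath[OF cont holo]) simp
  then have "((\<lambda>u. (u powi (- int k) * f u) / u) has_contour_integral (2 * pi * \<i>) * c k) (circlepath 0 1)"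
    unfolding coeff integrand .
  from contour_integral_circle_arc_length[OF c this]
  show "(\<integral>z. z powi (- int k) * f z \<partial>arc_length) = 2 * pi * c k" by simp
  assume "k > 0"
  \<comment> \<open>The factor \<open>1 / z\<close> of \<open>dz / z\<close> uses up one power,
    which is available for \<open>k > 0\<close> only.\<close>
  define j where "j = k - 1"
  have k: "k = Suc j" using \<open>k > 0\<close> by (simp add: j_def)
  have "((\<lambda>u. (u ^ j * f u)) has_contour_integral 0) (circlepath 0 1)"
  proof (rule Cauchy_theorem_disc[where K = "{}" and a = 0 and e = 1])
    fix x :: complex assume "x \<in> ball 0 1 - {}"
    then show "(\<lambda>u. u ^ j * f u) field_differentiable at x"
      using holo by (intro field_differentiable_mult field_differentiable_power
          field_differentiable_ident) (auto simp: holomorphic_on_open field_differentiable_def)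
  qed (auto intro!: continuous_intros cont simp: path_image_circlepath)
  then have "((\<lambda>u. (u powi int k * f u) / u) has_contour_integral 0) (circlepath 0 1)"
  proof (rule has_contour_integral_eq)
    fix x assume "x \<in> path_image (circlepath 0 1)"
    then have "x \<noteq> 0" by (auto simp: path_image_circlepath)
    then show "x ^ j * f x = (x powi int k * f x) / x" by (simp add: k power_int_add)
  qed
  from contour_integral_circle_arc_length[OF c this]
  show "(\<integral>z. z powi (int k) * f z \<partial>arc_length) = 0" by simp
qed

section \<open>Poles on the circle and removable singularities\<close>

lemma isCont_holomorphic: "f holomorphic_on S \<Longrightarrow> open S \<Longrightarrow> z \<in> S \<Longrightarrow> isCont f z"
  using continuous_on_eq_continuous_at holomorphic_on_imp_continuous_on by blast

text \<open>For an entire function, boundedness information along one sequence determines the order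
  of a zero. Multiplying the assumed limit by \<open>s k - v\<close> gives limit 0 for the exponent
  \<open>N\<close>; the value \<open>q v = 0\<close> carried by the induction then permits one more
  division by \<open>z - v\<close>.\<close>

lemma holomorphic_factor_power:
  fixes p :: "complex \<Rightarrow> complex"
  assumes "p holomorphic_on UNIV" "s \<longlonglongrightarrow> v" "\<And>k. s k \<noteq> v"
    and "(\<lambda>k. p (s k) / (s k - v) ^ N) \<longlonglongrightarrow> L"
  shows "\<exists>q. q holomorphic_on UNIV \<and> (\<forall>z. p z = (z - v) ^ N * q z) \<and> q v = L"
  using assms(4)
proof (induction N arbitrary: L)
  case 0
  have "isCont p v" by (rule isCont_holomorphic[OF assms(1)]) auto
  then have "(\<lambda>k. p (s k)) \<longlonglongrightarrow> p v" using assms(2) by (rule isCont_tendsto_compose)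
  then have "p v = L" using 0 LIMSEQ_unique by simp
  then show ?case using assms(1) by (intro exI[of _ p]) simp
next
  case (Suc N)
  have "(\<lambda>k. p (s k) / (s k - v) ^ Suc N * (s k - v)) \<longlonglongrightarrow> L * (v - v)"
    by (intro tendsto_intros Suc.prems assms(2))
  then have "(\<lambda>k. p (s k) / (s k - v) ^ N) \<longlonglongrightarrow> 0" using assms(3) by simp
  from Suc.IH[OF this] obtain q where q: "q holomorphic_on UNIV" "\<And>z. p z = (z - v) ^ N * q z" "q v = 0"
    by blast
  define h where "h = (\<lambda>z. if z = v then deriv q v else (q z - q v) / (z - v))"
  have h: "h holomorphic_on UNIV" unfolding h_def by (intro pole_lemma_open q open_UNIV)
  have ph: "p z = (z - v) ^ Suc N * h z" for z using q by (simp add: h_def)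
  have "isCont h v" by (rule isCont_holomorphic[OF h]) auto
  then have "(\<lambda>k. h (s k)) \<longlonglongrightarrow> h v" using assms(2) by (rule isCont_tendsto_compose)
  moreover have "h (s k) = p (s k) / (s k - v) ^ Suc N" for k using assms(3)[of k] by (simp add: ph)
  ultimately have "h v = L" using Suc.prems LIMSEQ_unique by simp
  then show ?case using h ph by blast
qed

lemma higher_deriv_power_mult:
  fixes q :: "complex \<Rightarrow> complex"
  assumes "q holomorphic_on S" "open S" "v \<in> S"
  shows "(deriv ^^ N) (\<lambda>z. (z - v) ^ N * q z) v = fact N * q v"
proof -
  have "(deriv ^^ N) (\<lambda>z. (z - v) ^ N * q z) v =
      (\<Sum>i = 0..N. of_nat (N choose i) * (deriv ^^ i) (\<lambda>z. (z - v) ^ N) v * (deriv ^^ (N - i)) q v)"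
    using assms by (intro higher_deriv_mult[of _ S] holomorphic_intros)
  also have "\<dots> = (\<Sum>i = 0..N. if i = N then fact N * q v else 0)"
  proof (intro sum.cong refl)
    fix i assume "i \<in> {0..N}"
    then show "of_nat (N choose i) * (deriv ^^ i) (\<lambda>z. (z - v) ^ N) v * (deriv ^^ (N - i)) q v =
        (if i = N then fact N * q v else 0)"
      by (auto simp: higher_deriv_power pochhammer_fact power_0_left)
  qed
  finally show ?thesis by simp
qed

text \<open>Dividing out the zero of \<open>d\<close>, the limit along \<open>s\<close> forces \<open>p\<close> to vanish at \<open>v\<close> to order at
  least \<open>m - 1\<close>; the two leading Taylor coefficients then express the residue.\<close>

lemma simple_pole_of_radial_limit:
  fixes p d :: "complex \<Rightarrow> complex"
  assumes p: "p holomorphic_on UNIV" and d: "d holomorphic_on UNIV" and "d v = 0" "d w \<noteq> 0" "v \<noteq> 0"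
    and s: "s \<longlonglongrightarrow> v" "\<And>k. s k \<noteq> v"
    and lim: "(\<lambda>k. (v - s k) * (p (s k) / d (s k))) \<longlonglongrightarrow> c"
  defines "m \<equiv> nat (zorder d v)"
  shows "- of_nat m / (2 * v * (deriv ^^ m) d v) * (deriv ^^ (m - 1)) p v = c / (2 * v)" (is ?res)
    and "\<exists>r>0. \<exists>q. q holomorphic_on ball v r \<and> q v = - c \<and>
      (\<forall>z\<in>ball v r - {v}. d z \<noteq> 0 \<and> p z / d z = q z / (z - v))" (is ?form)
proof -
  define h where "h = zor_poly d v"
  obtain r where "m > 0" "r > 0" and h: "h holomorphic_on cball v r"
    and dh: "\<And>w. w \<in> cball v r \<Longrightarrow> d w = h w * (w - v) ^ m" "\<And>w. w \<in> cball v r \<Longrightarrow> h w \<noteq> 0"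
  proof -
    have "\<exists>w\<in>UNIV. d w \<noteq> 0" using \<open>d w \<noteq> 0\<close> by blast
    from zorder_exist_zero[OF d open_UNIV connected_UNIV UNIV_I this, of v] \<open>d v = 0\<close>
    have "zorder d v > 0" "\<exists>r>0. h holomorphic_on cball v r \<and>
        (\<forall>w\<in>cball v r. d w = h w * (w - v) ^ m \<and> h w \<noteq> 0)"
      by (auto simp: m_def h_def)
    then show thesis using that by (auto simp: m_def)
  qed
  define N where "N = m - 1"
  have m: "m = Suc N" using \<open>m > 0\<close> by (simp add: N_def)
  have hb: "h holomorphic_on ball v r" by (rule holomorphic_on_subset[OF h]) auto
  have "isCont h v" by (rule isCont_holomorphic[OF hb]) (use \<open>r > 0\<close> in auto)
  then have "(\<lambda>k. h (s k)) \<longlonglongrightarrow> h v" using s(1) by (rule isCont_tendsto_compose)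
  then have "(\<lambda>k. - ((v - s k) * (p (s k) / d (s k)) * h (s k))) \<longlonglongrightarrow> - (c * h v)"
    by (intro tendsto_intros lim)
  \<comment> \<open>With \<open>d = h (z - v)^m\<close> the factor \<open>v - s k\<close> cancels
    one of the \<open>m\<close> factors; the sign comes from
    \<open>v - s = - (s - v)\<close>.\<close>
  moreover have "eventually (\<lambda>k. - ((v - s k) * (p (s k) / d (s k)) * h (s k)) = p (s k) / (s k - v) ^ N) sequentially"
  proof -
    have "eventually (\<lambda>k. s k \<in> ball v r) sequentially"
      using s(1) \<open>r > 0\<close> by (intro topological_tendstoD) auto
    then show ?thesis
    proof eventually_elim
      case (elim k)
      then have "s k \<in> cball v r" by auto
      then have ds: "d (s k) = h (s k) * ((s k - v) * (s k - v) ^ N)" and "h (s k) \<noteq> 0"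
        using dh by (auto simp: m)
      have vs: "v - s k = - (s k - v)" and "s k - v \<noteq> 0" using s(2) by auto
      then show ?case
        using \<open>h (s k) \<noteq> 0\<close> unfolding ds vs by (simp del: minus_diff_eq)
    qed
  qed
  ultimately have "(\<lambda>k. p (s k) / (s k - v) ^ N) \<longlonglongrightarrow> - (c * h v)"
    using tendsto_cong by force
  from holomorphic_factor_power[OF p s this] obtain k where
    k: "k holomorphic_on UNIV" "\<And>z. p z = (z - v) ^ N * k z" "k v = - (c * h v)"
    by blast
  have hv: "h v \<noteq> 0" using dh(2)[of v] \<open>r > 0\<close> by simp
  have "(deriv ^^ N) p v = fact N * k v"
    using higher_deriv_power_mult[OF k(1) open_UNIV UNIV_I, of N v] by (simp add: k(2)[abs_def] fun_eq_iff)
  moreover have "(deriv ^^ m) d v = fact m * h v"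
  proof -
    have "(deriv ^^ m) d v = (deriv ^^ m) (\<lambda>z. (z - v) ^ m * h z) v"
      using \<open>r > 0\<close> d dh by (intro higher_deriv_transform_within_open[of _ "ball v r"])
        (auto intro!: holomorphic_intros hb intro: holomorphic_on_subset simp: mult.commute)
    then show ?thesis using higher_deriv_power_mult[OF hb open_ball, of v m] \<open>r > 0\<close> by simp
  qed
  moreover have "1 + complex_of_nat N \<noteq> 0"
    using of_nat_neq_0[of N, where ?'a = complex] unfolding of_nat_Suc .
  \<comment> \<open>Here \<open>m! = m * N!\<close>, so the factorials and \<open>h v\<close> cancel
    and only \<open>c / (2 * v)\<close> is left.\<close>
  ultimately show ?res
    using hv \<open>v \<noteq> 0\<close> by (simp add: m k(3) divide_simps) (simp add: algebra_simps)
  show ?form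
  proof (intro exI[of _ r] conjI exI[of _ "\<lambda>z. k z / h z"] ballI)
    show "(\<lambda>z. k z / h z) holomorphic_on ball v r"
      using dh(2) by (intro holomorphic_intros hb holomorphic_on_subset[OF k(1)]) auto
    show "k v / h v = - c" using hv by (simp add: k(3))
    fix z assume z: "z \<in> ball v r - {v}"
    then have "z \<in> cball v r" "z - v \<noteq> 0" by auto
    then show "d z \<noteq> 0" using dh by simp
    show "p z / d z = k z / h z / (z - v)"
      using \<open>z \<in> cball v r\<close> \<open>z - v \<noteq> 0\<close> dh by (simp add: m k(2))
  qed fact
qed

lemma remove_sings_eq_analytic:
  assumes "G analytic_on {z}" "eventually (\<lambda>w. f w = G w) (at z)"
  shows "remove_sings f z = G z"
  using remove_sings_cong[OF assms(2) refl] assms(1) by simp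

text \<open>Agreement in a punctured neighbourhood of \<open>z\<close> is also agreement near each
  other point of it, so \<open>remove_sings f\<close> coincides with \<open>G\<close> on a full
  neighbourhood.\<close>

lemma analytic_on_remove_sings:
  assumes "G analytic_on {z}" "eventually (\<lambda>w. f w = G w) (at z)"
  shows "remove_sings f analytic_on {z}"
proof -
  obtain A where A: "open A" "z \<in> A" "G holomorphic_on A"
    using assms(1) by (auto simp: analytic_at)
  obtain B where B: "open B" "z \<in> B" "\<And>w. w \<in> B \<Longrightarrow> w \<noteq> z \<Longrightarrow> f w = G w"
    using assms(2) unfolding eventually_at_topological by blast
  have eq: "remove_sings f w = G w" if "w \<in> A \<inter> B" for w
  proof (rule remove_sings_eq_analytic)
    show "G analytic_on {w}" using A that by (auto simp: analytic_at)
    have "eventually (\<lambda>u. u \<in> B - {z}) (at w)"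
    proof (cases "w = z")
      case True
      then show ?thesis using B eventually_at_in_open[of B z] by simp
    next
      case False
      then show ?thesis using B that by (intro eventually_at_in_open') (auto intro: open_delete)
    qed
    then show "eventually (\<lambda>u. f u = G u) (at w)"
      by eventually_elim (use B in auto)
  qed
  have "G holomorphic_on A \<inter> B" by (rule holomorphic_on_subset[OF A(3)]) auto
  then have "remove_sings f holomorphic_on A \<inter> B" by (rule holomorphic_transform) (simp add: eq)
  then show ?thesis
    unfolding analytic_at using A B by (intro exI[of _ "A \<inter> B"] conjI open_Int) auto
qed

section \<open>The Herglotz kernel\<close>

text \<open>The kernel is \<open>2 / (1 - w) - 1\<close>; the coefficients
  \<open>1, 2, 2, ...\<close> are the origin of \<open>Gam\<close>.\<close>

lemma herglotz_kernel_sums: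
  assumes "cmod w < 1"
  shows "(\<lambda>k. (if k = 0 then 1 else 2) * w ^ k) sums ((1 + w) / (1 - w))"
proof -
  have "1 - w \<noteq> 0" using assms by auto
  have "(\<lambda>k. 2 * w ^ k) sums (2 * (1 / (1 - w)))" by (intro sums_mult geometric_sums assms)
  then have "(\<lambda>k. 2 * w ^ k - (if k = 0 then 1 else 0)) sums (2 * (1 / (1 - w)) - 1)"
    using sums_single[of 0 "\<lambda>_. 1::complex"] by (intro sums_diff) auto
  moreover have "2 * (1 / (1 - w)) - 1 = (1 + w) / (1 - w)"
    using \<open>1 - w \<noteq> 0\<close> by (simp add: field_simps)
  moreover have "(\<lambda>k. 2 * w ^ k - (if k = 0 then 1 else 0)) = (\<lambda>k. (if k = 0 then 1 else 2) * w ^ k)"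
    by (auto simp: fun_eq_iff)
  ultimately show ?thesis by simp
qed

lemma herglotz_kernel_sums_circle:
  assumes "cmod z < 1" "cmod v = 1"
  shows "(\<lambda>k. (if k = 0 then 1 else 2) * v powi (- int k) * z ^ k) sums ((v + z) / (v - z))"
proof -
  have "v \<noteq> 0" using assms by auto
  have "(1 + z / v) / (1 - z / v) = (v + z) / (v - z)"
  proof -
    have "1 + z / v = (v + z) / v" "1 - z / v = (v - z) / v"
      using \<open>v \<noteq> 0\<close> by (simp_all add: add_divide_distrib diff_divide_distrib)
    then show ?thesis using \<open>v \<noteq> 0\<close> by simp
  qed
  moreover have "(z / v) ^ k = v powi (- int k) * z ^ k" for k
    using \<open>v \<noteq> 0\<close> by (simp add: power_int_minus field_simps)
  ultimately show ?thesis
    using herglotz_kernel_sums[of "z / v"] assms by (simp add: norm_divide mult.assoc)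
qed

lemma continuous_on_herglotz_kernel:
  "cmod z < 1 \<Longrightarrow> continuous_on (sphere 0 1) (\<lambda>v. (v + z) / (v - z))"
  by (intro continuous_intros) auto

lemma herglotz_transform_sums:
  assumes M: "finite_measure M" "sets M = sets circle_borel" and z: "cmod z < 1"
  shows "(\<lambda>k. (if k = 0 then 1 else 2) * (\<integral>v. v powi (- int k) \<partial>M) * z ^ k) sums
    (\<integral>v. (v + z) / (v - z) \<partial>M)"
proof -
  interpret finite_measure M by fact
  have sp: "space M = sphere 0 1" using sets_eq_imp_space_eq[OF M(2)] by simp
  define f where "f k v = (if k = 0 then 1 else 2) * v powi (- int k) * z ^ k" for k and v :: complex
  have norm_f: "cmod (f k v) = (if k = 0 then 1 else 2) * cmod z ^ k" if "v \<in> space M" for k v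
    using that sp by (simp add: f_def norm_mult norm_power norm_power_int)
  have summ: "summable (\<lambda>k. (if k = 0 then 1 else 2) * cmod z ^ k)"
    by (rule summable_comparison_test'[of "\<lambda>k. 2 * cmod z ^ k" 0])
      (use z in \<open>auto intro: summable_mult summable_geometric\<close>)
  have "(\<lambda>k. integral\<^sup>L M (f k)) sums (\<integral>v. (\<Sum>k. f k v) \<partial>M)"
  proof (rule sums_integral)
    show "integrable M (f k)" for k
      unfolding f_def
      by (intro integrable_continuous_circle[OF M] continuous_on_mult continuous_on_const
          continuous_on_circle_powi)
    show "AE v in M. summable (\<lambda>k. cmod (f k v))"
      using summ by (intro AE_I2) (simp add: norm_f)
    have "(\<integral>v. cmod (f k v) \<partial>M) = measure M (space M) * ((if k = 0 then 1 else 2) * cmod z ^ k)" for k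
      by (subst Bochner_Integration.integral_cong[OF refl norm_f]) simp_all
    then show "summable (\<lambda>k. \<integral>v. cmod (f k v) \<partial>M)"
      using summ by (simp add: summable_mult)
  qed
  moreover have "(\<integral>v. (\<Sum>k. f k v) \<partial>M) = (\<integral>v. (v + z) / (v - z) \<partial>M)"
  proof (intro Bochner_Integration.integral_cong refl)
    fix v assume "v \<in> space M"
    then have "cmod v = 1" using sp by simp
    from herglotz_kernel_sums_circle[OF z this]
    show "(\<Sum>k. f k v) = (v + z) / (v - z)" by (simp add: f_def sums_iff)
  qed
  moreover have "integral\<^sup>L M (f k) = (if k = 0 then 1 else 2) * (\<integral>v. v powi (- int k) \<partial>M) * z ^ k" for k
    unfolding f_def by simp
  ultimately show ?thesis by simp
qed

text \<open>On the radius to \<open>v\<close> one has \<open>|v - s| = 1 - |s| \<le> |u - s|\<close>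
  for all \<open>u\<close> on the circle, so \<open>(v - s) (u + s) / (u - s)\<close> is bounded by
  2. Pointwise it tends to \<open>2 v\<close> at \<open>u = v\<close> and to 0 elsewhere, and
  dominated convergence isolates the atom.\<close>

lemma herglotz_transform_radial_limit:
  assumes M: "finite_measure M" "sets M = sets circle_borel" and v: "cmod v = 1"
  defines "s \<equiv> \<lambda>k::nat. of_real (1 - 1 / (real k + 1)) * v"
  shows "(\<lambda>k. (v - s k) * (\<integral>u. (u + s k) / (u - s k) \<partial>M)) \<longlonglongrightarrow> 2 * v * measure M {v}"
proof -
  interpret finite_measure M by fact
  have sp: "space M = sphere 0 1" using sets_eq_imp_space_eq[OF M(2)] by simp
  define r where "r k = 1 - 1 / (real k + 1)" for k :: nat
  have r: "0 \<le> r k" "r k < 1" for k by (auto simp: r_def field_simps)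
  have s: "s k = of_real (r k) * v" for k by (simp add: s_def r_def)
  have norm_s: "cmod (s k) = r k" for k using r v by (simp add: s norm_mult)
  have vs: "v - s k = of_real (1 - r k) * v" for k by (simp add: s algebra_simps)
  have norm_vs: "cmod (v - s k) = 1 - r k" for k
    unfolding vs norm_mult norm_of_real using r[of k] v by simp
  have "r \<longlonglongrightarrow> 1 - 0"
    unfolding r_def by (intro tendsto_intros LIMSEQ_Suc[OF lim_1_over_n, unfolded of_nat_Suc add.commute[of 1]])
  then have "(\<lambda>k. of_real (r k) * v) \<longlonglongrightarrow> of_real 1 * v" by (intro tendsto_intros) simp
  then have s_lim: "s \<longlonglongrightarrow> v" by (simp add: s[abs_def])
  have [measurable]: "{v} \<in> sets M"
    unfolding M(2) circle_borel_def sets_restrict_space using v by auto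
  have "(\<lambda>k. \<integral>u. (v - s k) * ((u + s k) / (u - s k)) \<partial>M) \<longlonglongrightarrow> (\<integral>u. indicator {v} u *\<^sub>R (2 * v) \<partial>M)"
  proof (rule integral_dominated_convergence[where w = "\<lambda>_. 2"])
    show "(\<lambda>u. (v - s k) * ((u + s k) / (u - s k))) \<in> borel_measurable M" for k
      using r norm_s by (intro borel_measurable_integrable integrable_continuous_circle[OF M]
          continuous_on_mult continuous_on_const continuous_on_herglotz_kernel) simp
    show "AE u in M. cmod ((v - s k) * ((u + s k) / (u - s k))) \<le> 2" for k
    proof (intro AE_I2)
      fix u assume "u \<in> space M"
      then have u: "cmod u = 1" using sp by simp
      have "cmod (v - s k) \<le> cmod (u - s k)"
        using norm_triangle_ineq2[of u "s k"] u norm_s norm_vs by simp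
      moreover have "cmod (u + s k) \<le> 2"
        using norm_triangle_ineq[of u "s k"] u norm_s r[of k] by simp
      ultimately have "cmod (v - s k) * cmod (u + s k) \<le> cmod (u - s k) * 2"
        by (intro mult_mono) auto
      moreover have "0 < cmod (u - s k)" using u norm_s[of k] r[of k] by auto
      ultimately show "cmod ((v - s k) * ((u + s k) / (u - s k))) \<le> 2"
        by (simp add: norm_mult norm_divide pos_divide_le_eq mult.commute)
    qed
    show "AE u in M. (\<lambda>k. (v - s k) * ((u + s k) / (u - s k))) \<longlonglongrightarrow> indicat_real {v} u *\<^sub>R (2 * v)"
    proof (intro AE_I2)
      fix u
      show "(\<lambda>k. (v - s k) * ((u + s k) / (u - s k))) \<longlonglongrightarrow> indicat_real {v} u *\<^sub>R (2 * v)"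
      proof (cases "u = v")
        case True
        have "v - s k \<noteq> 0" for k using norm_vs[of k] r[of k] by auto
        then have "(\<lambda>k. (v - s k) * ((u + s k) / (u - s k))) = (\<lambda>k. v + s k)" using True by simp
        moreover have "(\<lambda>k. v + s k) \<longlonglongrightarrow> v + v" by (intro tendsto_intros s_lim)
        ultimately show ?thesis using True by simp
      next
        case False
        have "(\<lambda>k. (v - s k) * ((u + s k) / (u - s k))) \<longlonglongrightarrow> (v - v) * ((u + v) / (u - v))"
          using False by (intro tendsto_intros s_lim) simp
        then show ?thesis using False by simp
      qed
    qed
  qed auto
  moreover have "(\<integral>u. indicator {v} u *\<^sub>R (2 * v) \<partial>M) = 2 * v * measure M {v}"
    by (simp add: scaleR_conv_of_real mult.commute)
  ultimately show ?thesis unfolding integral_mult_right_zero by simp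
qed

section \<open>The Caratheodory function of the spectral measure\<close>

text \<open>The splitting in \<open>has_cmeasure_integral\<close> may vary with the integrand.\<close>

lemma has_cmeasure_integral_common:
  assumes "\<And>j::int. has_cmeasure_integral \<nu> (\<lambda>z. z powi (- j)) (c j)"
  shows "\<exists>M. (\<forall>l<4. finite_measure (M l) \<and> sets (M l) = sets circle_borel) \<and>
    (\<forall>B\<in>sets circle_borel. \<nu> B = (\<Sum>l<4. \<i> ^ l * complex_of_real (measure (M l) B))) \<and>
    (\<forall>j. c j = (\<Sum>l<4. \<i> ^ l * (\<integral>z. z powi (- j) \<partial>M l)))"
proof -
  define Q where "Q M \<longleftrightarrow> (\<forall>l<4. finite_measure (M l) \<and> sets (M l) = sets circle_borel) \<and>
    (\<forall>B\<in>sets circle_borel. \<nu> B = (\<Sum>l<4. \<i> ^ l * complex_of_real (measure (M l) B)))" for M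
  have ex: "\<exists>M. Q M \<and> c j = (\<Sum>l<4. \<i> ^ l * (\<integral>z. z powi (- j) \<partial>M l))" for j
    using assms[of j] unfolding has_cmeasure_integral_def Q_def by meson
  obtain M where M: "Q M" using ex[of 0] by blast
  have "c j = (\<Sum>l<4. \<i> ^ l * (\<integral>z. z powi (- j) \<partial>M l))" for j
  proof -
    obtain M' where M': "Q M'" and c: "c j = (\<Sum>l<4. \<i> ^ l * (\<integral>z. z powi (- j) \<partial>M' l))"
      using ex[of j] by blast
    show ?thesis
      unfolding c
    proof (rule measure_combination_integral_eq[where N = circle_borel and K = 1])
      show "(\<Sum>l<4. \<i> ^ l * complex_of_real (measure (M' l) B)) =
          (\<Sum>l<4. \<i> ^ l * complex_of_real (measure (M l) B))" if "B \<in> sets circle_borel" for B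
        using M M' that unfolding Q_def by metis
      show "(\<lambda>z. z powi (- j)) \<in> borel_measurable circle_borel"
        by (intro borel_measurable_circle continuous_on_circle_powi)
    qed (use M M' in \<open>auto simp: Q_def norm_power_int\<close>)
  qed
  with M show ?thesis unfolding Q_def by blast
qed

text \<open>Deleting the atoms in \<open>N\<close> is expressed by the density that vanishes on
  \<open>N\<close>, so no new measure has to be formed.\<close>

lemma integral_remove_atoms:
  fixes \<phi> :: "complex \<Rightarrow> complex"
  assumes M: "finite_measure M" "sets M = sets circle_borel" and N: "finite N" "N \<subseteq> sphere 0 1"
    and \<phi>: "integrable M \<phi>"
  shows "(\<integral>z. \<phi> z * (if z \<in> N then 0 else 1) \<partial>M) =
    (\<integral>z. \<phi> z \<partial>M) - (\<Sum>v\<in>N. \<phi> v * measure M {v})"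
    and "integrable M (\<lambda>z. \<phi> z * (if z \<in> N then 0 else 1))"
proof -
  interpret finite_measure M by fact
  have atom: "{v} \<in> sets M" if "v \<in> N" for v
    unfolding M(2) circle_borel_def sets_restrict_space using N that by auto
  have int1: "integrable M (\<lambda>z. \<phi> v * complex_of_real (indicator {v} z))" if "v \<in> N" for v
    using atom[OF that]
    by (intro integrable_mult_right integrable_of_real integrable_real_indicator)
      (auto simp: less_top[symmetric])
  have eq: "\<phi> z * (if z \<in> N then 0 else 1) =
      \<phi> z - (\<Sum>v\<in>N. \<phi> v * complex_of_real (indicator {v} z))" for z
  proof -
    have "(\<Sum>v\<in>N. \<phi> v * complex_of_real (indicator {v} z)) = (\<Sum>v\<in>N. if v = z then \<phi> v else 0)"
      by (intro sum.cong) auto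
    then show ?thesis using N(1) by simp
  qed
  have int2: "integrable M (\<lambda>z. \<Sum>v\<in>N. \<phi> v * complex_of_real (indicator {v} z))"
    using int1 by (rule Bochner_Integration.integrable_sum)
  show "integrable M (\<lambda>z. \<phi> z * (if z \<in> N then 0 else 1))"
    unfolding eq using \<phi> int2 by (rule Bochner_Integration.integrable_diff)
  have atom_int: "(\<integral>z. \<phi> v * complex_of_real (indicator {v} z) \<partial>M) = \<phi> v * measure M {v}" if "v \<in> N" for v
    using atom[OF that] sets.sets_into_space[OF atom[OF that]] by (simp add: Int_absorb2)
  have "(\<integral>z. (\<Sum>v\<in>N. \<phi> v * complex_of_real (indicator {v} z)) \<partial>M) =
      (\<Sum>v\<in>N. \<integral>z. \<phi> v * complex_of_real (indicator {v} z) \<partial>M)"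
    using int1 by (rule Bochner_Integration.integral_sum)
  also have "\<dots> = (\<Sum>v\<in>N. \<phi> v * measure M {v})" by (intro sum.cong refl atom_int)
  finally show "(\<integral>z. \<phi> z * (if z \<in> N then 0 else 1) \<partial>M) =
      (\<integral>z. \<phi> z \<partial>M) - (\<Sum>v\<in>N. \<phi> v * measure M {v})"
    unfolding eq Bochner_Integration.integral_diff[OF \<phi> int2] by simp
qed

lemma matrix_mult_add_left: "(A + B) ** X = A ** X + B ** (X :: complex^'n^'m)"
  by (simp add: vec_eq_iff matrix_matrix_mult_def sum.distrib distrib_right)

lemma matrix_mult_diff_right: "X ** (A - B) = X ** A - X ** (B :: complex^'n^'m)"
  by (simp add: vec_eq_iff matrix_matrix_mult_def sum_subtractf right_diff_distrib)

lemma holomorphic_on_det: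
  fixes A :: "complex \<Rightarrow> complex^'n^'n"
  assumes "\<And>i j. (\<lambda>z. A z $ i $ j) holomorphic_on S"
  shows "(\<lambda>z. det (A z)) holomorphic_on S"
  unfolding det_def by (intro holomorphic_intros assms)

lemma holomorphic_on_adjugate:
  fixes A :: "complex \<Rightarrow> complex^'n^'n"
  assumes "\<And>i j. (\<lambda>z. A z $ i $ j) holomorphic_on S"
  shows "(\<lambda>z. adjugate (A z) $ i $ j) holomorphic_on S"
proof -
  have "(\<lambda>z. det (\<chi> k l. if k = j \<and> l = i then 1 else if k = j \<or> l = i then 0 else A z $ k $ l))
      holomorphic_on S"
  proof (rule holomorphic_on_det)
    fix k l
    show "(\<lambda>z. (\<chi> k l. if k = j \<and> l = i then 1 else if k = j \<or> l = i then 0 else A z $ k $ l) $ k $ l)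
        holomorphic_on S"
      by (cases "k = j"; cases "l = i") (simp_all add: assms)
  qed
  then show ?thesis by (simp add: adjugate_def)
qed

lemma holomorphic_on_matrix_mult:
  fixes A B :: "complex \<Rightarrow> complex^'n^'n"
  assumes "\<And>i j. (\<lambda>z. A z $ i $ j) holomorphic_on S" "\<And>i j. (\<lambda>z. B z $ i $ j) holomorphic_on S"
  shows "(\<lambda>z. (A z ** B z) $ i $ j) holomorphic_on S"
  unfolding matrix_matrix_mult_def by (simp, intro holomorphic_intros assms)

section \<open>The polynomial matrices of the formula\<close>

lemma bfun_eq: "bfun C n z = mat 1 - (\<Sum>l<n. z ^ Suc l *\<^sub>m backward_coeff C n l)"
  unfolding bfun_def backward_coeff_def block_row_col_def erow_def matrix_mult_mscale_left
    matrix_mul_lid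
  by (simp add: vec_eq_iff mscale_def sum_component sum_distrib_left mult.assoc)

lemma afun_eq: "afun C n z = Gam C 0 + (\<Sum>k<n. z ^ Suc k *\<^sub>m
    (\<Sum>l<n. ctranspose (Gam C (int l - int k)) ** backward_coeff C n l))"
  unfolding afun_def backward_coeff_def block_row_col_def erow_def matrix_mult_mscale_left
    matrix_mul_lid block_adjoint_def Smat_def
    block_mult_col_def[of n "\<lambda>j k. ctranspose (Gam C (int k - int j))"]
  by (simp add: vec_eq_iff mscale_def sum_component sum_distrib_left mult.assoc)

lemma bfun_0: "bfun C n 0 = mat 1"
  by (simp add: bfun_eq vec_eq_iff mscale_def sum_component)

lemma holomorphic_on_bfun: "(\<lambda>z. bfun C n z $ i $ j) holomorphic_on S"
  unfolding bfun_eq by (simp add: mscale_def sum_component, intro holomorphic_intros)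

lemma holomorphic_on_afun: "(\<lambda>z. afun C n z $ i $ j) holomorphic_on S"
  unfolding afun_eq by (simp add: mscale_def sum_component, intro holomorphic_intros)

text \<open>Blockwise this is \<open>S + S^* = 2 T\<close>; at \<open>i = 0\<close> both summands
  contribute \<open>C 0\<close>. It turns the two-sided recursion for \<open>C\<close> into a
  one-sided one for \<open>Gam\<close>, with the adjoint terms as remainder.\<close>

lemma Gam_add_adjoint:
  assumes "\<And>m. C (- m) = ctranspose (C m)"
  shows "Gam C i + ctranspose (Gam C (- i)) = 2 *\<^sub>m C i"
proof -
  have C0: "cnj (C 0 $ b $ a) = C 0 $ a $ b" for a b
    using assms[of 0] by (metis ctranspose_nth minus_zero)
  have neg: "cnj (C (- i) $ b $ a) = C i $ a $ b" for a b
    using assms[of "- i"] by (simp add: ctranspose_nth)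
  show ?thesis
    by (cases "i < 0"; cases "i = 0")
      (simp_all add: Gam_def vec_eq_iff mscale_def mRe_def ctranspose_nth C0 neg)
qed

locale autoregressive_spectral =
  fixes g :: "int \<Rightarrow> ('h::complex_hilbert)^('q::finite)" and n :: nat
    and \<mu> :: "complex set \<Rightarrow> complex^'q^'q"
  assumes stat: "stationary g" and pred: "predictor g n = full_predictor g"
    and spec: "spectral_measure g \<mu>"
begin

abbreviation "C \<equiv> covariance g"
abbreviation "N \<equiv> Nset C n"
abbreviation "d \<equiv> \<lambda>z. det (bfun C n z)"
abbreviation "p \<equiv> \<lambda>i j z. (afun C n z ** adjugate (bfun C n z)) $ i $ j"

lemma C_minus: "C (- m) = ctranspose (C m)"
  by (rule covariance_minus[OF stat])

lemma C_cnj: "cnj (C m $ a $ b) = C (- m) $ b $ a"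
  by (simp add: C_minus ctranspose_nth)

lemma Gam_nonneg: "Gam C (int k) $ a $ b = (if k = 0 then 1 else 2) * C (int k) $ a $ b"
  using C_cnj[of 0 b a]
  by (cases "k = 0") (simp_all add: Gam_def mRe_def mscale_def ctranspose_nth)

definition represents :: "'q \<Rightarrow> 'q \<Rightarrow> (nat \<Rightarrow> complex measure) \<Rightarrow> bool" where
  "represents a b M \<longleftrightarrow> (\<forall>l<4. finite_measure (M l) \<and> sets (M l) = sets circle_borel) \<and>
    (\<forall>B\<in>sets circle_borel. \<mu> B $ a $ b = (\<Sum>l<4. \<i> ^ l * complex_of_real (measure (M l) B))) \<and>
    (\<forall>j. C j $ a $ b = (\<Sum>l<4. \<i> ^ l * (\<integral>z. z powi (- j) \<partial>M l)))"

text \<open>One splitting per matrix entry, chosen once, which serves all Borel sets and all Fourier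
  coefficients simultaneously.\<close>

definition parts :: "'q \<Rightarrow> 'q \<Rightarrow> nat \<Rightarrow> complex measure" where
  "parts a b = (SOME M. represents a b M)"

lemma parts:
  shows "l < 4 \<Longrightarrow> finite_measure (parts a b l)" "l < 4 \<Longrightarrow> sets (parts a b l) = sets circle_borel"
    and "B \<in> sets circle_borel \<Longrightarrow>
      \<mu> B $ a $ b = (\<Sum>l<4. \<i> ^ l * complex_of_real (measure (parts a b l) B))"
    and "C j $ a $ b = (\<Sum>l<4. \<i> ^ l * (\<integral>z. z powi (- j) \<partial>parts a b l))"
proof -
  have "has_cmeasure_integral (\<lambda>B. \<mu> B $ a $ b) (\<lambda>z. z powi (- j)) (C j $ a $ b)" for j
    using spec unfolding spectral_measure_def by simp
  then have "\<exists>M. represents a b M"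
    unfolding represents_def by (rule has_cmeasure_integral_common)
  from someI_ex[OF this, folded parts_def] have "represents a b (parts a b)" .
  then show "l < 4 \<Longrightarrow> finite_measure (parts a b l)" "l < 4 \<Longrightarrow> sets (parts a b l) = sets circle_borel"
    and "B \<in> sets circle_borel \<Longrightarrow>
      \<mu> B $ a $ b = (\<Sum>l<4. \<i> ^ l * complex_of_real (measure (parts a b l) B))"
    and "C j $ a $ b = (\<Sum>l<4. \<i> ^ l * (\<integral>z. z powi (- j) \<partial>parts a b l))"
    unfolding represents_def by blast+
qed

text \<open>The Herglotz transform of \<mu>, taken entrywise through the splitting. It makes sense
  in the whole disc, including points where \<open>bfun C n z\<close> is singular.\<close>

definition F :: "complex \<Rightarrow> complex^'q^'q" where
  "F z = (\<chi> a b. \<Sum>l<4. \<i> ^ l * (\<integral>v. (v + z) / (v - z) \<partial>parts a b l))"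

lemma F_sums:
  assumes "cmod z < 1"
  shows "(\<lambda>k. Gam C (int k) $ a $ b * z ^ k) sums (F z $ a $ b)"
proof -
  have "(\<lambda>k. \<Sum>l<4. \<i> ^ l * ((if k = 0 then 1 else 2) * (\<integral>v. v powi (- int k) \<partial>parts a b l) * z ^ k))
      sums (\<Sum>l<4. \<i> ^ l * (\<integral>v. (v + z) / (v - z) \<partial>parts a b l))"
    by (intro sums_sum sums_mult herglotz_transform_sums assms) (simp_all add: parts(1,2))
  moreover have "(\<Sum>l<4. \<i> ^ l * ((if k = 0 then 1 else 2) * (\<integral>v. v powi (- int k) \<partial>parts a b l) * z ^ k)) =
      Gam C (int k) $ a $ b * z ^ k" for k
    unfolding Gam_nonneg parts(4)[of "int k"] sum_distrib_left sum_distrib_right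
    by (intro sum.cong refl) simp
  ultimately show ?thesis by (simp add: F_def)
qed

lemma F_radial_limit:
  assumes "cmod v = 1"
  defines "s \<equiv> \<lambda>k::nat. of_real (1 - 1 / (real k + 1)) * v"
  shows "(\<lambda>k. (v - s k) * F (s k) $ a $ b) \<longlonglongrightarrow> 2 * v * \<mu> {v} $ a $ b"
proof -
  have "{v} \<in> sets circle_borel"
    unfolding circle_borel_def sets_restrict_space using assms(1) by auto
  then have \<mu>: "\<mu> {v} $ a $ b = (\<Sum>l<4. \<i> ^ l * complex_of_real (measure (parts a b l) {v}))"
    by (rule parts)
  have "(\<lambda>k. \<Sum>l<4. \<i> ^ l * ((v - s k) * (\<integral>u. (u + s k) / (u - s k) \<partial>parts a b l)))
      \<longlonglongrightarrow> (\<Sum>l<4. \<i> ^ l * (2 * v * measure (parts a b l) {v}))"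
    unfolding s_def
    by (intro tendsto_sum tendsto_mult tendsto_const herglotz_transform_radial_limit assms(1))
      (simp_all add: parts(1,2))
  moreover have "(\<Sum>l<4. \<i> ^ l * (2 * v * measure (parts a b l) {v})) = 2 * v * \<mu> {v} $ a $ b"
    unfolding \<mu> sum_distrib_left by (intro sum.cong refl) simp
  moreover have "(\<Sum>l<4. \<i> ^ l * ((v - s k) * (\<integral>u. (u + s k) / (u - s k) \<partial>parts a b l))) =
      (v - s k) * F (s k) $ a $ b" for k
    unfolding F_def vec_lambda_beta sum_distrib_left by (intro sum.cong refl) simp
  ultimately show ?thesis by simp
qed

text \<open>The Taylor coefficients of the product are the \<open>\<alpha> m\<close>. Writing
  \<open>2 C\<close> as \<open>Gam\<close> plus adjoint, the backward recursion cancels all of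
  \<open>\<alpha> (Suc k)\<close> except \<open>\<beta> k\<close>, the coefficient of
  \<open>z^(k+1)\<close> in \<open>afun\<close>; it vanishes for \<open>k \<ge> n\<close> because it
  involves \<open>Gam\<close> at negative indices only.\<close>

lemma F_mult_bfun:
  assumes z: "cmod z < 1"
  shows "F z ** bfun C n z = afun C n z"
proof -
  define D where "D = backward_coeff C n"
  define \<alpha> where "\<alpha> m = Gam C (int m) - (\<Sum>l<n. Gam C (int m - int (Suc l)) ** D l)" for m
  define \<beta> where "\<beta> k = (\<Sum>l<n. ctranspose (Gam C (int l - int k)) ** D l)" for k
  have rec: "C (int k + 1) = (\<Sum>l<n. C (int k - int l) ** D l)" for k
    unfolding D_def by (rule backward_recursion[OF stat pred])
  have \<alpha>_Suc: "\<alpha> (Suc k) = \<beta> k" for k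
  proof -
    have "Gam C (int (Suc k)) = 2 *\<^sub>m C (int k + 1)" by (simp add: Gam_def add.commute)
    also have "\<dots> = (\<Sum>l<n. (2 *\<^sub>m C (int k - int l)) ** D l)"
      unfolding rec matrix_mult_mscale_left
      by (simp add: vec_eq_iff mscale_def sum_component sum_distrib_left)
    also have "\<dots> = (\<Sum>l<n. (Gam C (int k - int l) + ctranspose (Gam C (int l - int k))) ** D l)"
      using Gam_add_adjoint[of C, OF C_minus]
      by (intro sum.cong refl arg_cong2[where f="(**)"]) (metis minus_diff_eq)
    also have "\<dots> = (\<Sum>l<n. Gam C (int k - int l) ** D l) + \<beta> k"
      by (simp add: \<beta>_def matrix_mult_add_left sum.distrib)
    finally show ?thesis by (simp add: \<alpha>_def)
  qed
  have \<beta>_0: "\<beta> k = 0" if "k \<ge> n" for k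
    unfolding \<beta>_def
    by (intro sum.neutral ballI) (use that in \<open>simp add: Gam_def ctranspose_0\<close>)
  have \<alpha>_0: "\<alpha> 0 = Gam C 0" by (simp add: \<alpha>_def Gam_def)
  have "(F z ** bfun C n z) $ a $ c = afun C n z $ a $ c" for a c
  proof -
    have mult: "(\<lambda>k. (Gam C (int k) ** B) $ a $ c * z ^ k) sums ((F z ** B) $ a $ c)" for B :: "complex^'q^'q"
    proof -
      have "(\<lambda>k. \<Sum>e\<in>UNIV. Gam C (int k) $ a $ e * z ^ k * B $ e $ c) sums (\<Sum>e\<in>UNIV. F z $ a $ e * B $ e $ c)"
        by (intro sums_sum sums_mult2 F_sums z)
      then show ?thesis
        by (simp add: matrix_matrix_mult_def sum_distrib_left sum_distrib_right mult_ac)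
    qed
    \<comment> \<open>As \<open>Gam\<close> is zero at negative indices, multiplication by
      \<open>z ^ Suc l\<close> is a plain shift of the index in a series over all
      \<open>m\<close>.\<close>
    have shift: "(\<lambda>m. (Gam C (int m - int (Suc l)) ** B) $ a $ c * z ^ m) sums
        (z ^ Suc l * (F z ** B) $ a $ c)" for l and B :: "complex^'q^'q"
    proof -
      let ?f = "\<lambda>m. (Gam C (int m - int (Suc l)) ** B) $ a $ c * z ^ m"
      have "(\<Sum>m<Suc l. ?f m) = 0"
        by (intro sum.neutral ballI) (simp add: Gam_def)
      moreover have "(\<lambda>k. ?f (k + Suc l)) sums (z ^ Suc l * (F z ** B) $ a $ c)"
        using sums_mult[OF mult[of B], of "z ^ Suc l"] by (simp add: power_add mult_ac)
      ultimately show ?thesis using sums_iff_shift[of ?f "Suc l"] by simp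
    qed
    have "(\<lambda>m. Gam C (int m) $ a $ c * z ^ m - (\<Sum>l<n. (Gam C (int m - int (Suc l)) ** D l) $ a $ c * z ^ m))
        sums (F z $ a $ c - (\<Sum>l<n. z ^ Suc l * (F z ** D l) $ a $ c))"
      by (intro sums_diff sums_sum shift F_sums z)
    moreover have "Gam C (int m) $ a $ c * z ^ m - (\<Sum>l<n. (Gam C (int m - int (Suc l)) ** D l) $ a $ c * z ^ m) =
        \<alpha> m $ a $ c * z ^ m" for m
      by (simp add: \<alpha>_def sum_component left_diff_distrib sum_distrib_right)
    moreover have "F z $ a $ c - (\<Sum>l<n. z ^ Suc l * (F z ** D l) $ a $ c) = (F z ** bfun C n z) $ a $ c"
    proof -
      have "F z ** bfun C n z = F z - (\<Sum>l<n. z ^ Suc l *\<^sub>m (F z ** D l))"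
        unfolding bfun_eq matrix_mult_diff_right sum_matrix_mult_left matrix_mult_mscale_right D_def[symmetric]
        by simp
      then show ?thesis by (simp add: sum_component mscale_def)
    qed
    ultimately have "(\<lambda>m. \<alpha> m $ a $ c * z ^ m) sums ((F z ** bfun C n z) $ a $ c)" by simp
    moreover have "(\<lambda>m. \<alpha> m $ a $ c * z ^ m) sums (\<Sum>m<Suc n. \<alpha> m $ a $ c * z ^ m)"
    proof (rule sums_finite)
      fix m assume "m \<notin> {..<Suc n}"
      then obtain k where "m = Suc k" "k \<ge> n" by (cases m) auto
      then show "\<alpha> m $ a $ c * z ^ m = 0" by (simp add: \<alpha>_Suc \<beta>_0)
    qed simp
    ultimately have "(F z ** bfun C n z) $ a $ c = (\<Sum>m<Suc n. \<alpha> m $ a $ c * z ^ m)"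
      by (rule sums_unique2)
    also have "\<dots> = afun C n z $ a $ c"
      unfolding sum.lessThan_Suc_shift afun_eq D_def[symmetric] \<beta>_def[symmetric] \<alpha>_Suc \<alpha>_0
      by (simp add: sum_component mscale_def mult.commute)
    finally show ?thesis .
  qed
  then show ?thesis by (simp add: vec_eq_iff)
qed

lemma F_eq_quotient:
  assumes "cmod z < 1" "d z \<noteq> 0"
  shows "F z $ i $ j = p i j z / d z"
proof -
  have "F z = F z ** (bfun C n z ** matrix_inv (bfun C n z))"
    using matrix_inv_inverse(1)[OF assms(2)] by simp
  also have "\<dots> = afun C n z ** matrix_inv (bfun C n z)"
    using F_mult_bfun[OF assms(1)] by (simp add: matrix_mul_assoc)
  finally show ?thesis using mult_matrix_inv_nth[OF assms(2)] by simp
qed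

lemma holomorphic_d: "d holomorphic_on S"
  by (intro holomorphic_on_det holomorphic_on_bfun)

lemma holomorphic_p: "p i j holomorphic_on S"
  by (intro holomorphic_on_matrix_mult holomorphic_on_adjugate holomorphic_on_bfun holomorphic_on_afun)

lemma d_0: "d 0 = 1"
  by (simp add: bfun_0)

lemma eventually_d_nonzero: "eventually (\<lambda>z. d z \<noteq> 0) (at v)"
proof (cases "d v = 0")
  case True
  have d0: "d 0 \<noteq> 0" by (simp add: d_0)
  obtain r where "0 < r" "\<And>z. z \<in> ball v r - {v} \<Longrightarrow> d z \<noteq> 0"
    by (rule isolated_zeros[OF holomorphic_d open_UNIV connected_UNIV UNIV_I True UNIV_I d0]) (rule that)
  then show ?thesis unfolding eventually_at by (intro exI[of _ r]) (auto simp: dist_commute)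
next
  case False
  have "isCont d v" by (rule isCont_holomorphic[OF holomorphic_d open_UNIV UNIV_I])
  then show ?thesis
    using False unfolding isCont_def by (rule tendsto_imp_eventually_ne)
qed

lemma finite_N: "finite N"
proof -
  have "finite {z \<in> sphere 0 1. d z = 0}"
  proof (cases "d constant_on UNIV")
    case True
    then have "d z = 1" for z using d_0 unfolding constant_on_def by (metis UNIV_I)
    then show ?thesis by simp
  next
    case False
    then show ?thesis
      by (intro holomorphic_compact_finite_zeros[OF holomorphic_d open_UNIV]) auto
  qed
  then show ?thesis by (simp add: Nset_def)
qed

lemma N_sphere: "v \<in> N \<Longrightarrow> cmod v = 1"
  by (simp add: Nset_def)

text \<open>The radial limit is \<open>c = 2 v \<mu>({v})\<close>, so the residue expression, equal
  to \<open>c / (2 v)\<close>, is the mass of the atom. The local form of the quotient is kept for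
  cancelling the pole in \<open>Lambda\<close>.\<close>

lemma pole_at_N:
  assumes "v \<in> N"
  shows "Xres C n v = \<mu> {v}"
    and "\<exists>r>0. \<exists>q. q holomorphic_on ball v r \<and> q v = - (2 * v * Xres C n v $ i $ j) \<and>
      (\<forall>z\<in>ball v r - {v}. d z \<noteq> 0 \<and> p i j z / d z = q z / (z - v))"
proof -
  have v: "cmod v = 1" "d v = 0" using assms by (auto simp: Nset_def)
  then have "v \<noteq> 0" by auto
  define s where "s = (\<lambda>k::nat. of_real (1 - 1 / (real k + 1)) * v)"
  have "(\<lambda>k. 1 - 1 / (real k + 1)) \<longlonglongrightarrow> 1 - 0"
    by (intro tendsto_intros LIMSEQ_Suc[OF lim_1_over_n, unfolded of_nat_Suc add.commute[of 1]])
  then have "(\<lambda>k. of_real (1 - 1 / (real k + 1)) * v) \<longlonglongrightarrow> of_real 1 * v"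
    by (intro tendsto_intros) simp
  then have s: "s \<longlonglongrightarrow> v" by (simp add: s_def)
  have norm_s: "cmod (s k) < 1" for k
  proof -
    have "0 \<le> 1 - 1 / (real k + 1)" "1 - 1 / (real k + 1) < 1" by (simp_all add: field_simps)
    then show ?thesis unfolding s_def norm_mult norm_of_real v by simp
  qed
  then have sv: "s k \<noteq> v" for k using v(1) by (metis less_irrefl)
  \<comment> \<open>\<open>F\<close> is the quotient \<open>p / d\<close> only where
    \<open>d\<close> is nonzero, and \<open>d\<close> may vanish at some early \<open>s k\<close>;
    zeros do not accumulate at \<open>v\<close>.\<close>
  have "filterlim s (at v) sequentially" using s sv by (intro filterlim_atI) auto
  from eventually_compose_filterlim[OF eventually_d_nonzero this]
  have "eventually (\<lambda>k. d (s k) \<noteq> 0) sequentially" .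
  then have ev: "eventually (\<lambda>k. (v - s k) * F (s k) $ i $ j = (v - s k) * (p i j (s k) / d (s k))) sequentially" for i j
    by eventually_elim (simp add: F_eq_quotient norm_s)
  have lim: "(\<lambda>k. (v - s k) * (p i j (s k) / d (s k))) \<longlonglongrightarrow> 2 * v * \<mu> {v} $ i $ j" for i j
  proof (rule iffD1[OF tendsto_cong[OF ev]])
    show "(\<lambda>k. (v - s k) * F (s k) $ i $ j) \<longlonglongrightarrow> 2 * v * \<mu> {v} $ i $ j"
      unfolding s_def by (rule F_radial_limit[OF v(1)])
  qed
  note pole = simple_pole_of_radial_limit[OF holomorphic_p holomorphic_d v(2) _ \<open>v \<noteq> 0\<close> s sv lim, of 0]
  have "Xres C n v $ i $ j = \<mu> {v} $ i $ j" for i j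
    using pole(1)[of i j] d_0 \<open>v \<noteq> 0\<close> by (simp add: Xres_def mscale_def zmult_def)
  then show X: "Xres C n v = \<mu> {v}" by (simp add: vec_eq_iff)
  show "\<exists>r>0. \<exists>q. q holomorphic_on ball v r \<and> q v = - (2 * v * Xres C n v $ i $ j) \<and>
      (\<forall>z\<in>ball v r - {v}. d z \<noteq> 0 \<and> p i j z / d z = q z / (z - v))"
    unfolding X using pole(2)[of i j] d_0 by simp
qed

end

section \<open>Boundary values and the representation\<close>

lemma cnj_powi_circle: "cmod z = 1 \<Longrightarrow> cnj (z powi k) = z powi (- k)"
proof -
  assume z: "cmod z = 1"
  then have "z powi k * cnj (z powi k) = 1"
    using complex_norm_square[of "z powi k"] by (simp add: norm_power_int)
  then show ?thesis by (simp add: power_int_minus inverse_unique)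
qed

context autoregressive_spectral
begin

section \<open>Analyticity of the density on the closed disc\<close>

lemma Delta_nth: "Delta C n w $ i $ j = (\<Sum>v\<in>N. (v + w) / (v - w) * Xres C n v $ i $ j)"
  by (simp add: Delta_def sum_component mscale_def)

lemma quotient_minus_Delta_nth:
  assumes "d w \<noteq> 0"
  shows "(afun C n w ** matrix_inv (bfun C n w) - Delta C n w) $ i $ j =
    p i j w / d w - (\<Sum>v\<in>N. (v + w) / (v - w) * Xres C n v $ i $ j)"
  using mult_matrix_inv_nth[OF assms] by (simp add: Delta_nth)

lemma Lambda_nth: "Lambda C n z $ i $ j =
    remove_sings (\<lambda>w. (afun C n w ** matrix_inv (bfun C n w) - Delta C n w) $ i $ j) z"
  by (simp add: Lambda_def)

lemma analytic_herglotz_sum: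
  assumes "z \<notin> A" "finite A"
  shows "(\<lambda>w. \<Sum>v\<in>A. (v + w) / (v - w) * c v) analytic_on {z}"
  using assms by (intro analytic_intros) auto

lemma F_analytic:
  assumes "cmod z < 1"
  shows "(\<lambda>w. F w $ i $ j) analytic_on {z}"
proof -
  have "(\<lambda>w. F w $ i $ j) holomorphic_on ball 0 1"
    using F_sums by (intro power_series_holomorphic[of 0 1 "\<lambda>k. Gam C (int k) $ i $ j"]) simp
  then show ?thesis using assms unfolding analytic_at by (intro exI[of _ "ball 0 1"]) auto
qed

text \<open>Across a zero of \<open>d\<close> inside the disc, \<open>F\<close> continues the
  quotient analytically, and the poles of \<open>Delta\<close> lie on the circle. Hence
  \<open>remove_sings\<close> yields \<open>F\<close> minus the kernel sum at every point of the
  disc.\<close>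

lemma Lambda_ball:
  assumes "cmod z < 1"
  shows "Lambda C n z $ i $ j = F z $ i $ j - (\<Sum>v\<in>N. (v + z) / (v - z) * Xres C n v $ i $ j)"
    and "(\<lambda>w. Lambda C n w $ i $ j) analytic_on {z}"
proof -
  have G: "(\<lambda>w. F w $ i $ j - (\<Sum>v\<in>N. (v + w) / (v - w) * Xres C n v $ i $ j)) analytic_on {z}"
    using assms N_sphere by (intro analytic_on_diff F_analytic analytic_herglotz_sum finite_N) auto
  have "eventually (\<lambda>w. w \<in> ball 0 1) (at z)"
    using assms by (intro eventually_at_in_open') auto
  then have ev: "eventually (\<lambda>w. (afun C n w ** matrix_inv (bfun C n w) - Delta C n w) $ i $ j =
      F w $ i $ j - (\<Sum>v\<in>N. (v + w) / (v - w) * Xres C n v $ i $ j)) (at z)"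
    using eventually_d_nonzero[of z]
  proof eventually_elim
    case (elim w)
    then have "cmod w < 1" "d w \<noteq> 0" by auto
    then show ?case by (simp only: quotient_minus_Delta_nth F_eq_quotient not_False_eq_True)
  qed
  show "Lambda C n z $ i $ j = F z $ i $ j - (\<Sum>v\<in>N. (v + z) / (v - z) * Xres C n v $ i $ j)"
    unfolding Lambda_nth by (rule remove_sings_eq_analytic[OF G ev])
  show "(\<lambda>w. Lambda C n w $ i $ j) analytic_on {z}"
    unfolding Lambda_nth by (rule analytic_on_remove_sings[OF G ev])
qed

lemma Lambda_circle:
  assumes "cmod z = 1"
  shows "(\<lambda>w. Lambda C n w $ i $ j) analytic_on {z}"
proof (cases "z \<in> N")
  case False
  then have "d z \<noteq> 0" using assms by (simp add: Nset_def)
  have "(\<lambda>w. p i j w / d w - (\<Sum>v\<in>N. (v + w) / (v - w) * Xres C n v $ i $ j)) analytic_on {z}"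
  proof (intro analytic_on_diff analytic_on_divide analytic_herglotz_sum finite_N False)
    show "p i j analytic_on {z}" "d analytic_on {z}"
      using holomorphic_p[of i j UNIV] holomorphic_d[of UNIV]
      by (auto simp: analytic_on_open[symmetric] intro: analytic_on_subset)
  qed (use \<open>d z \<noteq> 0\<close> in auto)
  moreover have "eventually (\<lambda>w. (afun C n w ** matrix_inv (bfun C n w) - Delta C n w) $ i $ j =
      p i j w / d w - (\<Sum>v\<in>N. (v + w) / (v - w) * Xres C n v $ i $ j)) (at z)"
    using eventually_d_nonzero[of z] by eventually_elim (rule quotient_minus_Delta_nth)
  ultimately show ?thesis unfolding Lambda_nth by (rule analytic_on_remove_sings)
next
  case True
  define X where "X v = Xres C n v $ i $ j" for v
  obtain r q where "r > 0" and q: "q holomorphic_on ball z r" "q z = - (2 * z * X z)"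
    and pq: "\<And>w. w \<in> ball z r - {z} \<Longrightarrow> d w \<noteq> 0 \<and> p i j w / d w = q w / (w - z)"
    using pole_at_N(2)[OF True, of i j] unfolding X_def by blast
  \<comment> \<open>The numerator over \<open>w - z\<close> of \<open>p / d\<close> minus the
    summand of \<open>Delta\<close> at \<open>z\<close>. It vanishes at \<open>z\<close> since
    \<open>q z = - (2 * z * X z)\<close>, so its difference quotient \<open>H\<close> fills the
    singularity.\<close>
  define S where "S w = q w + (z + w) * X z" for w
  have "S holomorphic_on ball z r" unfolding S_def by (intro holomorphic_intros q(1))
  moreover have S0: "S z = 0" by (simp add: S_def q(2) algebra_simps)
  define H where "H = (\<lambda>w. if w = z then deriv S z else (S w - S z) / (w - z))"
  have "H holomorphic_on ball z r" unfolding H_def by (rule pole_lemma_open[OF _ open_ball]) fact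
  then have "H analytic_on {z}" using \<open>r > 0\<close> unfolding analytic_at by (intro exI[of _ "ball z r"]) auto
  moreover have "(\<lambda>w. \<Sum>v\<in>N - {z}. (v + w) / (v - w) * X v) analytic_on {z}"
    using finite_N by (intro analytic_herglotz_sum) auto
  ultimately have G: "(\<lambda>w. H w - (\<Sum>v\<in>N - {z}. (v + w) / (v - w) * X v)) analytic_on {z}"
    by (intro analytic_on_diff)
  have "eventually (\<lambda>w. w \<in> ball z r - {z}) (at z)"
    using \<open>r > 0\<close> by (intro eventually_at_in_open) auto
  then have "eventually (\<lambda>w. (afun C n w ** matrix_inv (bfun C n w) - Delta C n w) $ i $ j =
      H w - (\<Sum>v\<in>N - {z}. (v + w) / (v - w) * X v)) (at z)"
  proof eventually_elim
    case (elim w)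
    then have w: "w \<noteq> z" "d w \<noteq> 0" "p i j w / d w = q w / (w - z)" using pq by auto
    have "(\<Sum>v\<in>N. (v + w) / (v - w) * X v) =
        (z + w) / (z - w) * X z + (\<Sum>v\<in>N - {z}. (v + w) / (v - w) * X v)"
      using True finite_N by (rule sum.remove[rotated])
    moreover have "q w / (w - z) - (z + w) / (z - w) * X z = H w"
    proof -
      have "(z + w) / (z - w) = - ((z + w) / (w - z))" by (metis minus_diff_eq minus_divide_right)
      then have "q w / (w - z) - (z + w) / (z - w) * X z = S w / (w - z)"
        unfolding S_def add_divide_distrib[of "q w"] by (simp only:) simp
      then show ?thesis using w(1) by (simp add: H_def S0)
    qed
    ultimately show ?case
      unfolding quotient_minus_Delta_nth[OF w(2)] w(3) X_def[symmetric] by simp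
  qed
  with G show ?thesis unfolding Lambda_nth by (rule analytic_on_remove_sings)
qed

lemma continuous_on_Lambda: "continuous_on (cball 0 1) (\<lambda>w. Lambda C n w $ i $ j)"
proof (intro continuous_at_imp_continuous_on ballI analytic_at_imp_isCont)
  fix z :: complex assume "z \<in> cball 0 1"
  then show "(\<lambda>w. Lambda C n w $ i $ j) analytic_on {z}"
    using Lambda_ball(2)[of z] Lambda_circle[of z] by (cases "cmod z < 1") auto
qed

section \<open>Fourier coefficients of the density\<close>

text \<open>By \<open>pole_at_N\<close> these are the Fourier coefficients of \<mu> with its atoms
  on \<open>N\<close> taken away.\<close>

definition moment :: "int \<Rightarrow> complex^'q^'q" where
  "moment m = C m - (\<Sum>v\<in>N. (v powi (- m)) *\<^sub>m Xres C n v)"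

lemma moment_nth: "moment m $ a $ b = C m $ a $ b - (\<Sum>v\<in>N. v powi (- m) * Xres C n v $ a $ b)"
  by (simp add: moment_def sum_component mscale_def)

lemma moment_cnj: "cnj (moment m $ a $ b) = moment (- m) $ b $ a"
proof -
  have "cnj (v powi (- m) * Xres C n v $ a $ b) = v powi m * Xres C n v $ b $ a" if "v \<in> N" for v
  proof -
    have "{v} \<in> sets circle_borel"
      unfolding circle_borel_def sets_restrict_space using N_sphere[OF that] by auto
    then have "ctranspose (\<mu> {v}) = \<mu> {v}"
      using spec unfolding spectral_measure_def nonneg_hermitian_measure_def nonneg_hermitian_def
      by blast
    then have "cnj (\<mu> {v} $ a $ b) = \<mu> {v} $ b $ a" by (metis ctranspose_nth)
    then show ?thesis
      using cnj_powi_circle[OF N_sphere[OF that], of "- m"] pole_at_N(1)[OF that] by simp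
  qed
  then show ?thesis by (simp add: moment_nth C_cnj cong: sum.cong)
qed

text \<open>\<open>F\<close> and each kernel in \<open>Delta\<close> carry the same factors
  \<open>1, 2, 2, ...\<close>, so the subtraction of \<open>Delta\<close> acts directly on the
  covariances.\<close>

lemma Lambda_sums:
  assumes z: "cmod z < 1"
  shows "(\<lambda>k. ((if k = 0 then 1 else 2) * moment (int k) $ a $ b) * z ^ k) sums (Lambda C n z $ a $ b)"
proof -
  have "(\<lambda>k. Gam C (int k) $ a $ b * z ^ k -
        (\<Sum>v\<in>N. ((if k = 0 then 1 else 2) * v powi (- int k) * z ^ k) * Xres C n v $ a $ b)) sums
      (F z $ a $ b - (\<Sum>v\<in>N. (v + z) / (v - z) * Xres C n v $ a $ b))"
    by (intro sums_diff sums_sum sums_mult2 herglotz_kernel_sums_circle F_sums z N_sphere)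
  moreover have "Gam C (int k) $ a $ b * z ^ k -
        (\<Sum>v\<in>N. ((if k = 0 then 1 else 2) * v powi (- int k) * z ^ k) * Xres C n v $ a $ b) =
      ((if k = 0 then 1 else 2) * moment (int k) $ a $ b) * z ^ k" for k
    unfolding Gam_nonneg moment_nth right_diff_distrib left_diff_distrib sum_distrib_left sum_distrib_right
    by (intro arg_cong2[where f="(-)"] refl sum.cong) (simp_all add: mult_ac)
  ultimately show ?thesis unfolding Lambda_ball(1)[OF z] by simp
qed

lemma Lambda_fourier:
  "(\<integral>z. z powi (- m) * Lambda C n z $ a $ b \<partial>arc_length) =
    (if m < 0 then 0 else if m = 0 then 2 * pi * moment m $ a $ b else 4 * pi * moment m $ a $ b)"
proof (cases "m < 0")
  case True
  then obtain k where "m = - int k" "k > 0"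
    by (metis neg_int_cases)
  then show ?thesis
    using circle_fourier_coeff(2)[OF continuous_on_Lambda Lambda_sums, of k a b] True by simp
next
  case False
  then obtain k where m: "m = int k" by (metis nat_0_le not_less)
  show ?thesis
    using circle_fourier_coeff(1)[OF continuous_on_Lambda Lambda_sums, of k a b] by (simp add: m)
qed

lemma continuous_on_circle_Lambda: "continuous_on (sphere 0 1) (\<lambda>w. Lambda C n w $ i $ j)"
  by (rule continuous_on_subset[OF continuous_on_Lambda]) (simp add: sphere_cball)

lemma mRe_nth: "mRe A $ a $ b = (A $ a $ b + cnj (A $ b $ a)) / 2"
  by (simp add: mRe_def mscale_def ctranspose_nth)

lemma continuous_on_circle_mRe_Lambda: "continuous_on (sphere 0 1) (\<lambda>w. mRe (Lambda C n w) $ i $ j)"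
  unfolding mRe_nth
  by (intro continuous_on_divide continuous_on_add continuous_on_cnj continuous_on_const
      continuous_on_circle_Lambda) simp

text \<open>For \<open>m > 0\<close> only \<open>Lambda\<close> contributes and for
  \<open>m < 0\<close> only its adjoint, each with factor \<open>4 * pi\<close>; at
  \<open>m = 0\<close> both contribute \<open>2 * pi\<close>. Half the sum has the same factor
  \<open>2 * pi\<close> for every \<open>m\<close>.\<close>

lemma mRe_Lambda_fourier:
  "(\<integral>z. z powi (- m) * mRe (Lambda C n z) $ a $ b \<partial>arc_length) = 2 * pi * moment m $ a $ b"
proof -
  note arc = finite_measure_arc_length sets_arc_length
  have int: "integrable arc_length (\<lambda>z. z powi (- m) * Lambda C n z $ a $ b)"
    by (intro integrable_continuous_circle[OF arc] continuous_on_mult continuous_on_circle_powi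
        continuous_on_circle_Lambda)
  have int': "integrable arc_length (\<lambda>z. z powi (- m) * cnj (Lambda C n z $ b $ a))"
    by (intro integrable_continuous_circle[OF arc] continuous_on_mult continuous_on_circle_powi
        continuous_on_cnj continuous_on_circle_Lambda)
  have sp: "space arc_length = sphere 0 1" using sets_eq_imp_space_eq[OF arc(2)] by simp
  have "(\<integral>z. z powi (- m) * cnj (Lambda C n z $ b $ a) \<partial>arc_length) =
      (\<integral>z. cnj (z powi (- (- m)) * Lambda C n z $ b $ a) \<partial>arc_length)"
  proof (intro Bochner_Integration.integral_cong refl)
    fix z assume "z \<in> space arc_length"
    then have "cmod z = 1" using sp by simp
    then show "z powi (- m) * cnj (Lambda C n z $ b $ a) = cnj (z powi (- (- m)) * Lambda C n z $ b $ a)"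
      using cnj_powi_circle[of z m] by simp
  qed
  also have "\<dots> = cnj (\<integral>z. z powi (- (- m)) * Lambda C n z $ b $ a \<partial>arc_length)"
    by (rule Bochner_Integration.integral_cnj)
  finally have conj: "(\<integral>z. z powi (- m) * cnj (Lambda C n z $ b $ a) \<partial>arc_length) =
    (if m > 0 then 0 else if m = 0 then 2 * pi * moment m $ a $ b else 4 * pi * moment m $ a $ b)"
    unfolding Lambda_fourier[of "- m"] by (simp add: moment_cnj)
  have "(\<integral>z. z powi (- m) * mRe (Lambda C n z) $ a $ b \<partial>arc_length) =
      (\<integral>z. (z powi (- m) * Lambda C n z $ a $ b + z powi (- m) * cnj (Lambda C n z $ b $ a)) / 2 \<partial>arc_length)"
    by (simp add: mRe_nth distrib_left)
  also have "\<dots> = ((\<integral>z. z powi (- m) * Lambda C n z $ a $ b \<partial>arc_length) +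
      (\<integral>z. z powi (- m) * cnj (Lambda C n z $ b $ a) \<partial>arc_length)) / 2"
    using int int' by simp
  also have "\<dots> = 2 * pi * moment m $ a $ b"
    unfolding conj Lambda_fourier by (cases m "0::int" rule: linorder_cases) simp_all
  finally show ?thesis .
qed

text \<open>Off the atoms \<open>\<mu>\<close> has the same Fourier coefficients as the density.\<close>

lemma absolutely_continuous_part:
  assumes B: "B \<in> sets circle_borel"
  shows "(\<Sum>l<4. \<i> ^ l * (\<integral>z. indicator B z * (if z \<in> N then 0 else 1) \<partial>parts a b l)) =
    (1 / (2 * pi)) * (LINT z:B|arc_length. mRe (Lambda C n z) $ a $ b)"
proof -
  \<comment> \<open>Index 4 carries the claimed density with a minus sign, so that the equality
    becomes the vanishing of one five-term combination.\<close>
  define M where "M l = (if l < 4 then parts a b l else arc_length)" for l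
  define h where "h l = (if l < 4 then (\<lambda>z. \<i> ^ l * (if z \<in> N then 0 else 1))
    else (\<lambda>z. - (1 / (2 * pi)) * mRe (Lambda C n z) $ a $ b))" for l :: nat
  have arc: "finite_measure arc_length" "sets arc_length = sets circle_borel"
    by (rule finite_measure_arc_length sets_arc_length)+
  have NS: "N \<subseteq> sphere 0 1" using N_sphere by auto
  note remove = integral_remove_atoms[OF parts(1,2) finite_N NS]
  have split: "(\<Sum>l<5. f l) = (\<Sum>l<4. f l) + f 4" for f :: "nat \<Rightarrow> complex"
    by (simp add: numeral_eq_Suc)
  have "(\<Sum>l<5. \<integral>z. indicator B z *\<^sub>R h l z \<partial>M l) = 0"
  proof (rule trig_moments_unique[OF finite_lessThan _ _ _ B])
    show "sets (M l) = sets circle_borel" for l by (simp add: M_def parts arc)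
    show "integrable (M l) (h l)" for l
    proof (cases "l < 4")
      case True
      then have "integrable (parts a b l) (\<lambda>z. 1 * (if z \<in> N then 0 else 1) :: complex)"
        by (intro remove(2) integrable_continuous_circle parts) auto
      then have "integrable (parts a b l) (\<lambda>z. \<i> ^ l * (if z \<in> N then 0 else 1))"
        by (intro integrable_mult_right) simp
      then show ?thesis using True by (simp add: M_def h_def)
    next
      case False
      have "integrable arc_length (\<lambda>z. - (1 / (2 * pi)) * mRe (Lambda C n z) $ a $ b)"
        by (intro integrable_mult_right integrable_continuous_circle[OF arc] continuous_on_circle_mRe_Lambda)
      then show ?thesis using False by (simp add: M_def h_def)
    qed
    fix k :: int
    have "(\<integral>z. z powi k * (if z \<in> N then 0 else 1) \<partial>parts a b l) =
        (\<integral>z. z powi k \<partial>parts a b l) - (\<Sum>v\<in>N. v powi k * measure (parts a b l) {v})" if "l < 4" for l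
      using that by (intro remove(1) integrable_continuous_circle parts continuous_on_circle_powi)
    then have "(\<Sum>l<4. \<integral>z. z powi k * h l z \<partial>M l) =
        (\<Sum>l<4. \<i> ^ l * ((\<integral>z. z powi k \<partial>parts a b l) - (\<Sum>v\<in>N. v powi k * measure (parts a b l) {v})))"
      by (intro sum.cong refl) (simp add: h_def M_def mult.left_commute[of _ "\<i> ^ _"])
    also have "\<dots> = C (- k) $ a $ b - (\<Sum>l<4. \<Sum>v\<in>N. v powi k * (\<i> ^ l * measure (parts a b l) {v}))"
      unfolding parts(4) right_diff_distrib sum_subtractf sum_distrib_left
      by (simp add: mult.left_commute)
    also have "(\<Sum>l<4. \<Sum>v\<in>N. v powi k * (\<i> ^ l * measure (parts a b l) {v})) =
        (\<Sum>v\<in>N. v powi k * (\<Sum>l<4. \<i> ^ l * measure (parts a b l) {v}))"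
      by (subst sum.swap) (simp add: sum_distrib_left)
    also have "\<dots> = (\<Sum>v\<in>N. v powi k * Xres C n v $ a $ b)"
    proof (intro sum.cong refl arg_cong2[where f="(*)"])
      fix v assume v: "v \<in> N"
      have "{v} \<in> sets circle_borel"
        unfolding circle_borel_def sets_restrict_space using N_sphere[OF v] by auto
      from parts(3)[OF this, of a b]
      show "(\<Sum>l<4. \<i> ^ l * complex_of_real (measure (parts a b l) {v})) = Xres C n v $ a $ b"
        using pole_at_N(1)[OF v] by simp
    qed
    finally have "(\<Sum>l<4. \<integral>z. z powi k * h l z \<partial>M l) = moment (- k) $ a $ b"
      by (simp add: moment_nth)
    moreover have "(\<integral>z. z powi k * h 4 z \<partial>M 4) = - moment (- k) $ a $ b"
    proof -
      have "(\<integral>z. z powi k * h 4 z \<partial>M 4) =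
          (\<integral>z. - (1 / (2 * pi)) * (z powi (- (- k)) * mRe (Lambda C n z) $ a $ b) \<partial>arc_length)"
        by (simp add: h_def M_def)
      also have "\<dots> = - (1 / (2 * pi)) * (\<integral>z. z powi (- (- k)) * mRe (Lambda C n z) $ a $ b \<partial>arc_length)"
        by (rule integral_mult_right_zero)
      also have "\<dots> = - moment (- k) $ a $ b" unfolding mRe_Lambda_fourier by simp
      finally show ?thesis .
    qed
    ultimately show "(\<Sum>l<5. \<integral>z. z powi k * h l z \<partial>M l) = 0" unfolding split by simp
  qed
  moreover have "(\<Sum>l<4. \<integral>z. indicator B z *\<^sub>R h l z \<partial>M l) =
      (\<Sum>l<4. \<i> ^ l * (\<integral>z. indicator B z * (if z \<in> N then 0 else 1) \<partial>parts a b l))"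
  proof (intro sum.cong refl)
    fix l :: nat assume "l \<in> {..<4}"
    then have "(\<integral>z. indicator B z *\<^sub>R h l z \<partial>M l) =
        (\<integral>z. \<i> ^ l * (indicator B z * (if z \<in> N then 0 else 1)) \<partial>parts a b l)"
      by (intro Bochner_Integration.integral_cong) (simp_all add: h_def M_def indicator_def)
    then show "(\<integral>z. indicator B z *\<^sub>R h l z \<partial>M l) =
        \<i> ^ l * (\<integral>z. indicator B z * (if z \<in> N then 0 else 1) \<partial>parts a b l)"
      by (simp only: integral_mult_right_zero)
  qed
  moreover have "(\<integral>z. indicator B z *\<^sub>R h 4 z \<partial>M 4) =
      - ((1 / (2 * pi)) * (LINT z:B|arc_length. mRe (Lambda C n z) $ a $ b))"
  proof -
    have "(\<integral>z. indicator B z *\<^sub>R h 4 z \<partial>M 4) =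
        (\<integral>z. - (1 / (2 * pi)) * (indicator B z *\<^sub>R mRe (Lambda C n z) $ a $ b) \<partial>arc_length)"
      by (simp add: h_def M_def)
    also have "\<dots> = - (1 / (2 * pi)) * (LINT z:B|arc_length. mRe (Lambda C n z) $ a $ b)"
      unfolding set_lebesgue_integral_def by (rule integral_mult_right_zero)
    finally show ?thesis by simp
  qed
  ultimately show ?thesis unfolding split by simp
qed

text \<open>Restoring the atoms: for each part, its mass on \<open>B\<close> minus its atoms in
  \<open>B \<inter> N\<close> is the integral handled by \<open>absolutely_continuous_part\<close>,
  and the atoms add up to the \<open>Xres\<close> terms.\<close>

lemma spectral_measure_nth:
  assumes B: "B \<in> sets circle_borel"
  shows "\<mu> B $ a $ b = (1 / (2 * pi)) * (LINT z:B|arc_length. mRe (Lambda C n z) $ a $ b) +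
    (\<Sum>v\<in>N. indicator B v * Xres C n v $ a $ b)"
proof -
  have NS: "N \<subseteq> sphere 0 1" using N_sphere by auto
  have "(\<Sum>l<4. \<i> ^ l * (\<integral>z. indicator B z * (if z \<in> N then 0 else 1) \<partial>parts a b l)) =
      (\<Sum>l<4. \<i> ^ l * (complex_of_real (measure (parts a b l) B) -
        (\<Sum>v\<in>N. indicator B v * complex_of_real (measure (parts a b l) {v}))))"
  proof (intro sum.cong refl arg_cong2[where f="(*)"])
    fix l :: nat assume "l \<in> {..<4}"
    then have l: "finite_measure (parts a b l)" "sets (parts a b l) = sets circle_borel"
      using parts by auto
    interpret finite_measure "parts a b l" by (rule l)
    have Bl: "B \<in> sets (parts a b l)" using B l by simp
    have "integrable (parts a b l) (\<lambda>z. complex_of_real (indicator B z))"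
      using Bl by (intro integrable_of_real integrable_real_indicator) (auto simp: less_top[symmetric])
    then have int: "integrable (parts a b l) (indicator B :: complex \<Rightarrow> complex)"
      by (simp add: of_real_indicator)
    have "(\<integral>z. complex_of_real (indicator B z) \<partial>parts a b l) = measure (parts a b l) B"
      using Bl sets.sets_into_space[OF Bl] by (simp add: Int_absorb2)
    then have "(\<integral>z. indicator B z \<partial>parts a b l) = complex_of_real (measure (parts a b l) B)"
      by (simp add: of_real_indicator)
    then show "(\<integral>z. indicator B z * (if z \<in> N then 0 else 1) \<partial>parts a b l) =
        complex_of_real (measure (parts a b l) B) - (\<Sum>v\<in>N. indicator B v * complex_of_real (measure (parts a b l) {v}))"
      using integral_remove_atoms(1)[OF l finite_N NS int] by simp
  qed
  also have "\<dots> = \<mu> B $ a $ b - (\<Sum>l<4. \<Sum>v\<in>N. indicator B v * (\<i> ^ l * complex_of_real (measure (parts a b l) {v})))"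
    unfolding parts(3)[OF B] right_diff_distrib sum_subtractf sum_distrib_left
    by (simp add: mult.left_commute)
  also have "(\<Sum>l<4. \<Sum>v\<in>N. indicator B v * (\<i> ^ l * complex_of_real (measure (parts a b l) {v}))) =
      (\<Sum>v\<in>N. indicator B v * (\<Sum>l<4. \<i> ^ l * complex_of_real (measure (parts a b l) {v})))"
    by (subst sum.swap) (simp add: sum_distrib_left)
  also have "\<dots> = (\<Sum>v\<in>N. indicator B v * Xres C n v $ a $ b)"
  proof (intro sum.cong refl arg_cong2[where f="(*)"])
    fix v assume v: "v \<in> N"
    have "{v} \<in> sets circle_borel"
      unfolding circle_borel_def sets_restrict_space using N_sphere[OF v] by auto
    from parts(3)[OF this, of a b]
    show "(\<Sum>l<4. \<i> ^ l * complex_of_real (measure (parts a b l) {v})) = Xres C n v $ a $ b"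
      using pole_at_N(1)[OF v] by simp
  qed
  finally show ?thesis unfolding absolutely_continuous_part[OF B] by (simp add: algebra_simps)
qed

text \<open>Taking an entry is a bounded linear map, so it commutes with the matrix-valued Bochner
  integral.\<close>

lemma set_integral_mRe_Lambda_nth:
  assumes "B \<in> sets circle_borel"
  shows "(LINT z:B|arc_length. mRe (Lambda C n z)) $ a $ b =
    (LINT z:B|arc_length. mRe (Lambda C n z) $ a $ b)"
proof -
  have "continuous_on (sphere 0 1) (\<lambda>z. \<chi> a b. mRe (Lambda C n z) $ a $ b)"
    by (intro continuous_on_vec_lambda continuous_on_circle_mRe_Lambda)
  then have "integrable arc_length (\<lambda>z. mRe (Lambda C n z))"
    using integrable_continuous_circle[OF finite_measure_arc_length sets_arc_length] by simp
  then have int: "integrable arc_length (\<lambda>z. indicat_real B z *\<^sub>R mRe (Lambda C n z))"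
    using assms by (intro integrable_mult_indicator) (simp_all add: sets_arc_length)
  have "bounded_linear (\<lambda>A :: complex^'q^'q. A $ a $ b)"
    using bounded_linear_compose[OF bounded_linear_vec_nth bounded_linear_vec_nth] .
  from integral_bounded_linear[OF this int]
  show ?thesis by (simp add: set_lebesgue_integral_def)
qed

lemma spectral_measure_representation:
  assumes B: "B \<in> sets circle_borel"
  shows "\<mu> B = (1 / (2 * pi)) *\<^sub>R (LINT z:B|arc_length. mRe (Lambda C n z)) +
    (\<Sum>v\<in>N. indicat_real B v *\<^sub>R Xres C n v)"
proof -
  have "\<mu> B $ a $ b = ((1 / (2 * pi)) *\<^sub>R (LINT z:B|arc_length. mRe (Lambda C n z)) +
      (\<Sum>v\<in>N. indicat_real B v *\<^sub>R Xres C n v)) $ a $ b" for a b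
    unfolding spectral_measure_nth[OF B]
    by (simp add: set_integral_mRe_Lambda_nth[OF B] sum_component
        scaleR_conv_of_real[where 'a = complex] of_real_indicator)
  then show ?thesis by (simp add: vec_eq_iff)
qed

end

theorem theorem6p2:
  fixes g :: "int \<Rightarrow> ('h::complex_hilbert)^('q::finite)"
    and n :: nat
    and \<mu> :: "complex set \<Rightarrow> complex^'q^'q"
  assumes "stationary g"
    and "1 \<le> n"
    and "autoregressive g"
    and "ar_order g = n"
    and "spectral_measure g \<mu>"
  shows "(\<forall>u\<in>sphere 0 1. \<forall>i j. (\<lambda>z. Lambda (covariance g) n z $ i $ j) analytic_on {u}) \<and>
    (\<forall>B\<in>sets circle_borel.
      \<mu> B = (1 / (2 * pi)) *\<^sub>R (LINT \<zeta>:B|arc_length. mRe (Lambda (covariance g) n \<zeta>)) +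
        (\<Sum>v\<in>Nset (covariance g) n. indicat_real B v *\<^sub>R Xres (covariance g) n v))"
proof -
  \<comment> \<open>As \<open>n \<ge> 1\<close>, the order comes from the \<open>LEAST\<close>
    branch of \<open>ar_order\<close>, not from the default 0.\<close>
  have n: "n = (LEAST n. 1 \<le> n \<and> predictor g n = full_predictor g)"
    using assms(2,4) by (auto simp: ar_order_def split: if_splits)
  have "\<exists>n. 1 \<le> n \<and> predictor g n = full_predictor g"
    using assms(3) by (simp add: autoregressive_def)
  from LeastI_ex[OF this, folded n] have "predictor g n = full_predictor g" by simp
  then interpret autoregressive_spectral g n \<mu>
    using assms by unfold_locales
  show ?thesis
    using Lambda_circle spectral_measure_representation by simp
qed

end
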